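(* Let $w:\mathbb{R}\to[0,\infty)$ be an even Schwartz function, not identically zero. Suppose that $w$ is regular, i.e. the sequence $r_m=r_m(w)$ has a limit $r\in[1,\infty]$ as $m\to\infty$. Then the probability measures $\boldsymbol{\sigma}_m=\boldsymbol{\sigma}_m(w)$ satisfy $$\lim_{m\to\infty}\boldsymbol{\sigma}_m=\gamma_{\frac{r+1}{r}}$$ in the sense of weak convergence, where $\frac{r+1}{r}:=1$ if $r=\infty$.
   Context: For $m\ge2$ set $$s_m=\frac1{(2\pi)^m}\int_{\mathbb{R}^m}w(|x|)dx,\quad d_m=\frac1{(2\pi)^m}\int_{\mathbb{R}^m}x_1^2w(|x|)dx,\quad h_m=\frac1{(2\pi)^m}\int_{\mathbb{R}^m}x_1^2x_2^2w(|x|)dx,$$ $q_m=\frac{s_mh_m}{d_m^2}$, $r_m=\max(1,q_m)$, $\boldsymbol{\omega}_m\ge0$ is defined by $r_m=\frac{(s_m+\boldsymbol{\omega}_m)h_m}{d_m^2}$, and $\check{s}_m=s_m+\boldsymbol{\omega}_m$. $\gamma_v$ is the centered Gaussian measure (or density) on $\mathbb{R}$ with variance $v>0$, $\gamma_0=\delta_0$; $*$ is convolution. $\mathrm{GOE}_N^v$ is the space of real symmetric $N\times N$ matrices with the Gaussian measure for which the entries $a_{ij}$, $i\le j$, are independent centered normal with $\mathrm{var}(a_{ii})=2v$ and $\mathrm{var}(a_{ij})=v$ for $i<j$; $\rho_{N,v}$ is determined by $\int_{\mathbb{R}}f\rho_{N,v}\,d\lambda=\frac1N\boldsymbol{E}_{\mathrm{GOE}_N^v}(\mathrm{tr}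 f(A))$ for all bounded continuous $f$; $\theta^{\pm}_{N,v}(x)=\rho_{N,v}(x)e^{\pm x^2/(4v)}$. $\check{\boldsymbol{\sigma}}_m$ is the probability measure on $\mathbb{R}$ proportional to $(\gamma_{r_m-1}*\theta^+_{m+1,r_m})(y)\gamma_1(y)dy$; equivalently, proportional to $(\theta^-_{m+1,1/r_m}*\gamma_{(r_m-1)/r_m})(y)dy$. $\boldsymbol{\sigma}_m$ is the unique probability measure on $\mathbb{R}$ with $\gamma_{\boldsymbol{\omega}_m/\check{s}_m}*\boldsymbol{\sigma}_m=\check{\boldsymbol{\sigma}}_m$. It exists because it is the weak limit as $\varepsilon\to0$, for any compact connected Riemannian $m$-manifold $(M,g)$ of unit volume, of the measures $\frac1{\boldsymbol{N}^\varepsilon}(\mathcal{R}_{(\check{s}_m\varepsilon^{-m})^{-1/2}})_*\boldsymbol{\sigma}^\varepsilon$, where $\boldsymbol{\sigma}^\varepsilon$ is the expected distribution of critical values (counted with multiplicity) of the random function $\boldsymbol{u}^\varepsilon=\sum_kX_k\sqrt{w(\varepsilon\sqrt{\lambda_k})}\Psi_k$ ($X_k$ independent standard Gaussians, $(\Psi_k)$ an orthonormal eigenbasis of the Laplacian with eigenvalues $\lambda_k$), $\boldsymbol{N}^\varepsilon=\boldsymbol{\sigma}^\varepsilon(\mathbb{R})$ and $\mathcal{R}_t(x)=tx$. *)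

theory Defs
  imports "HOL-Probability.Probability" "Jordan_Normal_Form.Char_Poly"
begin

definition schwartz :: "(real \<Rightarrow> real) \<Rightarrow> bool" where
  "schwartz f \<longleftrightarrow>
     (\<forall>k x. ((deriv ^^ k) f) field_differentiable (at x)) \<and>
     (\<forall>j k. bounded (range (\<lambda>x. x ^ j * (deriv ^^ k) f x)))"

text \<open>
  The dimension \<open>m\<close> varies, so \<open>\<real>\<^sup>m\<close> is the set of coordinate functions on
  \<open>{1..m}\<close>, with the product of \<open>m\<close> copies of Lebesgue measure.
\<close>

definition lebesgue_pow :: "nat \<Rightarrow> (nat \<Rightarrow> real) measure" where
  "lebesgue_pow m = Pi\<^sub>M {1..m} (\<lambda>_. lborel)"

definition eucl_norm :: "nat \<Rightarrow> (nat \<Rightarrow> real) \<Rightarrow> real" where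
  "eucl_norm m x = sqrt (\<Sum>i\<in>{1..m}. (x i)\<^sup>2)"

text \<open>The constants attached to \<open>w\<close> are meant for \<open>m \<ge> 2\<close>; smaller \<open>m\<close> give unspecified values.\<close>

definition s_const :: "(real \<Rightarrow> real) \<Rightarrow> nat \<Rightarrow> real" where
  "s_const w m = 1 / (2 * pi) ^ m * (\<integral>x. w (eucl_norm m x) \<partial>lebesgue_pow m)"

definition d_const :: "(real \<Rightarrow> real) \<Rightarrow> nat \<Rightarrow> real" where
  "d_const w m = 1 / (2 * pi) ^ m * (\<integral>x. (x 1)\<^sup>2 * w (eucl_norm m x) \<partial>lebesgue_pow m)"

definition h_const :: "(real \<Rightarrow> real) \<Rightarrow> nat \<Rightarrow> real" where
  "h_const w m =
     1 / (2 * pi) ^ m * (\<integral>x. (x 1)\<^sup>2 * (x 2)\<^sup>2 * w (eucl_norm m x) \<partial>lebesgue_pow m)"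

definition q_const :: "(real \<Rightarrow> real) \<Rightarrow> nat \<Rightarrow> real" where
  "q_const w m = s_const w m * h_const w m / (d_const w m)\<^sup>2"

definition r_const :: "(real \<Rightarrow> real) \<Rightarrow> nat \<Rightarrow> real" where
  "r_const w m = max 1 (q_const w m)"

text \<open>The solution \<open>\<omega>\<close> of the equation \<open>r = (s + \<omega>) * h / d\<^sup>2\<close>; it is nonnegative since \<open>r \<ge> q\<close>.\<close>

definition omega_const :: "(real \<Rightarrow> real) \<Rightarrow> nat \<Rightarrow> real" where
  "omega_const w m = r_const w m * (d_const w m)\<^sup>2 / h_const w m - s_const w m"

definition s_check :: "(real \<Rightarrow> real) \<Rightarrow> nat \<Rightarrow> real" where
  "s_check w m = s_const w m + omega_const w m"

text \<open>The parameter is the variance, whereas \<^const>\<open>normal_density\<close> takes the standard deviation.\<close>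

definition gauss_measure :: "real \<Rightarrow> real measure" where
  "gauss_measure v =
     (if v = 0 then return borel 0
      else density lborel (\<lambda>x. ennreal (normal_density 0 (sqrt v) x)))"

text \<open>
  A real symmetric matrix is parametrized by its entries \<open>a (i, j)\<close> with \<open>i \<le> j\<close>, and the
  Gaussian ensemble is the law of these independent entries.
\<close>

definition goe_entries :: "nat \<Rightarrow> real \<Rightarrow> (nat \<times> nat \<Rightarrow> real) measure" where
  "goe_entries N v =
     Pi\<^sub>M {(i, j). i \<le> j \<and> j < N} (\<lambda>(i, j). gauss_measure (if i = j then 2 * v else v))"

definition sym_mat :: "nat \<Rightarrow> (nat \<times> nat \<Rightarrow> real) \<Rightarrow> real mat" where
  "sym_mat N a = mat N N (\<lambda>(i, j). a (min i j, max i j))"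

text \<open>
  \<open>tr f(A)\<close> for a real symmetric matrix \<open>A\<close>: the sum of \<open>f\<close> over the eigenvalues of \<open>A\<close>
  (all of them real), counted with multiplicity.
\<close>

definition trace_fun :: "(real \<Rightarrow> real) \<Rightarrow> real mat \<Rightarrow> real" where
  "trace_fun f A = (\<Sum>x\<in>#proots (char_poly A). f x)"

definition is_goe_density :: "nat \<Rightarrow> real \<Rightarrow> (real \<Rightarrow> real) \<Rightarrow> bool" where
  "is_goe_density N v \<rho> \<longleftrightarrow>
     integrable lborel \<rho> \<and> (\<forall>x. 0 \<le> \<rho> x) \<and>
     (\<forall>f. continuous_on UNIV f \<and> bounded (range f) \<longrightarrow>
        (\<integral>x. f x * \<rho> x \<partial>lborel) =
          1 / real N * (\<integral>a. trace_fun f (sym_mat N a) \<partial>goe_entries N v))"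

text \<open>
  The condition determines the density up to null sets; the measures defined from it below do
  not depend on the version chosen.
\<close>

definition goe_density :: "nat \<Rightarrow> real \<Rightarrow> real \<Rightarrow> real" where
  "goe_density N v = (SOME \<rho>. is_goe_density N v \<rho>)"

definition theta_plus :: "nat \<Rightarrow> real \<Rightarrow> real \<Rightarrow> real" where
  "theta_plus N v x = goe_density N v x * exp (x\<^sup>2 / (4 * v))"

text \<open>
  Convolution of a measure with a function. The library's \<open>convolution\<close> is for two measures,
  but \<^const>\<open>theta_plus\<close> need not be integrable.
\<close>

definition conv_fun :: "real measure \<Rightarrow> (real \<Rightarrow> real) \<Rightarrow> real \<Rightarrow> real" where
  "conv_fun \<mu> f y = (\<integral>x. f (y - x) \<partial>\<mu>)"

definition sigma_check_weight :: "(real \<Rightarrow> real) \<Rightarrow> nat \<Rightarrow> real \<Rightarrow> real" where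
  "sigma_check_weight w m y =
     conv_fun (gauss_measure (r_const w m - 1)) (theta_plus (m + 1) (r_const w m)) y *
     normal_density 0 1 y"

definition sigma_check :: "(real \<Rightarrow> real) \<Rightarrow> nat \<Rightarrow> real measure" where
  "sigma_check w m =
     density lborel
       (\<lambda>y. ennreal (sigma_check_weight w m y / (\<integral>z. sigma_check_weight w m z \<partial>lborel)))"

definition sigma_meas :: "(real \<Rightarrow> real) \<Rightarrow> nat \<Rightarrow> real measure" where
  "sigma_meas w m =
     (THE \<sigma>. real_distribution \<sigma> \<and>
        convolution (gauss_measure (omega_const w m / s_check w m)) \<sigma> = sigma_check w m)"

end

theory Submission
  imports Defs "HOL-Complex_Analysis.Complex_Analysis" "HOL-Real_Asymp.Real_Asymp"
begin

text \<open>Put \<open>N = m + 1\<close>. Completing squares and rescaling, the characteristic function of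
  \<open>\<sigma>\<^sub>m\<close> is, up to explicit Gaussian factors, the quotient of the expected trace of
  \<open>exp (- A\<^sup>2 / 4 + i s A)\<close> over the Gaussian orthogonal ensemble of variance one by its value at
  \<open>s = 0\<close>. The Gaussian measure of variance \<open>\<omega>\<^sub>m / (s\<^sub>m + \<omega>\<^sub>m)\<close> can be divided out because
  \<open>q\<^sub>m > m / (m + 2)\<close>, by the strict Cauchy-Schwarz inequality for the radial moments, and because
  the spectrum is that of the traceless part smoothed by an independent Gaussian.

  For the asymptotics, integration by parts and the Poincare inequality show that the expected trace
  \<open>g\<close> of the resolvent at height \<open>Im z = 1\<close> nearly solves \<open>N + z g + g\<^sup>2 = 0\<close>, so that
  \<open>g / \<surd>N\<close> tends to \<open>\<i>\<close>: at unit scale the spectrum is asymptotically uniform. Cauchy's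
  formula on the strip \<open>\<bar>Im z\<bar> \<le> 1\<close> turns this into \<open>e\<^bsup>-s\<^sup>2\<^esup>\<close> for the quotient, and Levy's
  continuity theorem concludes.\<close>

section \<open>Gaussian measures and normal densities\<close>

text \<open>The weight \<open>exp (- x\<^sup>2 / 4)\<close> sees only eigenvalues at distance of
  order 1 from 0, a vanishing part of a spectrum of width of order \<open>sqrt N\<close>. The global
  semicircle law says nothing at that scale, so a local law is needed. A soft one suffices because
  the test function is entire: Cauchy's formula moves the problem to height 1, where resolvent
  entries are bounded by 1 and the loop equation has an error of order \<open>Im g\<close>, that is
  \<open>sqrt N\<close> against main terms of order N.

  The Gaussian to be divided out has variance \<open>1 - q / r\<close>, which is nonzero only if
  \<open>r = 1\<close> and is then less than \<open>1 - m / (m + 2) = 2 / (N + 1)\<close>. On the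
  other side, the normalized trace of the unit ensemble smooths the traceless spectrum with variance
  \<open>2 / N\<close>, and the weight \<open>exp (- x\<^sup>2 / 4)\<close> adds
  \<open>1 / 2\<close> to the precision \<open>N / 2\<close>, which leaves variance
  \<open>2 / (N + 1)\<close>. The two bounds meet exactly, and strictness leaves a positive
  variance.

  In the limit the outer smoothing contributes \<open>(r - 1) / r\<close> to the variance, and the
  flat spectrum, through \<open>exp (- s\<^sup>2)\<close> at \<open>s = t / sqrt r\<close>,
  contributes \<open>2 / r\<close>.\<close>

lemma sets_gauss_measure [simp, measurable_cong]: "sets (gauss_measure v) = sets borel"
  by (simp add: gauss_measure_def)

lemma space_gauss_measure [simp]: "space (gauss_measure v) = UNIV"
  by (simp add: gauss_measure_def)

lemma prob_space_gauss_measure: "0 \<le> v \<Longrightarrow> prob_space (gauss_measure v)"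
  by (auto simp: gauss_measure_def prob_space_return intro!: prob_space_normal_density)

lemma real_distribution_gauss_measure: "0 \<le> v \<Longrightarrow> real_distribution (gauss_measure v)"
  by (simp add: real_distribution_def real_distribution_axioms_def prob_space_gauss_measure)

lemma integral_gauss_measure:
  fixes f :: "real \<Rightarrow> 'a::{banach, second_countable_topology}"
  assumes "0 < v" and [measurable]: "f \<in> borel_measurable borel"
  shows "(\<integral>x. f x \<partial>gauss_measure v) = (\<integral>x. normal_density 0 (sqrt v) x *\<^sub>R f x \<partial>lborel)"
  using assms(1) by (simp add: gauss_measure_def integral_density)

lemma integrable_gauss_measure:
  fixes f :: "real \<Rightarrow> 'a::{banach, second_countable_topology}"
  assumes "0 < v" and [measurable]: "f \<in> borel_measurable borel"
  shows "integrable (gauss_measure v) f \<longleftrightarrow> integrable lborel (\<lambda>x. normal_density 0 (sqrt v) x *\<^sub>R f x)"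
  using assms(1) by (simp add: gauss_measure_def integrable_density)

text \<open>The substitution \<open>x = m + s * y\<close> reduces the integral to the characteristic
  function of the standard normal law.\<close>

lemma iexp_normal_density:
  assumes "0 < s"
  shows "integrable lborel (\<lambda>x. normal_density m s x *\<^sub>R iexp (t * x))"
    and "(\<integral>x. normal_density m s x *\<^sub>R iexp (t * x) \<partial>lborel) = iexp (t * m) * of_real (exp (- s\<^sup>2 * t\<^sup>2 / 2))"
proof -
  have eq: "std_normal_density x *\<^sub>R iexp (t * (m + s * x)) = iexp (t * m) * (std_normal_density x *\<^sub>R iexp ((s * t) * x))" for x
    by (simp add: exp_add[symmetric] algebra_simps scaleR_conv_of_real)
  have int: "integrable lborel (\<lambda>x. normal_density m s x *\<^sub>R iexp (t * x))"
    if "0 < s" for m s t :: real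
    by (rule Bochner_Integration.integrable_bound[OF integrable_normal_density[OF that]]) auto
  show "integrable lborel (\<lambda>x. normal_density m s x *\<^sub>R iexp (t * x))"
    by (rule int[OF assms])
  have "(\<integral>x. normal_density m s x *\<^sub>R iexp (t * x) \<partial>lborel) =
    \<bar>s\<bar> *\<^sub>R (\<integral>x. normal_density m s (m + s * x) *\<^sub>R iexp (t * (m + s * x)) \<partial>lborel)"
    using assms by (intro lborel_integral_real_affine) simp
  also have "\<dots> = (\<integral>x. std_normal_density x *\<^sub>R iexp (t * (m + s * x)) \<partial>lborel)"
  proof -
    have "s * normal_density m s (m + s * x) = std_normal_density x" for x
      using assms by (simp add: normal_density_def power_mult_distrib real_sqrt_mult field_simps)
    then show ?thesis using assms
      by (simp add: integral_scaleR_right[symmetric] del: integral_scaleR_right)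
  qed
  also have "\<dots> = iexp (t * m) * (\<integral>x. std_normal_density x *\<^sub>R iexp ((s * t) * x) \<partial>lborel)"
    unfolding eq by (rule integral_mult_right_zero)
  also have "(\<integral>x. std_normal_density x *\<^sub>R iexp ((s * t) * x) \<partial>lborel) = char std_normal_distribution (s * t)"
    unfolding char_def by (subst integral_density) auto
  finally show "(\<integral>x. normal_density m s x *\<^sub>R iexp (t * x) \<partial>lborel) = iexp (t * m) * of_real (exp (- s\<^sup>2 * t\<^sup>2 / 2))"
    by (simp add: char_std_normal_distribution power_mult_distrib)
qed

text \<open>The Dirac mass at variance 0 obeys the same formula, so the deconvolution can treat
  \<omega> = 0 together with positive \<omega>.\<close>

lemma char_gauss_measure:
  assumes "0 \<le> v"
  shows "char (gauss_measure v) t = of_real (exp (- v * t\<^sup>2 / 2))"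
proof (cases "v = 0")
  case True
  then show ?thesis by (simp add: char_def gauss_measure_def integral_return)
next
  case False
  with assms have v: "0 < v" by simp
  then show ?thesis
    unfolding char_def using iexp_normal_density(2)[of "sqrt v" 0 t]
    by (simp add: integral_gauss_measure)
qed

lemma DERIV_normal_density:
  assumes "0 < v"
  shows "(normal_density 0 (sqrt v) has_real_derivative - (x / v) * normal_density 0 (sqrt v) x) (at x)"
  unfolding normal_density_def using assms
  by (auto intro!: derivative_eq_intros simp: field_simps)

lemma normal_density_tendsto_0:
  assumes "0 < v"
  shows "(normal_density 0 (sqrt v) \<longlongrightarrow> 0) at_top" "(normal_density 0 (sqrt v) \<longlongrightarrow> 0) at_bot"
  unfolding normal_density_def using assms by real_asymp+

text \<open>Integration by parts: \<open>F'\<close> is the derivative of the density times f, which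
  vanishes at both ends. Values in a Euclidean space cover both uses, real in the Poincare
  inequality and complex for the resolvent.\<close>

lemma gauss_measure_stein:
  fixes f f' :: "real \<Rightarrow> 'a::euclidean_space"
  assumes v: "0 < v"
    and der: "\<And>x. (f has_vector_derivative f' x) (at x)"
    and cont: "continuous_on UNIV f'"
    and bf: "\<And>x. norm (f x) \<le> B" and bf': "\<And>x. norm (f' x) \<le> B'"
  shows "(\<integral>x. x *\<^sub>R f x \<partial>gauss_measure v) = v *\<^sub>R (\<integral>x. f' x \<partial>gauss_measure v)"
proof -
  let ?n = "normal_density 0 (sqrt v)"
  define F where "F x = ?n x *\<^sub>R f x" for x
  define F' where "F' x = ?n x *\<^sub>R f' x - (1 / v) *\<^sub>R (x *\<^sub>R (?n x *\<^sub>R f x))" for x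
  have contf: "continuous_on UNIV f"
    using der by (meson continuous_at_imp_continuous_on has_vector_derivative_continuous)
  have [measurable]: "f \<in> borel_measurable borel" "f' \<in> borel_measurable borel"
    by (auto intro!: borel_measurable_continuous_onI contf cont)
  have contn: "continuous_on UNIV ?n"
    using DERIV_normal_density[OF v] by (meson DERIV_continuous continuous_at_imp_continuous_on)
  have F: "(F has_vector_derivative F' x) (at x)" for x
    unfolding F_def F'_def
    using DERIV_normal_density[OF v, of x] der[of x] v
    by (auto intro!: derivative_eq_intros simp: has_real_derivative_iff_has_vector_derivative algebra_simps)
  have contF': "isCont F' x" for x
    unfolding F'_def using contf cont contn v
    by (auto intro!: continuous_intros simp: continuous_on_eq_continuous_at)
  have B0: "0 \<le> B" "0 \<le> B'"
    using bf[of 0] bf'[of 0] norm_ge_zero order.trans by blast+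
  have int1: "integrable lborel (\<lambda>x. ?n x *\<^sub>R f' x)"
  proof (rule Bochner_Integration.integrable_bound[where f = "\<lambda>x. ?n x * B'"])
    show "AE x in lborel. norm (?n x *\<^sub>R f' x) \<le> norm (?n x * B')"
      using B0 bf' by (intro AE_I2) (simp add: abs_mult mult_left_mono)
  qed (use v in auto)
  have int2: "integrable lborel (\<lambda>x. x *\<^sub>R (?n x *\<^sub>R f x))"
  proof (rule Bochner_Integration.integrable_bound[where f = "\<lambda>x. (?n x * \<bar>x - 0\<bar> ^ 1) * B"])
    show "AE x in lborel. norm (x *\<^sub>R (?n x *\<^sub>R f x)) \<le> norm ((?n x * \<bar>x - 0\<bar> ^ 1) * B)"
    proof (rule AE_I2)
      fix x
      have "(?n x * \<bar>x\<bar>) * norm (f x) \<le> (?n x * \<bar>x\<bar>) * B"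
        using bf by (intro mult_left_mono) auto
      then show "norm (x *\<^sub>R (?n x *\<^sub>R f x)) \<le> norm ((?n x * \<bar>x - 0\<bar> ^ 1) * B)"
        using B0 by (simp add: abs_mult mult_ac)
    qed
    show "integrable lborel (\<lambda>x. (?n x * \<bar>x - 0\<bar> ^ 1) * B)"
      using integrable_normal_moment_abs[of "sqrt v" 0 1] v by (intro integrable_mult_left) simp
  qed auto
  have intF': "integrable lborel F'"
    unfolding F'_def by (intro Bochner_Integration.integrable_diff integrable_scaleR_right int1 int2)
  have lim: "(F \<longlongrightarrow> 0) G" if "(?n \<longlongrightarrow> 0) G" for G
  proof (rule Lim_null_comparison)
    show "\<forall>\<^sub>F x in G. norm (F x) \<le> B * ?n x"
      using bf by (auto simp: F_def mult.commute[of B] intro!: always_eventually mult_left_mono)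
    show "((\<lambda>x. B * ?n x) \<longlongrightarrow> 0) G"
      using tendsto_mult_right_zero[OF that] .
  qed
  have "(LBINT x=-\<infinity>..\<infinity>. F' x) = 0 - 0"
  proof (rule interval_integral_FTC_integrable[where F = F])
    show "((F \<circ> real_of_ereal) \<longlongrightarrow> 0) (at_right (- \<infinity>))"
      unfolding ereal_tendsto_simps1 by (intro lim normal_density_tendsto_0 v)
    show "((F \<circ> real_of_ereal) \<longlongrightarrow> 0) (at_left \<infinity>)"
      unfolding ereal_tendsto_simps1 by (intro lim normal_density_tendsto_0 v)
  qed (use F contF' intF' in \<open>auto simp: set_integrable_def\<close>)
  then have "(\<integral>x. F' x \<partial>lborel) = 0"
    by (simp add: interval_lebesgue_integral_def set_lebesgue_integral_def)
  then have "(\<integral>x. ?n x *\<^sub>R f' x \<partial>lborel) = (1 / v) *\<^sub>R (\<integral>x. x *\<^sub>R (?n x *\<^sub>R f x) \<partial>lborel)"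
    unfolding F'_def
    by (subst (asm) Bochner_Integration.integral_diff[OF int1 integrable_scaleR_right[OF int2]])
      (simp only: integral_scaleR_right right_minus_eq)
  then have "v *\<^sub>R (\<integral>x. ?n x *\<^sub>R f' x \<partial>lborel) = (\<integral>x. x *\<^sub>R (?n x *\<^sub>R f x) \<partial>lborel)"
    using v by simp
  then show ?thesis
    using v by (simp add: integral_gauss_measure mult.commute)
qed

text \<open>Applying Stein's identity to \<open>(f - f 0)\<^sup>2 / x\<close> gives the sharp Poincare inequality,
  since \<open>2 g g' / x - g\<^sup>2 / x\<^sup>2 \<le> g'\<^sup>2\<close>.\<close>

lemma gauss_measure_poincare_at_0:
  fixes f f' :: "real \<Rightarrow> real"
  assumes v: "0 < v"
    and der: "\<And>x. (f has_real_derivative f' x) (at x)"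
    and cont: "continuous_on UNIV f'"
    and bf: "\<And>x. \<bar>f x\<bar> \<le> B" and bf': "\<And>x. \<bar>f' x\<bar> \<le> L"
  shows "(\<integral>x. (f x - f 0)\<^sup>2 \<partial>gauss_measure v) \<le> v * (\<integral>x. (f' x)\<^sup>2 \<partial>gauss_measure v)"
proof -
  interpret prob_space "gauss_measure v" using v by (intro prob_space_gauss_measure) simp
  define g where "g x = f x - f 0" for x
  \<comment> \<open>The difference quotient of f at 0, completed by its limit; the bound L on the
    derivative bounds it.\<close>
  define h where "h x = (if x = 0 then f' 0 else g x / x)" for x
  have gh: "g x = x * h x" for x by (simp add: h_def g_def)
  have derg: "(g has_real_derivative f' x) (at x)" for x
    unfolding g_def using der[of x] by (auto intro!: derivative_eq_intros)
  have hL: "\<bar>h x\<bar> \<le> L" for x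
  proof (cases "x = 0")
    case False
    have "\<bar>g x - g 0\<bar> \<le> L * \<bar>x - 0\<bar>"
      using field_differentiable_bound[of UNIV g f' L 0 x] derg bf' by auto
    with False show ?thesis by (simp add: h_def g_def divide_simps abs_if split: if_splits)
  qed (use bf' in \<open>simp add: h_def\<close>)
  have h0: "h \<midarrow>0\<rightarrow> f' 0"
  proof -
    have "(\<lambda>x. (f x - f 0) / (x - 0)) \<midarrow>0\<rightarrow> f' 0"
      using der[of 0] unfolding has_field_derivative_iff by simp
    then show ?thesis
      by (rule Lim_transform_eventually) (auto simp: h_def g_def eventually_at intro!: exI[of _ 1])
  qed
  \<comment> \<open>Away from 0 this is \<open>(g x)\<^sup>2 / x\<close>; written with h it is
    differentiable at 0 as well.\<close>
  define G where "G x = x * (h x)\<^sup>2" for x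
  define G' where "G' x = 2 * h x * f' x - (h x)\<^sup>2" for x
  have conth: "isCont h x" for x
  proof (cases "x = 0")
    case True
    then show ?thesis using h0 by (simp add: isCont_def h_def)
  next
    case False
    have "isCont (\<lambda>x. g x / x) x"
      using False by (intro isCont_divide DERIV_isCont[OF derg]) auto
    then show ?thesis
      by (rule continuous_transform_within[where \<delta> = "\<bar>x\<bar>"]) (use False in \<open>auto simp: h_def dist_real_def\<close>)
  qed
  have derG: "(G has_real_derivative G' x) (at x)" for x
  proof (cases "x = 0")
    case True
    have "(\<lambda>x. (h x)\<^sup>2) \<midarrow>0\<rightarrow> (f' 0)\<^sup>2" by (intro tendsto_intros h0)
    then have "(\<lambda>x. (G x - G 0) / (x - 0)) \<midarrow>0\<rightarrow> (f' 0)\<^sup>2"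
      by (rule Lim_transform_eventually) (auto simp: G_def eventually_at intro!: exI[of _ 1])
    moreover have "G' 0 = (f' 0)\<^sup>2" by (simp add: G'_def h_def power2_eq_square)
    ultimately show ?thesis using True unfolding has_field_derivative_iff by simp
  next
    case False
    have "((\<lambda>x. (g x)\<^sup>2 / x) has_real_derivative G' x) (at x)"
      using derg[of x] False
      by (auto intro!: derivative_eq_intros simp: G'_def h_def power2_eq_square field_simps)
    then show ?thesis
      by (rule has_field_derivative_transform_within[where d = "\<bar>x\<bar>"])
        (use False in \<open>auto simp: G_def h_def power2_eq_square dist_real_def\<close>)
  qed
  have Gb: "norm (G x) \<le> 2 * B * L" for x
  proof -
    have "\<bar>g x\<bar> \<le> 2 * B" using bf[of x] bf[of 0] by (simp add: g_def abs_if split: if_splits)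
    then have "\<bar>g x\<bar> * \<bar>h x\<bar> \<le> 2 * B * L" using hL[of x] by (intro mult_mono) auto
    then show ?thesis by (simp add: G_def gh abs_mult power2_eq_square mult.assoc)
  qed
  have "\<bar>2 * h x * f' x\<bar> \<le> 2 * L * L" "(h x)\<^sup>2 \<le> L\<^sup>2" for x
    using hL[of x] bf'[of x] by (auto simp: abs_mult intro!: mult_mono abs_le_square_iff[THEN iffD1])
  then have G'b: "norm (G' x) \<le> 2 * L * L + L\<^sup>2" for x
    unfolding G'_def real_norm_def by (smt (verit) zero_le_power2)
  have contG': "continuous_on UNIV G'"
    unfolding G'_def by (intro continuous_intros cont) (simp_all add: continuous_at_imp_continuous_on conth)
  have "(\<integral>x. x *\<^sub>R G x \<partial>gauss_measure v) = v *\<^sub>R (\<integral>x. G' x \<partial>gauss_measure v)"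
    by (rule gauss_measure_stein[OF v _ contG' Gb G'b]) (use derG in \<open>simp add: has_real_derivative_iff_has_vector_derivative\<close>)
  moreover have "x *\<^sub>R G x = (f x - f 0)\<^sup>2" for x
    using gh[of x] by (simp add: G_def g_def power2_eq_square)
  moreover have "(\<integral>x. G' x \<partial>gauss_measure v) \<le> (\<integral>x. (f' x)\<^sup>2 \<partial>gauss_measure v)"
  proof (rule integral_mono)
    have [measurable]: "G' \<in> borel_measurable borel" "f' \<in> borel_measurable borel"
      using contG' cont by (auto intro!: borel_measurable_continuous_onI)
    show "integrable (gauss_measure v) G'"
      by (rule integrable_const_bound[where B = "2 * L * L + L\<^sup>2"]) (use G'b in auto)
    show "integrable (gauss_measure v) (\<lambda>x. (f' x)\<^sup>2)"
      by (rule integrable_const_bound[where B = "L\<^sup>2"]) (use bf' in \<open>auto intro!: abs_le_square_iff[THEN iffD1] order.trans[OF bf']\<close>)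
    fix x
    have "(f' x)\<^sup>2 - G' x = (f' x - h x)\<^sup>2" by (simp add: G'_def power2_eq_square algebra_simps)
    then show "G' x \<le> (f' x)\<^sup>2" by (smt (verit) zero_le_power2)
  qed
  ultimately show ?thesis using v by simp
qed

text \<open>The mean minimizes the second moment, so the inequality about the value at 0 passes to
  the variance. The complex case adds those for the real and the imaginary part.\<close>

lemma gauss_measure_poincare:
  fixes f f' :: "real \<Rightarrow> complex"
  assumes v: "0 < v"
    and der: "\<And>x. (f has_vector_derivative f' x) (at x)"
    and cont: "continuous_on UNIV f'"
    and bf: "\<And>x. cmod (f x) \<le> B" and bf': "\<And>x. cmod (f' x) \<le> L"
  shows "(\<integral>x. (cmod (f x - (\<integral>y. f y \<partial>gauss_measure v)))\<^sup>2 \<partial>gauss_measure v) \<le>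
    v * (\<integral>x. (cmod (f' x))\<^sup>2 \<partial>gauss_measure v)"
proof -
  interpret prob_space "gauss_measure v" using v by (intro prob_space_gauss_measure) simp
  have contf: "continuous_on UNIV f"
    using der by (meson continuous_at_imp_continuous_on has_vector_derivative_continuous)
  have [measurable]: "f \<in> borel_measurable borel" "f' \<in> borel_measurable borel"
    by (auto intro!: borel_measurable_continuous_onI contf cont)
  have bRe: "\<bar>Re (f x)\<bar> \<le> B" "\<bar>Im (f x)\<bar> \<le> B" "\<bar>Re (f' x)\<bar> \<le> L" "\<bar>Im (f' x)\<bar> \<le> L" for x
    using bf bf' abs_Re_le_cmod abs_Im_le_cmod order.trans by blast+
  have int: "integrable (gauss_measure v) (\<lambda>x. Re (f x))" "integrable (gauss_measure v) (\<lambda>x. Im (f x))"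
    "integrable (gauss_measure v) f"
    by (rule integrable_const_bound[where B = B]; use bRe bf in auto)+
  have sq: "integrable (gauss_measure v) (\<lambda>x. (Re (f' x))\<^sup>2)" "integrable (gauss_measure v) (\<lambda>x. (Im (f' x))\<^sup>2)"
    by (rule integrable_const_bound[where B = "L\<^sup>2"]; use bRe in \<open>auto intro!: abs_le_square_iff[THEN iffD1] order.trans[OF bRe(3)] order.trans[OF bRe(4)]\<close>)+
  have real: "variance u \<le> v * (\<integral>x. (u' x)\<^sup>2 \<partial>gauss_measure v)"
    if u: "\<And>x. (u has_real_derivative u' x) (at x)" "continuous_on UNIV u'"
      "\<And>x. \<bar>u x\<bar> \<le> B" "\<And>x. \<bar>u' x\<bar> \<le> L" for u u' :: "real \<Rightarrow> real"
  proof -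
    have [measurable]: "u \<in> borel_measurable borel"
      using u(1) by (intro borel_measurable_continuous_onI) (meson DERIV_continuous continuous_at_imp_continuous_on)
    have iu: "integrable (gauss_measure v) u"
      by (rule integrable_const_bound[where B = B]) (use u(3) in auto)
    have iu2: "integrable (gauss_measure v) (\<lambda>x. (u x)\<^sup>2)"
      by (rule integrable_const_bound[where B = "B\<^sup>2"])
        (use u(3) in \<open>auto intro!: abs_le_square_iff[THEN iffD1] order.trans[OF u(3)]\<close>)
    have "(\<integral>x. (u x - u 0)\<^sup>2 \<partial>gauss_measure v) = (\<integral>x. (u x)\<^sup>2 + ((u 0)\<^sup>2 - 2 * u 0 * u x) \<partial>gauss_measure v)"
      by (rule Bochner_Integration.integral_cong) (auto simp: power2_diff)
    also have "\<dots> = expectation (\<lambda>x. (u x)\<^sup>2) + ((u 0)\<^sup>2 - 2 * u 0 * expectation u)"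
      using iu iu2 by (subst Bochner_Integration.integral_add) (auto simp: prob_space[simplified])
    finally have "(\<integral>x. (u x - u 0)\<^sup>2 \<partial>gauss_measure v) - variance u = (u 0 - expectation u)\<^sup>2"
      using variance_eq[OF iu iu2] by (simp add: power2_eq_square algebra_simps)
    then have "variance u \<le> (\<integral>x. (u x - u 0)\<^sup>2 \<partial>gauss_measure v)"
      by (smt (verit) zero_le_power2)
    also have "\<dots> \<le> v * (\<integral>x. (u' x)\<^sup>2 \<partial>gauss_measure v)"
      by (rule gauss_measure_poincare_at_0[OF v u])
    finally show ?thesis .
  qed
  have d: "((\<lambda>x. Re (f x)) has_real_derivative Re (f' x)) (at x)"
    "((\<lambda>x. Im (f x)) has_real_derivative Im (f' x)) (at x)" for x
    unfolding has_real_derivative_iff_has_vector_derivative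
    by (rule bounded_linear.has_vector_derivative[OF bounded_linear_Re der]
        bounded_linear.has_vector_derivative[OF bounded_linear_Im der])+
  have var: "integrable (gauss_measure v) (\<lambda>x. (u x - c)\<^sup>2)"
    if "\<And>x. \<bar>u x\<bar> \<le> B" "u \<in> borel_measurable borel" for u :: "real \<Rightarrow> real" and c
  proof (rule integrable_const_bound[where B = "(B + \<bar>c\<bar>)\<^sup>2"])
    have "\<bar>u x - c\<bar> \<le> \<bar>B + \<bar>c\<bar>\<bar>" for x using that(1)[of x] by linarith
    then show "AE x in gauss_measure v. norm ((u x - c)\<^sup>2) \<le> (B + \<bar>c\<bar>)\<^sup>2"
      by (auto intro!: abs_le_square_iff[THEN iffD1])
  qed (use that(2) in measurable)
  have "(\<integral>x. (cmod (f x - (\<integral>y. f y \<partial>gauss_measure v)))\<^sup>2 \<partial>gauss_measure v)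
    = variance (\<lambda>x. Re (f x)) + variance (\<lambda>x. Im (f x))"
    using int by (subst Bochner_Integration.integral_add[symmetric]) (auto intro!: var bRe simp: cmod_power2)
  also have "\<dots> \<le> v * (\<integral>x. (Re (f' x))\<^sup>2 \<partial>gauss_measure v) + v * (\<integral>x. (Im (f' x))\<^sup>2 \<partial>gauss_measure v)"
    using d cont bRe by (intro add_mono real) (auto intro!: continuous_intros)
  also have "\<dots> = v * (\<integral>x. (cmod (f' x))\<^sup>2 \<partial>gauss_measure v)"
    using sq by (simp add: cmod_power2 distrib_left)
  finally show ?thesis .
qed

section \<open>Eigenvalues, traces and the resolvent\<close>

lemma sym_mat_carrier [simp]: "sym_mat N a \<in> carrier_mat N N"
  by (simp add: sym_mat_def)

lemma sym_mat_index [simp]: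
  "i < N \<Longrightarrow> j < N \<Longrightarrow> sym_mat N a $$ (i, j) = a (min i j, max i j)"
  by (simp add: sym_mat_def)

lemma mat_mult_index_sum:
  assumes "A \<in> carrier_mat n m" "B \<in> carrier_mat m k" "i < n" "j < k"
  shows "(A * B) $$ (i, j) = (\<Sum>l<m. A $$ (i, l) * B $$ (l, j))"
  using assms by (auto simp: scalar_prod_def lessThan_atLeast0 intro!: sum.cong)

lemma sum_mult_kronecker:
  fixes f :: "nat \<Rightarrow> 'a::semiring_1"
  assumes "k < N"
  shows "(\<Sum>i<N. f i * (if i = k then 1 else 0)) = f k" "(\<Sum>i<N. (if k = i then 1 else 0) * f i) = f k"
    "(\<Sum>i<N. f i * (if k = i then 1 else 0)) = f k" "(\<Sum>i<N. (if i = k then 1 else 0) * f i) = f k"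
  using assms by (simp_all add: if_distrib[of "\<lambda>x. _ * x"] if_distrib[of "\<lambda>x. x * _"] cong: if_cong)

text \<open>Over the complex numbers the characteristic polynomial splits, and the resolvent can be
  taken at nonreal points.\<close>

definition csym_mat :: "nat \<Rightarrow> (nat \<times> nat \<Rightarrow> real) \<Rightarrow> complex mat" where
  "csym_mat N a = map_mat complex_of_real (sym_mat N a)"

lemma csym_mat_carrier [simp]: "csym_mat N a \<in> carrier_mat N N"
  by (simp add: csym_mat_def)

lemma csym_mat_index [simp]:
  "i < N \<Longrightarrow> j < N \<Longrightarrow> csym_mat N a $$ (i, j) = of_real (a (min i j, max i j))"
  by (simp add: csym_mat_def sym_mat_def)

lemma csym_mat_dim [simp]: "dim_row (csym_mat N a) = N" "dim_col (csym_mat N a) = N"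
  using csym_mat_carrier[of N a] by (auto simp del: csym_mat_carrier)

abbreviation spec :: "nat \<Rightarrow> (nat \<times> nat \<Rightarrow> real) \<Rightarrow> real multiset" where
  "spec N a \<equiv> proots (char_poly (sym_mat N a))"

text \<open>Conjugation followed by an exchange of the two summation indices reproduces the
  form.\<close>

lemma Im_symmetric_form:
  fixes b :: "nat \<Rightarrow> nat \<Rightarrow> real" and x :: "nat \<Rightarrow> complex"
  assumes "\<And>i j. b i j = b j i"
  shows "Im (\<Sum>i<N. cnj (x i) * (\<Sum>j<N. of_real (b i j) * x j)) = 0"
proof -
  let ?S = "\<Sum>i<N. cnj (x i) * (\<Sum>j<N. of_real (b i j) * x j)"
  have "cnj ?S = (\<Sum>i<N. \<Sum>j<N. x i * (of_real (b i j) * cnj (x j)))"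
    by (simp add: sum_distrib_left)
  also have "\<dots> = (\<Sum>j<N. \<Sum>i<N. x i * (of_real (b i j) * cnj (x j)))"
    by (rule sum.swap)
  also have "\<dots> = ?S"
    by (simp add: sum_distrib_left assms mult_ac)
  finally show ?thesis
    by (simp only: Reals_cnj_iff[symmetric] complex_is_Real_iff)
qed

text \<open>Pair (B - z) x = y with x: the form of B is real, so the imaginary part sees only z.
  This one identity gives the reality of the eigenvalues (y = 0), the Ward identity (y a unit
  vector) and the bound on the squared resolvent (y a column of the resolvent).\<close>

lemma symmetric_resolvent_energy:
  fixes b :: "nat \<Rightarrow> nat \<Rightarrow> real" and x y :: "nat \<Rightarrow> complex"
  assumes "\<And>i j. b i j = b j i"
    and "\<And>i. i < N \<Longrightarrow> (\<Sum>j<N. of_real (b i j) * x j) - z * x i = y i"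
  shows "Im z * (\<Sum>i<N. (cmod (x i))\<^sup>2) = - Im (\<Sum>i<N. cnj (x i) * y i)"
proof -
  have "(\<Sum>i<N. cnj (x i) * y i) =
    (\<Sum>i<N. cnj (x i) * (\<Sum>j<N. of_real (b i j) * x j)) - z * (\<Sum>i<N. cnj (x i) * x i)"
    by (simp add: assms(2)[symmetric] algebra_simps sum_subtractf sum_distrib_left)
  moreover have "(\<Sum>i<N. cnj (x i) * x i) = of_real (\<Sum>i<N. (cmod (x i))\<^sup>2)"
    unfolding of_real_sum by (intro sum.cong refl) (simp only: complex_norm_square mult.commute)
  ultimately show ?thesis
    using Im_symmetric_form[of b x N, OF assms(1)] by (simp del: of_real_sum)
qed

lemma csym_mat_eigenvalue_real:
  assumes "eigenvalue (csym_mat N a) z"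
  shows "Im z = 0"
proof -
  obtain v where v: "v \<in> carrier_vec N" "v \<noteq> 0\<^sub>v N" "csym_mat N a *\<^sub>v v = z \<cdot>\<^sub>v v"
    using assms by (auto simp: eigenvalue_def eigenvector_def)
  have eq: "(\<Sum>j<N. of_real (a (min i j, max i j)) * v $ j) - z * v $ i = 0" if i: "i < N" for i
  proof -
    have "(csym_mat N a *\<^sub>v v) $ i = (\<Sum>j<N. of_real (a (min i j, max i j)) * v $ j)"
      using i v(1) by (auto simp: mult_mat_vec_def scalar_prod_def lessThan_atLeast0 intro!: sum.cong)
    then show ?thesis using v i by simp
  qed
  have "Im z * (\<Sum>i<N. (cmod (v $ i))\<^sup>2) = 0"
    using symmetric_resolvent_energy[where b = "\<lambda>i j. a (min i j, max i j)" and x = "\<lambda>j. v $ j" and y = "\<lambda>_. 0" and z = z and N = N] eq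
    by (simp add: min.commute max.commute)
  moreover obtain i where "i < N" "v $ i \<noteq> 0"
    using v(1,2) by (metis carrier_vecD eq_vecI index_zero_vec)
  then have "(\<Sum>i<N. (cmod (v $ i))\<^sup>2) \<noteq> 0"
    by (subst sum_nonneg_eq_0_iff) auto
  ultimately show ?thesis by simp
qed

lemma char_poly_csym_mat: "char_poly (csym_mat N a) = map_poly of_real (char_poly (sym_mat N a))"
  unfolding csym_mat_def by (rule of_real_hom.char_poly_hom[OF sym_mat_carrier])

lemma map_poly_of_real_linear_factors:
  "map_poly complex_of_real (\<Prod>b\<leftarrow>bs. [:- b, 1:]) = (\<Prod>b\<leftarrow>bs. [:- complex_of_real b, 1:])"
proof (induct bs)
  case (Cons b bs)
  have "map_poly complex_of_real ([:- b, 1:] * (\<Prod>b\<leftarrow>bs. [:- b, 1:])) =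
    map_poly complex_of_real [:- b, 1:] * map_poly complex_of_real (\<Prod>b\<leftarrow>bs. [:- b, 1:])"
    by (intro poly_eqI)
      (auto simp: coeff_map_poly coeff_mult coeff_pCons simp del: mult_pCons_left intro!: sum.cong split: nat.split)
  with Cons show ?case by (simp del: mult_pCons_left add: map_poly_pCons)
qed simp

text \<open>The complex roots are real, so the complex factorization is the image of a real one, and
  embedding the coefficients is injective.\<close>

lemma char_poly_sym_mat_factorized:
  "\<exists>bs. char_poly (sym_mat N a) = (\<Prod>b\<leftarrow>bs. [:- b, 1:]) \<and> length bs = N"
proof -
  obtain as where as: "char_poly (csym_mat N a) = (\<Prod>b\<leftarrow>as. [:- b, 1:])" "length as = N"
    using char_poly_factorized[OF csym_mat_carrier] by blast
  have "Im b = 0" if "b \<in> set as" for b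
  proof (rule csym_mat_eigenvalue_real)
    have "poly (char_poly (csym_mat N a)) b = 0"
      using that unfolding as by (force simp: poly_prod_list prod_list_zero_iff)
    then show "eigenvalue (csym_mat N a) b"
      by (simp add: eigenvalue_root_char_poly[OF csym_mat_carrier])
  qed
  then have "map complex_of_real (map Re as) = as"
    by (intro nth_equalityI) (auto simp: complex_eq_iff)
  then obtain bs where bs: "as = map complex_of_real bs" by metis
  have "map_poly complex_of_real (\<Prod>b\<leftarrow>bs. [:- b, 1:]) = (\<Prod>b\<leftarrow>as. [:- b, 1:])"
    unfolding bs by (simp add: map_poly_of_real_linear_factors comp_def)
  then have "map_poly complex_of_real (\<Prod>b\<leftarrow>bs. [:- b, 1:]) =
      map_poly complex_of_real (char_poly (sym_mat N a))"
    by (simp add: as(1)[symmetric] char_poly_csym_mat)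
  then show ?thesis
    using as(2) bs by (auto simp: poly_eq_iff coeff_map_poly intro!: exI[of _ bs])
qed

lemma proots_linear_factors: "proots (\<Prod>b\<leftarrow>bs. [:- b, 1:]) = mset (bs :: real list)"
proof (induct bs)
  case (Cons b bs)
  have "(\<Prod>b\<leftarrow>bs. [:- b, 1:]) \<noteq> 0"
    by (auto simp: prod_list_zero_iff)
  with Cons show ?case by (simp add: proots_mult del: mult_pCons_left)
qed simp

lemma obtain_spec:
  obtains bs where "char_poly (sym_mat N a) = (\<Prod>b\<leftarrow>bs. [:- b, 1:])" "length bs = N"
    "spec N a = mset bs"
  using char_poly_sym_mat_factorized proots_linear_factors by metis

lemma size_spec [simp]: "size (spec N a) = N"
  by (rule obtain_spec[of N a]) simp

text \<open>The junk value outside the resolvent set plays no role, as only nonreal \<open>z\<close> are used.\<close>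

definition resolvent :: "nat \<Rightarrow> (nat \<times> nat \<Rightarrow> real) \<Rightarrow> complex \<Rightarrow> nat \<Rightarrow> nat \<Rightarrow> complex" where
  "resolvent N a z i j =
     adj_mat (char_matrix (csym_mat N a) z) $$ (i, j) / Determinant.det (char_matrix (csym_mat N a) z)"

lemma char_matrix_csym_carrier [simp]: "char_matrix (csym_mat N a) z \<in> carrier_mat N N"
  by (simp add: char_matrix_def)

lemma char_matrix_csym_index:
  "i < N \<Longrightarrow> j < N \<Longrightarrow> char_matrix (csym_mat N a) z $$ (i, j) =
    of_real (a (min i j, max i j)) - (if i = j then z else 0)"
  by (simp add: char_matrix_def)

lemma det_char_matrix_csym:
  assumes "Im z \<noteq> 0"
  shows "Determinant.det (char_matrix (csym_mat N a) z) \<noteq> 0"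
  using csym_mat_eigenvalue_real[of N a z] assms eigenvalue_det[OF csym_mat_carrier, of N a z] by auto

lemma adj_mat_char_matrix_csym_carrier [simp]:
  "adj_mat (char_matrix (csym_mat N a) z) \<in> carrier_mat N N"
  by (rule adj_mat(1)[OF char_matrix_csym_carrier])

lemma resolvent_right:
  assumes z: "Im z \<noteq> 0" and "i < N" "k < N"
  shows "(\<Sum>j<N. of_real (a (min i j, max i j)) * resolvent N a z j k) - z * resolvent N a z i k
    = (if i = k then 1 else 0)"
proof -
  let ?M = "char_matrix (csym_mat N a) z"
  let ?d = "Determinant.det ?M"
  have "(?M * adj_mat ?M) $$ (i, k) = (\<Sum>j<N. ?M $$ (i, j) * adj_mat ?M $$ (j, k))"
    using assms by (intro mat_mult_index_sum) auto
  also have "\<dots> = (\<Sum>j<N. of_real (a (min i j, max i j)) * adj_mat ?M $$ (j, k)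
      - (if i = j then z * adj_mat ?M $$ (i, k) else 0))"
    using assms by (intro sum.cong) (auto simp: char_matrix_csym_index algebra_simps)
  also have "\<dots> = (\<Sum>j<N. of_real (a (min i j, max i j)) * adj_mat ?M $$ (j, k)) - z * adj_mat ?M $$ (i, k)"
    using assms by (simp add: sum_subtractf)
  finally have "(\<Sum>j<N. of_real (a (min i j, max i j)) * adj_mat ?M $$ (j, k)) - z * adj_mat ?M $$ (i, k)
      = (if i = k then ?d else 0)"
    using assms by (simp add: adj_mat(2)[OF char_matrix_csym_carrier] split: if_splits)
  then have "((\<Sum>j<N. of_real (a (min i j, max i j)) * adj_mat ?M $$ (j, k)) - z * adj_mat ?M $$ (i, k)) / ?d
      = (if i = k then 1 else 0)"
    using det_char_matrix_csym[OF z, of N a] by simp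
  then show ?thesis
    by (simp add: resolvent_def diff_divide_distrib sum_divide_distrib)
qed

lemma resolvent_left:
  assumes z: "Im z \<noteq> 0" and "i < N" "k < N"
  shows "(\<Sum>j<N. resolvent N a z i j * of_real (a (min j k, max j k))) - z * resolvent N a z i k
    = (if i = k then 1 else 0)"
proof -
  let ?M = "char_matrix (csym_mat N a) z"
  let ?d = "Determinant.det ?M"
  have "(adj_mat ?M * ?M) $$ (i, k) = (\<Sum>j<N. adj_mat ?M $$ (i, j) * ?M $$ (j, k))"
    using assms by (intro mat_mult_index_sum) auto
  also have "\<dots> = (\<Sum>j<N. adj_mat ?M $$ (i, j) * of_real (a (min j k, max j k))
      - (if j = k then z * adj_mat ?M $$ (i, k) else 0))"
    using assms by (intro sum.cong) (auto simp: char_matrix_csym_index algebra_simps)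
  also have "\<dots> = (\<Sum>j<N. adj_mat ?M $$ (i, j) * of_real (a (min j k, max j k))) - z * adj_mat ?M $$ (i, k)"
    using assms by (simp add: sum_subtractf)
  finally have "(\<Sum>j<N. adj_mat ?M $$ (i, j) * of_real (a (min j k, max j k))) - z * adj_mat ?M $$ (i, k)
      = (if i = k then ?d else 0)"
    using assms by (simp add: adj_mat(3)[OF char_matrix_csym_carrier] split: if_splits)
  then have "((\<Sum>j<N. adj_mat ?M $$ (i, j) * of_real (a (min j k, max j k))) - z * adj_mat ?M $$ (i, k)) / ?d
      = (if i = k then 1 else 0)"
    using det_char_matrix_csym[OF z, of N a] by simp
  then show ?thesis
    by (simp add: resolvent_def diff_divide_distrib sum_divide_distrib mult.commute)
qed

text \<open>With G' the resolvent of a', evaluate G' (A - z) G by the right inverse property and G'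
  (A' - z) G by the left one; z cancels in the difference.\<close>

lemma resolvent_identity:
  assumes z: "Im z \<noteq> 0" and "p < N" "q < N"
  shows "resolvent N a' z p q - resolvent N a z p q =
    (\<Sum>r<N. \<Sum>s<N. resolvent N a' z p r *
       of_real (a (min r s, max r s) - a' (min r s, max r s)) * resolvent N a z s q)"
proof -
  let ?G = "resolvent N a z" and ?G' = "resolvent N a' z"
  let ?A = "\<lambda>r s. complex_of_real (a (min r s, max r s))"
  let ?A' = "\<lambda>r s. complex_of_real (a' (min r s, max r s))"
  have 1: "(\<Sum>r<N. ?G' p r * ((\<Sum>s<N. ?A r s * ?G s q) - z * ?G r q)) = ?G' p q"
    using assms by (simp add: resolvent_right sum_mult_kronecker)
  have 2: "(\<Sum>s<N. ((\<Sum>r<N. ?G' p r * ?A' r s) - z * ?G' p s) * ?G s q) = ?G p q"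
    using assms by (simp add: resolvent_left sum_mult_kronecker)
  have "(\<Sum>r<N. ?G' p r * (\<Sum>s<N. ?A r s * ?G s q)) - (\<Sum>s<N. (\<Sum>r<N. ?G' p r * ?A' r s) * ?G s q)
    = ?G' p q - ?G p q"
    using 1 2 by (simp add: algebra_simps sum_subtractf)
  moreover have "(\<Sum>s<N. (\<Sum>r<N. ?G' p r * ?A' r s) * ?G s q) = (\<Sum>r<N. \<Sum>s<N. ?G' p r * ?A' r s * ?G s q)"
    by (simp add: sum_distrib_right) (rule sum.swap)
  ultimately show ?thesis
    by (simp add: sum_distrib_left sum_subtractf algebra_simps)
qed

text \<open>The derivative of the characteristic polynomial is the sum of the principal minors, that
  is, up to sign the trace of the adjugate. Hence the trace of the resolvent is minus a logarithmic
  derivative, which a product of linear factors turns into a sum over the roots.\<close>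

lemma sum_resolvent_diag:
  assumes z: "Im z \<noteq> 0"
  shows "(\<Sum>i<N. resolvent N a z i i) = (\<Sum>x\<in>#spec N a. 1 / (of_real x - z))"
\<comment> \<open>For N = 0 the exponent \<open>N - 1\<close> truncates and the sign relation
  \<open>e\<close> below fails.\<close>
proof (cases "N = 0")
  case True
  then show ?thesis using size_spec[of N a] by (simp del: size_spec)
next
  case N: False
  let ?M = "char_matrix (csym_mat N a) z"
  let ?p = "char_poly (csym_mat N a)"
  have neg: "Determinant.det (- B) = (-1) ^ n * Determinant.det B" if "B \<in> carrier_mat n n" for B :: "complex mat" and n
  proof -
    have "- B = (-1) \<cdot>\<^sub>m B" using that by (intro eq_matI) auto
    then show ?thesis using that by (simp add: det_smult)
  qed
  have p: "poly ?p z = (-1) ^ N * Determinant.det ?M"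
    by (simp add: char_poly_matrix[OF csym_mat_carrier] neg)
  have p': "poly (pderiv ?p) z = (\<Sum>i<N. (-1) ^ (N - 1) * adj_mat ?M $$ (i, i))"
    unfolding pderiv_char_poly[OF csym_mat_carrier] poly_sum
  proof (intro sum.cong refl)
    fix i assume i: "i \<in> {..<N}"
    have c: "mat_delete (csym_mat N a) i i \<in> carrier_mat (N - 1) (N - 1)"
      by (rule mat_delete_carrier) simp
    have "char_matrix (mat_delete (csym_mat N a) i i) z = mat_delete ?M i i"
      using i by (intro eq_matI) (auto simp: char_matrix_def mat_delete_def)
    moreover have "adj_mat ?M $$ (i, i) = Determinant.det (mat_delete ?M i i)"
      using i by (simp add: adj_mat_def cofactor_def char_matrix_def)
    moreover have "mat_delete ?M i i \<in> carrier_mat (N - 1) (N - 1)"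
      by (rule mat_delete_carrier) simp
    ultimately show "poly (char_poly (mat_delete (csym_mat N a) i i)) z = (-1) ^ (N - 1) * adj_mat ?M $$ (i, i)"
      by (simp add: char_poly_matrix[OF c] neg)
  qed
  have e: "(-1::complex) ^ N = - ((-1) ^ (N - 1))"
    using N by (cases N) simp_all
  have tr: "(\<Sum>i<N. resolvent N a z i i) = - poly (pderiv ?p) z / poly ?p z"
    unfolding p p' e resolvent_def
    by (simp add: sum_distrib_left[symmetric] sum_divide_distrib[symmetric])
  obtain bs where bs: "char_poly (sym_mat N a) = (\<Prod>b\<leftarrow>bs. [:- b, 1:])" "spec N a = mset bs"
    by (rule obtain_spec)
  have pb: "?p = (\<Prod>b\<leftarrow>bs. [:- complex_of_real b, 1:])"
    unfolding char_poly_csym_mat bs(1) by (rule map_poly_of_real_linear_factors)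
  have ne: "poly (\<Prod>b\<leftarrow>bs. [:- complex_of_real b, 1:]) z \<noteq> 0" for bs
    using z by (force simp: poly_prod_list prod_list_zero_iff)
  have "- poly (pderiv (\<Prod>b\<leftarrow>bs. [:- complex_of_real b, 1:])) z / poly (\<Prod>b\<leftarrow>bs. [:- complex_of_real b, 1:]) z
    = (\<Sum>b\<leftarrow>bs. 1 / (of_real b - z))"
  proof (induct bs)
    case (Cons b bs)
    let ?q = "\<Prod>b\<leftarrow>bs. [:- complex_of_real b, 1:]"
    have z': "z \<noteq> of_real b" "complex_of_real b \<noteq> z" using z by auto
    have "poly (pderiv ([:- complex_of_real b, 1:] * ?q)) z = (z - of_real b) * poly (pderiv ?q) z + poly ?q z"
      by (simp add: pderiv_mult pderiv_pCons algebra_simps del: mult_pCons_left)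
    moreover have "poly ([:- complex_of_real b, 1:] * ?q) z = (z - of_real b) * poly ?q z"
      by (simp add: algebra_simps)
    ultimately have "- poly (pderiv ([:- complex_of_real b, 1:] * ?q)) z / poly ([:- complex_of_real b, 1:] * ?q) z
      = 1 / (of_real b - z) + - poly (pderiv ?q) z / poly ?q z"
      using ne[of bs] z' by (simp add: divide_simps) (simp add: algebra_simps)
    with Cons show ?case by (simp del: mult_pCons_left)
  qed simp
  then show ?thesis
    unfolding tr pb bs(2) by (simp add: sum_mset_sum_list[symmetric] flip: mset_map)
qed

text \<open>The Ward identity, from the energy identity for the k-th column. It trades a sum of N
  squared entries for one diagonal entry, which is what keeps the errors of the loop equation of
  order \<open>Im g\<close>.\<close>

lemma resolvent_ward:
  assumes z: "Im z \<noteq> 0" and k: "k < N"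
  shows "Im z * (\<Sum>i<N. (cmod (resolvent N a z i k))\<^sup>2) = Im (resolvent N a z k k)"
proof -
  have "Im z * (\<Sum>i<N. (cmod (resolvent N a z i k))\<^sup>2) =
    - Im (\<Sum>i<N. cnj (resolvent N a z i k) * (if i = k then 1 else 0))"
    using resolvent_right[OF z _ k, of _ a]
    by (intro symmetric_resolvent_energy[where b = "\<lambda>i j. a (min i j, max i j)"]) (auto simp: min.commute max.commute)
  also have "\<dots> = Im (resolvent N a z k k)"
    using k by (simp add: sum_mult_kronecker)
  finally show ?thesis .
qed

text \<open>The Ward identity bounds the square of a diagonal entry by its own imaginary part, hence
  by its modulus. So the diagonal is bounded by 1, and then every entry of a column is.\<close>

lemma cmod_resolvent_le:
  assumes z: "Im z = 1" and "i < N" "k < N"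
  shows "cmod (resolvent N a z i k) \<le> 1"
proof -
  have le: "(cmod (resolvent N a z i k))\<^sup>2 \<le> Im (resolvent N a z k k)" if "i < N" "k < N" for i k
  proof -
    have "(cmod (resolvent N a z i k))\<^sup>2 \<le> (\<Sum>i<N. (cmod (resolvent N a z i k))\<^sup>2)"
      using that by (intro member_le_sum) auto
    then show ?thesis using resolvent_ward[of z k N a] z that by simp
  qed
  have "(cmod (resolvent N a z k k))\<^sup>2 \<le> cmod (resolvent N a z k k)"
    using le[of k k] assms abs_Im_le_cmod[of "resolvent N a z k k"] by linarith
  then have 1: "cmod (resolvent N a z k k) \<le> 1"
    by (cases "resolvent N a z k k = 0") (auto simp: power2_eq_square)
  have "(cmod (resolvent N a z i k))\<^sup>2 \<le> 1"
    using le[of i k] 1 assms abs_Im_le_cmod[of "resolvent N a z k k"] by linarith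
  then show ?thesis by (simp add: power_le_one_iff)
qed

text \<open>Up to sign, these entries make up the gradient of the resolvent trace with respect to
  the matrix.\<close>

definition resolvent_sq :: "nat \<Rightarrow> (nat \<times> nat \<Rightarrow> real) \<Rightarrow> complex \<Rightarrow> nat \<Rightarrow> nat \<Rightarrow> complex" where
  "resolvent_sq N a z i j = (\<Sum>p<N. resolvent N a z i p * resolvent N a z p j)"

text \<open>A column x of the squared resolvent solves (A - z) x = y with y the same column of the
  resolvent. The energy identity gives \<open>?X \<le> (?X + ?Y) / 2\<close>, hence
  \<open>?X \<le> ?Y\<close>, and the Ward identity evaluates \<open>?Y\<close>.\<close>

lemma sum_resolvent_sq_le:
  assumes z: "Im z = 1"
  shows "(\<Sum>k<N. \<Sum>i<N. (cmod (resolvent_sq N a z i k))\<^sup>2) \<le> Im (\<Sum>k<N. resolvent N a z k k)"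
proof -
  have "(\<Sum>i<N. (cmod (resolvent_sq N a z i k))\<^sup>2) \<le> Im (resolvent N a z k k)" if k: "k < N" for k
  proof -
    let ?x = "\<lambda>i. resolvent_sq N a z i k" and ?y = "\<lambda>i. resolvent N a z i k"
    let ?X = "\<Sum>i<N. (cmod (?x i))\<^sup>2" and ?Y = "\<Sum>i<N. (cmod (?y i))\<^sup>2"
    have "(\<Sum>j<N. of_real (a (min i j, max i j)) * ?x j) - z * ?x i = ?y i" if i: "i < N" for i
    proof -
      have "(\<Sum>j<N. of_real (a (min i j, max i j)) * ?x j) =
        (\<Sum>p<N. (\<Sum>j<N. of_real (a (min i j, max i j)) * resolvent N a z j p) * ?y p)"
        unfolding resolvent_sq_def sum_distrib_left sum_distrib_right mult.assoc by (rule sum.swap)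
      then have "(\<Sum>j<N. of_real (a (min i j, max i j)) * ?x j) - z * ?x i =
        (\<Sum>p<N. ((\<Sum>j<N. of_real (a (min i j, max i j)) * resolvent N a z j p) - z * resolvent N a z i p) * ?y p)"
        unfolding resolvent_sq_def by (simp add: algebra_simps sum_subtractf sum_distrib_left)
      also have "\<dots> = ?y i"
        using z i by (simp add: resolvent_right sum_mult_kronecker)
      finally show ?thesis .
    qed
    then have "?X = - Im (\<Sum>i<N. cnj (?x i) * ?y i)"
      using symmetric_resolvent_energy[where b = "\<lambda>i j. a (min i j, max i j)" and x = ?x and y = ?y and z = z and N = N] z
      by (simp add: min.commute max.commute)
    also have "\<dots> \<le> cmod (\<Sum>i<N. cnj (?x i) * ?y i)"
      using abs_Im_le_cmod[of "\<Sum>i<N. cnj (?x i) * ?y i"] by linarith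
    also have "\<dots> \<le> (\<Sum>i<N. ((cmod (?x i))\<^sup>2 + (cmod (?y i))\<^sup>2) / 2)"
    proof (rule order.trans[OF norm_sum], rule sum_mono)
      fix i
      have "2 * cmod (?x i) * cmod (?y i) \<le> (cmod (?x i))\<^sup>2 + (cmod (?y i))\<^sup>2"
        by (rule sum_squares_bound)
      then show "cmod (cnj (?x i) * ?y i) \<le> ((cmod (?x i))\<^sup>2 + (cmod (?y i))\<^sup>2) / 2"
        by (simp add: norm_mult)
    qed
    also have "\<dots> = (?X + ?Y) / 2"
      by (simp add: sum.distrib sum_divide_distrib[symmetric])
    finally have "?X \<le> ?Y" by simp
    then show ?thesis using resolvent_ward[of z k N a] z k by simp
  qed
  then show ?thesis by (auto intro: sum_mono)
qed

section \<open>The variance of a function of independent variables\<close>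

text \<open>Expanding around the mean, the cross term integrates to 0.\<close>

lemma (in prob_space) bias_variance:
  fixes h :: "'a \<Rightarrow> complex"
  assumes [measurable]: "h \<in> borel_measurable M" and b: "\<And>x. x \<in> space M \<Longrightarrow> cmod (h x) \<le> B"
  shows "(\<integral>x. (cmod (h x - c))\<^sup>2 \<partial>M) =
    (\<integral>x. (cmod (h x - (\<integral>y. h y \<partial>M)))\<^sup>2 \<partial>M) + (cmod ((\<integral>y. h y \<partial>M) - c))\<^sup>2"
proof -
  let ?m = "\<integral>y. h y \<partial>M"
  have int: "integrable M h"
    by (rule integrable_const_bound[where B = B]) (use b in auto)
  have sq: "integrable M (\<lambda>x. (cmod (h x - c))\<^sup>2)" for c
    by (rule integrable_const_bound[where B = "(B + cmod c)\<^sup>2"])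
      (auto intro!: power_mono order.trans[OF norm_triangle_ineq4] b)
  have "(cmod (h x - c))\<^sup>2 = (cmod (h x - ?m))\<^sup>2 + ((cmod (?m - c))\<^sup>2 + 2 * Re ((h x - ?m) * cnj (?m - c)))" for x
    unfolding cmod_power2 by (simp add: power2_eq_square algebra_simps)
  then have "(\<integral>x. (cmod (h x - c))\<^sup>2 \<partial>M) =
    (\<integral>x. (cmod (h x - ?m))\<^sup>2 + ((cmod (?m - c))\<^sup>2 + 2 * Re ((h x - ?m) * cnj (?m - c))) \<partial>M)"
    by simp
  also have "\<dots> = (\<integral>x. (cmod (h x - ?m))\<^sup>2 \<partial>M) + (\<integral>x. (cmod (?m - c))\<^sup>2 + 2 * Re ((h x - ?m) * cnj (?m - c)) \<partial>M)"
    using int sq by (intro Bochner_Integration.integral_add) auto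
  also have "(\<integral>x. (cmod (?m - c))\<^sup>2 + 2 * Re ((h x - ?m) * cnj (?m - c)) \<partial>M) =
    (cmod (?m - c))\<^sup>2 + 2 * (\<integral>x. Re ((h x - ?m) * cnj (?m - c)) \<partial>M)"
    using int by (subst Bochner_Integration.integral_add) (auto simp: prob_space)
  also have "(\<integral>x. Re ((h x - ?m) * cnj (?m - c)) \<partial>M) = Re (\<integral>x. (h x - ?m) * cnj (?m - c) \<partial>M)"
    using int by (intro integral_Re) auto
  also have "(\<integral>x. (h x - ?m) * cnj (?m - c) \<partial>M) = 0"
    using int by (simp add: prob_space)
  finally show ?thesis by simp
qed

lemma (in prob_space) cmod_integral_sq_le:
  fixes h :: "'a \<Rightarrow> complex"
  assumes "h \<in> borel_measurable M" and "\<And>x. x \<in> space M \<Longrightarrow> cmod (h x) \<le> B"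
  shows "(cmod (\<integral>x. h x \<partial>M))\<^sup>2 \<le> (\<integral>x. (cmod (h x))\<^sup>2 \<partial>M)"
  using bias_variance[OF assms, of 0] by simp

lemma (in prob_space) norm_integral_le:
  fixes h :: "'a \<Rightarrow> 'b::{banach, second_countable_topology}"
  assumes h: "h \<in> borel_measurable M" "\<And>x. x \<in> space M \<Longrightarrow> norm (h x) \<le> B"
  shows "norm (\<integral>x. h x \<partial>M) \<le> B"
proof -
  have "integrable M h"
    by (rule integrable_const_bound[where B = B]) (use h in auto)
  have "norm (\<integral>x. h x \<partial>M) \<le> (\<integral>x. norm (h x) \<partial>M)" by (rule integral_norm_bound)
  also have "\<dots> \<le> (\<integral>x. B \<partial>M)"
    by (intro integral_mono integrable_norm \<open>integrable M h\<close>) (use h in auto)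
  finally show ?thesis by (simp add: prob_space)
qed

lemma fun_upd_in_space_PiM:
  assumes "y \<in> space (Pi\<^sub>M I M)" "x \<in> space (M j)"
  shows "y(j := x) \<in> space (Pi\<^sub>M (insert j I) M)"
  using assms by (auto simp: space_PiM PiE_def extensional_def)

lemma fun_upd_in_space_PiM':
  assumes "y \<in> space (Pi\<^sub>M I M)" "x \<in> space (M j)" "j \<in> I"
  shows "y(j := x) \<in> space (Pi\<^sub>M I M)"
  using fun_upd_in_space_PiM[OF assms(1,2)] assms(3) by (simp add: insert_absorb)

lemma measurable_fun_upd_const:
  assumes "y \<in> space (Pi\<^sub>M I M)" "insert j I = J"
  shows "(\<lambda>x. y(j := x)) \<in> measurable (M j) (Pi\<^sub>M J M)"
  by (rule measurable_fun_upd[where J = I]) (use assms in auto)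

lemma integrable_PiM_bounded:
  fixes F :: "('i \<Rightarrow> 'a) \<Rightarrow> 'b::{banach, second_countable_topology}"
  assumes "\<And>i. prob_space (M i)" and "F \<in> borel_measurable (Pi\<^sub>M I M)" "\<And>a. a \<in> space (Pi\<^sub>M I M) \<Longrightarrow> norm (F a) \<le> B"
  shows "integrable (Pi\<^sub>M I M) F"
proof -
  interpret P: prob_space "Pi\<^sub>M I M" by (intro prob_space_PiM assms)
  show ?thesis by (rule P.integrable_const_bound[where B = B]) (use assms in auto)
qed

text \<open>Induction on the coordinates. The variance of F is the mean of its variance in the
  coordinate j plus the variance of the partial mean m over j. The hypotheses pass to m because
  averaging over j does not increase mean squared deviations in another coordinate. The bound V is
  compared only after integration over its own coordinate, which is the form in which a
  one-dimensional Poincare inequality is available.\<close>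

lemma efron_stein:
  fixes F :: "('i \<Rightarrow> 'a) \<Rightarrow> complex" and V :: "'i \<Rightarrow> ('i \<Rightarrow> 'a) \<Rightarrow> real"
  assumes pM: "\<And>i. prob_space (M i)" and "finite I"
    and "F \<in> borel_measurable (Pi\<^sub>M I M)" "\<And>a. a \<in> space (Pi\<^sub>M I M) \<Longrightarrow> cmod (F a) \<le> B"
    and "\<And>i. i \<in> I \<Longrightarrow> V i \<in> borel_measurable (Pi\<^sub>M I M)"
    and "\<And>i a. i \<in> I \<Longrightarrow> a \<in> space (Pi\<^sub>M I M) \<Longrightarrow> \<bar>V i a\<bar> \<le> C"
    and "\<And>i a. i \<in> I \<Longrightarrow> a \<in> space (Pi\<^sub>M I M) \<Longrightarrow>
      (\<integral>t. (cmod (F (a(i := t)) - (\<integral>s. F (a(i := s)) \<partial>M i)))\<^sup>2 \<partial>M i) \<le> (\<integral>t. V i (a(i := t)) \<partial>M i)"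
  shows "(\<integral>a. (cmod (F a - (\<integral>b. F b \<partial>Pi\<^sub>M I M)))\<^sup>2 \<partial>Pi\<^sub>M I M) \<le> (\<Sum>i\<in>I. \<integral>a. V i a \<partial>Pi\<^sub>M I M)"
  using assms(2-)
proof (induct I arbitrary: F V rule: finite_induct)
  case empty
  show ?case by (simp add: PiM_empty lebesgue_integral_count_space_finite)
next
  case (insert j I)
  let ?J = "insert j I"
  note [measurable] = insert.prems(1)
  note V[measurable] = insert.prems(3)
  interpret M: prob_space "M i" for i by (rule pM)
  interpret product_sigma_finite M
    by unfold_locales
  interpret P: prob_space "Pi\<^sub>M I M" by (intro prob_space_PiM M.prob_space_axioms)
  interpret Pj: pair_prob_space "Pi\<^sub>M I M" "M j" ..
  note upd = fun_upd_in_space_PiM[where j = j and I = I]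
  have B0: "0 \<le> B" and C0: "I \<noteq> {} \<Longrightarrow> 0 \<le> C"
  proof -
    obtain a where "a \<in> space (Pi\<^sub>M ?J M)"
      using prob_space.not_empty[OF prob_space_PiM[where M = M and I = ?J, OF pM]] by blast
    then show "0 \<le> B" "I \<noteq> {} \<Longrightarrow> 0 \<le> C"
      using insert.prems(2)[of a] insert.prems(4)[of _ a] by (auto intro: order.trans[OF norm_ge_zero] order.trans[OF abs_ge_zero])
  qed
  have meas_y[measurable]: "(\<lambda>x. F (y(j := x))) \<in> borel_measurable (M j)" if "y \<in> space (Pi\<^sub>M I M)" for y
    by (rule measurable_compose[OF measurable_fun_upd_const[OF that refl] insert.prems(1)])
  have mF[measurable]: "(\<lambda>(y, x). F (y(j := x))) \<in> borel_measurable (Pi\<^sub>M I M \<Otimes>\<^sub>M M j)"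
    by measurable
  have mV[measurable]: "(\<lambda>(y, x). V i (y(j := x))) \<in> borel_measurable (Pi\<^sub>M I M \<Otimes>\<^sub>M M j)" if "i \<in> ?J" for i
    using V[OF that] by measurable
  have FB: "cmod (F (y(j := x))) \<le> B" if "y \<in> space (Pi\<^sub>M I M)" "x \<in> space (M j)" for y x
    by (rule insert.prems(2)[OF upd[OF that]])
  define m where "m y = (\<integral>x. F (y(j := x)) \<partial>M j)" for y
  define V' where "V' i y = (\<integral>x. V i (y(j := x)) \<partial>M j)" for i y
  have m_meas[measurable]: "m \<in> borel_measurable (Pi\<^sub>M I M)"
    unfolding m_def by measurable
  have V'_meas: "V' i \<in> borel_measurable (Pi\<^sub>M I M)" if "i \<in> ?J" for i
    unfolding V'_def using mV[OF that] by measurable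
  have mB: "cmod (m y) \<le> B" if "y \<in> space (Pi\<^sub>M I M)" for y
    unfolding m_def by (rule M.norm_integral_le[OF meas_y[OF that] insert.prems(2)[OF upd[OF that]]])
  have muF: "(\<integral>a. F a \<partial>Pi\<^sub>M ?J M) = (\<integral>y. m y \<partial>Pi\<^sub>M I M)"
    unfolding m_def using insert.hyps insert.prems(1,2)
    by (intro product_integral_insert integrable_PiM_bounded pM) auto
  define \<mu> where "\<mu> = (\<integral>y. m y \<partial>Pi\<^sub>M I M)"
  define S where "S y = (\<integral>x. (cmod (F (y(j := x)) - m y))\<^sup>2 \<partial>M j)" for y
  have [measurable]: "S \<in> borel_measurable (Pi\<^sub>M I M)"
    unfolding S_def by measurable
  have sqB: "(cmod (u - w))\<^sup>2 \<le> 4 * B\<^sup>2" if "cmod u \<le> B" "cmod w \<le> B" for u w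
    using power_mono[of "cmod (u - w)" "2 * B" 2] that norm_triangle_ineq4[of u w] by (simp add: power_mult_distrib)
  have \<mu>B: "cmod \<mu> \<le> B"
    unfolding \<mu>_def by (rule P.norm_integral_le) (use mB in auto)
  have S0: "0 \<le> S y" for y unfolding S_def by simp
  have SB: "S y \<le> 4 * B\<^sup>2" if y: "y \<in> space (Pi\<^sub>M I M)" for y
  proof -
    have "S y \<le> (\<integral>x. 4 * B\<^sup>2 \<partial>M j)"
      unfolding S_def
      by (intro integral_mono M.integrable_const_bound[where B = "4 * B\<^sup>2"] AE_I2)
        (use sqB[OF FB[OF y] mB[OF y]] y in auto)
    then show ?thesis by (simp add: M.prob_space)
  qed
  have intV: "integrable (M j) (\<lambda>x. V i (y(j := x)))" if "i \<in> ?J" "y \<in> space (Pi\<^sub>M I M)" for i y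
  proof (rule M.integrable_const_bound[where B = C], rule AE_I2)
    show "norm (V i (y(j := x))) \<le> C" if "x \<in> space (M j)" for x
      unfolding real_norm_def by (rule insert.prems(4)[OF \<open>i \<in> ?J\<close> upd[OF \<open>y \<in> _\<close> that]])
  qed (rule measurable_compose[OF measurable_fun_upd_const[OF that(2) refl] V[OF that(1)]])
  have V'C: "\<bar>V' i y\<bar> \<le> C" if "i \<in> ?J" "y \<in> space (Pi\<^sub>M I M)" for i y
    unfolding V'_def real_norm_def[symmetric]
  proof (rule M.norm_integral_le[OF borel_measurable_integrable[OF intV[OF that]]])
    show "norm (V i (y(j := x))) \<le> C" if "x \<in> space (M j)" for x
      unfolding real_norm_def by (rule insert.prems(4)[OF \<open>i \<in> ?J\<close> upd[OF \<open>y \<in> _\<close> that]])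
  qed
  have intV': "integrable (Pi\<^sub>M I M) (V' i)" if "i \<in> ?J" for i
    by (rule P.integrable_const_bound[where B = C]) (use V'_meas[OF that] V'C[OF that] in auto)
  have V'_eq: "(\<integral>a. V i a \<partial>Pi\<^sub>M ?J M) = (\<integral>y. V' i y \<partial>Pi\<^sub>M I M)" if "i \<in> ?J" for i
    unfolding V'_def using insert.hyps V[OF that] insert.prems(4)[OF that]
    by (intro product_integral_insert integrable_PiM_bounded pM) auto
  have S_le: "S y \<le> V' j y" if y: "y \<in> space (Pi\<^sub>M I M)" for y
  proof -
    \<comment> \<open>The value at j is arbitrary: the hypothesis overwrites it on both
      sides.\<close>
    obtain x0 where x0: "x0 \<in> space (M j)" using M.not_empty by blast
    have "(\<integral>t. (cmod (F ((y(j := x0))(j := t)) - (\<integral>s. F ((y(j := x0))(j := s)) \<partial>M j)))\<^sup>2 \<partial>M j) \<le>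
        (\<integral>t. V j ((y(j := x0))(j := t)) \<partial>M j)"
      by (rule insert.prems(5)[OF insertI1 upd[OF y x0]])
    then show ?thesis by (simp add: S_def m_def V'_def)
  qed
  have IH: "(\<integral>y. (cmod (m y - (\<integral>b. m b \<partial>Pi\<^sub>M I M)))\<^sup>2 \<partial>Pi\<^sub>M I M) \<le> (\<Sum>i\<in>I. \<integral>y. V' i y \<partial>Pi\<^sub>M I M)"
  proof (rule insert.hyps(3)[OF m_meas mB V'_meas V'C])
    fix i y assume i: "i \<in> I" and y: "y \<in> space (Pi\<^sub>M I M)"
    interpret Pij: pair_prob_space "M i" "M j" ..
    have ij: "i \<noteq> j" using i insert.hyps by auto
    have sp: "y(i := t, j := x) \<in> space (Pi\<^sub>M ?J M)" if "t \<in> space (M i)" "x \<in> space (M j)" for t x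
      using upd[OF fun_upd_in_space_PiM'[OF y that(1) i] that(2)] .
    have m2: "(\<lambda>p. y(i := fst p, j := snd p)) \<in> measurable (M i \<Otimes>\<^sub>M M j) (Pi\<^sub>M ?J M)"
    proof (rule measurable_fun_upd[where J = I])
      show "(\<lambda>p. y(i := fst p)) \<in> measurable (M i \<Otimes>\<^sub>M M j) (Pi\<^sub>M I M)"
        using i y by (intro measurable_compose[OF measurable_fst measurable_fun_upd_const]) auto
    qed auto
    define f where "f t x = F (y(i := t, j := x))" for t x
    have f_meas[measurable]: "(\<lambda>(t, x). f t x) \<in> borel_measurable (M i \<Otimes>\<^sub>M M j)"
      unfolding f_def case_prod_beta' by (rule measurable_compose[OF m2 insert.prems(1)])
    have fB: "cmod (f t x) \<le> B" if "t \<in> space (M i)" "x \<in> space (M j)" for t x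
      unfolding f_def by (rule insert.prems(2)[OF sp[OF that]])
    define e where "e x = (\<integral>t. f t x \<partial>M i)" for x
    have [measurable]: "e \<in> borel_measurable (M j)"
      unfolding e_def by measurable
    have f_int: "integrable (M i \<Otimes>\<^sub>M M j) (\<lambda>(t, x). f t x)"
      by (rule Pij.integrable_const_bound[where B = B]) (use fB in \<open>auto simp: space_pair_measure\<close>)
    have f_x: "(\<lambda>t. f t x) \<in> borel_measurable (M i)" if "x \<in> space (M j)" for x
      using measurable_compose[OF measurable_Pair2'[OF that] f_meas] by simp
    have f_t: "f t \<in> borel_measurable (M j)" if "t \<in> space (M i)" for t
      using measurable_compose[OF measurable_Pair1'[OF that] f_meas] by simp
    have eB: "cmod (e x) \<le> B" if "x \<in> space (M j)" for x
      unfolding e_def by (rule M.norm_integral_le) (use fB f_x that in auto)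
    have m_eq: "m (y(i := t)) = (\<integral>x. f t x \<partial>M j)" for t
      by (simp add: m_def f_def)
    have "(\<integral>s. m (y(i := s)) \<partial>M i) = (\<integral>x. e x \<partial>M j)"
      unfolding m_eq e_def using f_int by (rule Pij.Fubini_integral[symmetric])
    then have diff: "m (y(i := t)) - (\<integral>s. m (y(i := s)) \<partial>M i) = (\<integral>x. f t x - e x \<partial>M j)"
      if "t \<in> space (M i)" for t
      unfolding m_eq using that fB eB f_t
      by (subst Bochner_Integration.integral_diff) (auto intro!: M.integrable_const_bound[where B = B])
    have g_int: "integrable (M i \<Otimes>\<^sub>M M j) (\<lambda>(t, x). (cmod (f t x - e x))\<^sup>2)"
      by (rule Pij.integrable_const_bound[where B = "4 * B\<^sup>2"])
        (use fB eB sqB in \<open>auto simp: space_pair_measure\<close>)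
    have W_int: "integrable (M i \<Otimes>\<^sub>M M j) (\<lambda>(t, x). V i (y(i := t, j := x)))"
    proof (rule Pij.integrable_const_bound[where B = C])
      show "(\<lambda>(t, x). V i (y(i := t, j := x))) \<in> borel_measurable (M i \<Otimes>\<^sub>M M j)"
        unfolding case_prod_beta' by (rule measurable_compose[OF m2 V]) (use i in simp)
      have "\<bar>V i (y(i := t, j := x))\<bar> \<le> C" if "t \<in> space (M i)" "x \<in> space (M j)" for t x
        by (rule insert.prems(4)[OF _ sp[OF that]]) (use i in simp)
      then show "AE p in M i \<Otimes>\<^sub>M M j. norm (case p of (t, x) \<Rightarrow> V i (y(i := t, j := x))) \<le> C"
        by (intro AE_I2) (auto simp: space_pair_measure simp del: fun_upd_apply)
    qed
    have "(\<integral>t. (cmod (m (y(i := t)) - (\<integral>s. m (y(i := s)) \<partial>M i)))\<^sup>2 \<partial>M i) =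
      (\<integral>t. (cmod (\<integral>x. f t x - e x \<partial>M j))\<^sup>2 \<partial>M i)"
      by (rule Bochner_Integration.integral_cong) (use diff in auto)
    \<comment> \<open>Jensen's inequality in the coordinate j; after Fubini the hypothesis on F
      applies for each fixed x.\<close>
    also have "\<dots> \<le> (\<integral>t. (\<integral>x. (cmod (f t x - e x))\<^sup>2 \<partial>M j) \<partial>M i)"
    proof (rule integral_mono)
      have bd: "cmod (f t x - e x) \<le> 2 * B" if "t \<in> space (M i)" "x \<in> space (M j)" for t x
        using norm_triangle_ineq4[of "f t x" "e x"] fB[OF that] eB[OF that(2)] by linarith
      show "(cmod (\<integral>x. f t x - e x \<partial>M j))\<^sup>2 \<le> (\<integral>x. (cmod (f t x - e x))\<^sup>2 \<partial>M j)" if "t \<in> space (M i)" for t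
        by (rule M.cmod_integral_sq_le[where B = "2 * B"]) (use bd f_t that in auto)
      show "integrable (M i) (\<lambda>t. \<integral>x. (cmod (f t x - e x))\<^sup>2 \<partial>M j)"
        using Pij.integrable_fst'[OF g_int] by simp
      have "(cmod (\<integral>x. f t x - e x \<partial>M j))\<^sup>2 \<le> 4 * B\<^sup>2" if "t \<in> space (M i)" for t
        using power_mono[OF M.norm_integral_le[of "\<lambda>x. f t x - e x" j "2 * B"], of 2] bd f_t that
        by (simp add: power_mult_distrib)
      then show "integrable (M i) (\<lambda>t. (cmod (\<integral>x. f t x - e x \<partial>M j))\<^sup>2)"
        by (intro M.integrable_const_bound[where B = "4 * B\<^sup>2"] AE_I2)
          auto
    qed
    also have "\<dots> = (\<integral>x. (\<integral>t. (cmod (f t x - e x))\<^sup>2 \<partial>M i) \<partial>M j)"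
      using g_int by (rule Pij.Fubini_integral[symmetric])
    also have "\<dots> \<le> (\<integral>x. (\<integral>t. V i (y(i := t, j := x)) \<partial>M i) \<partial>M j)"
    proof (rule integral_mono)
      show "integrable (M j) (\<lambda>x. \<integral>t. (cmod (f t x - e x))\<^sup>2 \<partial>M i)"
        using Pij.integrable_snd[OF g_int] by simp
      show "integrable (M j) (\<lambda>x. \<integral>t. V i (y(i := t, j := x)) \<partial>M i)"
        using Pij.integrable_snd[OF W_int] by simp
      fix x assume x: "x \<in> space (M j)"
      show "(\<integral>t. (cmod (f t x - e x))\<^sup>2 \<partial>M i) \<le> (\<integral>t. V i (y(i := t, j := x)) \<partial>M i)"
        unfolding e_def f_def fun_upd_twist[OF ij]
        by (rule insert.prems(5)[OF _ upd[OF y x]]) (use i in simp)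
    qed
    also have "\<dots> = (\<integral>t. V' i (y(i := t)) \<partial>M i)"
      unfolding V'_def using W_int by (rule Pij.Fubini_integral)
    finally show "(\<integral>t. (cmod (m (y(i := t)) - (\<integral>s. m (y(i := s)) \<partial>M i)))\<^sup>2 \<partial>M i) \<le> (\<integral>t. V' i (y(i := t)) \<partial>M i)" .
  qed auto
  have "(\<integral>a. (cmod (F a - \<mu>))\<^sup>2 \<partial>Pi\<^sub>M ?J M) = (\<integral>y. (\<integral>x. (cmod (F (y(j := x)) - \<mu>))\<^sup>2 \<partial>M j) \<partial>Pi\<^sub>M I M)"
    using insert.hyps insert.prems(1,2) \<mu>B
    by (intro product_integral_insert integrable_PiM_bounded[where B = "4 * B\<^sup>2"] pM) (auto intro!: sqB)
  also have "\<dots> = (\<integral>y. S y + (cmod (m y - \<mu>))\<^sup>2 \<partial>Pi\<^sub>M I M)"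
  proof (rule Bochner_Integration.integral_cong)
    fix y assume y: "y \<in> space (Pi\<^sub>M I M)"
    show "(\<integral>x. (cmod (F (y(j := x)) - \<mu>))\<^sup>2 \<partial>M j) = S y + (cmod (m y - \<mu>))\<^sup>2"
      unfolding S_def m_def by (rule M.bias_variance[OF meas_y[OF y]]) (use FB[OF y] in auto)
  qed simp
  also have "\<dots> = (\<integral>y. S y \<partial>Pi\<^sub>M I M) + (\<integral>y. (cmod (m y - \<mu>))\<^sup>2 \<partial>Pi\<^sub>M I M)"
    using SB S0 mB \<mu>B
    by (intro Bochner_Integration.integral_add P.integrable_const_bound[where B = "4 * B\<^sup>2"]) (auto intro!: sqB)
  also have "(\<integral>y. S y \<partial>Pi\<^sub>M I M) \<le> (\<integral>y. V' j y \<partial>Pi\<^sub>M I M)"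
    using SB S0 S_le intV'[of j]
    by (intro integral_mono P.integrable_const_bound[where B = "4 * B\<^sup>2" and f = S]) auto
  also have "(\<integral>y. V' j y \<partial>Pi\<^sub>M I M) + (\<integral>y. (cmod (m y - \<mu>))\<^sup>2 \<partial>Pi\<^sub>M I M) \<le>
      (\<integral>y. V' j y \<partial>Pi\<^sub>M I M) + (\<Sum>i\<in>I. \<integral>y. V' i y \<partial>Pi\<^sub>M I M)"
    using IH by (simp add: \<mu>_def)
  also have "\<dots> = (\<Sum>i\<in>?J. \<integral>a. V i a \<partial>Pi\<^sub>M ?J M)"
    using insert.hyps by (simp add: V'_eq)
  finally show ?case by (simp add: muF \<mu>_def)
qed

section \<open>The loop equation\<close>

lemma borel_measurable_det:
  fixes B :: "'a \<Rightarrow> complex mat"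
  assumes c: "\<And>\<omega>. B \<omega> \<in> carrier_mat n n"
    and m: "\<And>i j. i < n \<Longrightarrow> j < n \<Longrightarrow> (\<lambda>\<omega>. B \<omega> $$ (i, j)) \<in> borel_measurable M"
  shows "(\<lambda>\<omega>. Determinant.det (B \<omega>)) \<in> borel_measurable M"
  unfolding det_def'[OF c]
proof (intro borel_measurable_sum borel_measurable_times borel_measurable_const borel_measurable_prod)
  fix p i assume "p \<in> {p. p permutes {0..<n}}" "i \<in> {0..<n}"
  then show "(\<lambda>\<omega>. B \<omega> $$ (i, p i)) \<in> borel_measurable M"
    by (intro m) (auto simp: permutes_in_image)
qed

text \<open>A quotient of determinants, which are polynomials in the entries. Matrix and spectral
  parameter may both depend on \<omega>, since the parameter later becomes a variable of
  integration.\<close>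

lemma borel_measurable_resolvent:
  assumes X: "\<And>i j. i \<le> j \<Longrightarrow> j < N \<Longrightarrow> (\<lambda>\<omega>. X \<omega> (i, j)) \<in> borel_measurable M"
    and Z: "Z \<in> borel_measurable M" and ij: "i < N" "j < N"
  shows "(\<lambda>\<omega>. resolvent N (X \<omega>) (Z \<omega>) i j) \<in> borel_measurable M"
proof -
  let ?M = "\<lambda>\<omega>. char_matrix (csym_mat N (X \<omega>)) (Z \<omega>)"
  have m: "(\<lambda>\<omega>. ?M \<omega> $$ (p, q)) \<in> borel_measurable M" if "p < N" "q < N" for p q
  proof -
    have "(\<lambda>\<omega>. X \<omega> (min p q, max p q)) \<in> borel_measurable M"
      using that by (intro X) auto
    then show ?thesis
      using Z that by (simp add: char_matrix_csym_index)
  qed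
  have "(\<lambda>\<omega>. adj_mat (?M \<omega>) $$ (i, j)) = (\<lambda>\<omega>. (-1) ^ (j + i) * Determinant.det (mat_delete (?M \<omega>) j i))"
    using ij by (auto simp: adj_mat_def cofactor_def char_matrix_def)
  moreover have "(\<lambda>\<omega>. Determinant.det (mat_delete (?M \<omega>) j i)) \<in> borel_measurable M"
  proof (rule borel_measurable_det[where n = "N - 1"])
    show "mat_delete (?M \<omega>) j i \<in> carrier_mat (N - 1) (N - 1)" for \<omega>
      by (rule mat_delete_carrier) simp
    fix p q assume pq: "p < N - 1" "q < N - 1"
    have "(\<lambda>\<omega>. mat_delete (?M \<omega>) j i $$ (p, q)) =
      (\<lambda>\<omega>. ?M \<omega> $$ (if p < j then p else Suc p, if q < i then q else Suc q))"
      using pq by (simp add: mat_delete_def char_matrix_def)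
    then show "(\<lambda>\<omega>. mat_delete (?M \<omega>) j i $$ (p, q)) \<in> borel_measurable M"
      using pq by (simp add: m)
  qed
  ultimately have "(\<lambda>\<omega>. adj_mat (?M \<omega>) $$ (i, j)) \<in> borel_measurable M"
    by simp
  moreover have "(\<lambda>\<omega>. Determinant.det (?M \<omega>)) \<in> borel_measurable M"
    by (rule borel_measurable_det[where n = N]) (use m in auto)
  ultimately show ?thesis
    unfolding resolvent_def by (rule borel_measurable_divide)
qed

section \<open>The Gaussian orthogonal ensemble as a product measure\<close>

definition goe_index :: "nat \<Rightarrow> (nat \<times> nat) set" where
  "goe_index N = {(i, j). i \<le> j \<and> j < N}"

definition goe_var :: "real \<Rightarrow> nat \<times> nat \<Rightarrow> real" where
  "goe_var v k = (if fst k = snd k then 2 * v else v)"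

lemma finite_goe_index [simp]: "finite (goe_index N)"
  by (rule finite_subset[of _ "{..<N} \<times> {..<N}"]) (auto simp: goe_index_def)

lemma goe_entries_alt: "goe_entries N v = Pi\<^sub>M (goe_index N) (\<lambda>k. gauss_measure (goe_var v k))"
  unfolding goe_entries_def goe_index_def goe_var_def
  by (rule arg_cong[where f = "Pi\<^sub>M _"]) (auto simp: fun_eq_iff)

lemma goe_var_pos: "0 < v \<Longrightarrow> 0 < goe_var v k"
  by (simp add: goe_var_def)

lemma prob_space_gauss_goe_var: "0 < v \<Longrightarrow> prob_space (gauss_measure (goe_var v k))"
  by (intro prob_space_gauss_measure less_imp_le goe_var_pos)

lemma prob_space_goe_entries: "0 < v \<Longrightarrow> prob_space (goe_entries N v)"
  unfolding goe_entries_alt by (intro prob_space_PiM prob_space_gauss_goe_var)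

lemma goe_entries_component_measurable:
  assumes "k \<in> goe_index N"
  shows "(\<lambda>a. a k) \<in> borel_measurable (goe_entries N v)"
proof -
  have "(\<lambda>a. a k) \<in> measurable (goe_entries N v) (gauss_measure (goe_var v k))"
    unfolding goe_entries_alt using assms by (rule measurable_component_singleton)
  then show ?thesis by (simp cong: measurable_cong_sets)
qed

lemma goe_entries_entry_measurable:
  "i \<le> j \<Longrightarrow> j < N \<Longrightarrow> (\<lambda>a. a (i, j)) \<in> borel_measurable (goe_entries N v)"
  by (rule goe_entries_component_measurable) (simp add: goe_index_def)

lemma integral_goe_entries_split:
  fixes F :: "(nat \<times> nat \<Rightarrow> real) \<Rightarrow> 'a::{banach, second_countable_topology}"
  assumes "0 < v" "k \<in> goe_index N" "integrable (goe_entries N v) F"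
  shows "(\<integral>a. F a \<partial>goe_entries N v) =
    (\<integral>y. (\<integral>t. F (y(k := t)) \<partial>gauss_measure (goe_var v k)) \<partial>Pi\<^sub>M (goe_index N - {k}) (\<lambda>k. gauss_measure (goe_var v k)))"
proof -
  interpret G: prob_space "gauss_measure (goe_var v l)" for l
    using assms(1) by (rule prob_space_gauss_goe_var)
  interpret product_sigma_finite "\<lambda>k. gauss_measure (goe_var v k)" by unfold_locales
  have "insert k (goe_index N - {k}) = goe_index N"
    using assms(2) by (simp add: insert_absorb)
  then show ?thesis
    using product_integral_insert[of "goe_index N - {k}" k F] assms(3) by (simp add: goe_entries_alt)
qed

lemma integrable_goe_entries_component:
  assumes "0 < v" "k \<in> goe_index N"
  shows "integrable (goe_entries N v) (\<lambda>a. a k)"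
proof -
  interpret G: prob_space "gauss_measure (goe_var v l)" for l
    using assms(1) by (rule prob_space_gauss_goe_var)
  have "distr (goe_entries N v) (gauss_measure (goe_var v k)) (\<lambda>a. a k) = gauss_measure (goe_var v k)"
    unfolding goe_entries_alt using assms by (intro distr_PiM_component) (auto intro: G.prob_space_axioms)
  moreover have "integrable (gauss_measure (goe_var v k)) (\<lambda>x. x)"
    using integrable_normal_moment_nz_1[of "sqrt (goe_var v k)" 0] goe_var_pos[OF assms(1), of k]
    by (simp add: integrable_gauss_measure)
  ultimately have "integrable (distr (goe_entries N v) (gauss_measure (goe_var v k)) (\<lambda>a. a k)) (\<lambda>x. x)"
    by simp
  then show ?thesis
    using measurable_component_singleton[OF assms(2), of "\<lambda>k. gauss_measure (goe_var v k)"]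
    by (subst (asm) integrable_distr_eq) (simp_all add: goe_entries_alt)
qed

text \<open>Fubini isolates the coordinate k, and the one-dimensional identity holds for each value
  of the others.\<close>

lemma goe_entries_stein:
  fixes F D :: "(nat \<times> nat \<Rightarrow> real) \<Rightarrow> complex"
  assumes v: "0 < v" and k: "k \<in> goe_index N"
    and F: "F \<in> borel_measurable (goe_entries N v)" "\<And>a. cmod (F a) \<le> B"
    and D: "D \<in> borel_measurable (goe_entries N v)" "\<And>a. cmod (D a) \<le> C"
    and der: "\<And>a t. ((\<lambda>t. F (a(k := t))) has_vector_derivative D (a(k := t))) (at t)"
    and cont: "\<And>a. continuous_on UNIV (\<lambda>t. D (a(k := t)))"
  shows "(\<integral>a. of_real (a k) * F a \<partial>goe_entries N v) = of_real (goe_var v k) * (\<integral>a. D a \<partial>goe_entries N v)"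
proof -
  interpret P: prob_space "goe_entries N v" using v by (rule prob_space_goe_entries)
  have int: "integrable (goe_entries N v) (\<lambda>a. of_real (a k) * F a)"
  proof (rule Bochner_Integration.integrable_bound)
    show "integrable (goe_entries N v) (\<lambda>a. a k * B)"
      using integrable_goe_entries_component[OF v k] by simp
    have "\<bar>a k\<bar> * cmod (F a) \<le> \<bar>a k\<bar> * \<bar>B\<bar>" for a
      using F(2)[of a] by (intro mult_left_mono) auto
    then show "AE a in goe_entries N v. norm (complex_of_real (a k) * F a) \<le> norm (a k * B)"
      by (intro AE_I2) (simp add: norm_mult abs_mult)
  qed (use F(1) goe_entries_component_measurable[OF k] in simp)
  have intD: "integrable (goe_entries N v) D"
    by (rule P.integrable_const_bound[where B = C]) (use D in auto)
  have "(\<integral>t. of_real t * F (y(k := t)) \<partial>gauss_measure (goe_var v k)) =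
      of_real (goe_var v k) * (\<integral>t. D (y(k := t)) \<partial>gauss_measure (goe_var v k))" for y
    using gauss_measure_stein[OF goe_var_pos[OF v] der cont F(2) D(2), of k y]
    by (simp add: scaleR_conv_of_real)
  then show ?thesis
    using integral_goe_entries_split[OF v k int] integral_goe_entries_split[OF v k intD] by simp
qed

text \<open>The Efron-Stein inequality with the one-dimensional Poincare inequality as the bound in
  each coordinate. No factor depending on the number of coordinates arises.\<close>

lemma goe_entries_poincare:
  fixes F :: "(nat \<times> nat \<Rightarrow> real) \<Rightarrow> complex"
  assumes v: "0 < v"
    and F: "F \<in> borel_measurable (goe_entries N v)" "\<And>a. cmod (F a) \<le> B"
    and D: "\<And>k. k \<in> goe_index N \<Longrightarrow> D k \<in> borel_measurable (goe_entries N v)"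
      "\<And>k a. k \<in> goe_index N \<Longrightarrow> cmod (D k a) \<le> C"
    and der: "\<And>k a t. k \<in> goe_index N \<Longrightarrow> ((\<lambda>t. F (a(k := t))) has_vector_derivative D k (a(k := t))) (at t)"
    and cont: "\<And>k a. k \<in> goe_index N \<Longrightarrow> continuous_on UNIV (\<lambda>t. D k (a(k := t)))"
  shows "(\<integral>a. (cmod (F a - (\<integral>b. F b \<partial>goe_entries N v)))\<^sup>2 \<partial>goe_entries N v) \<le>
    (\<Sum>k\<in>goe_index N. goe_var v k * (\<integral>a. (cmod (D k a))\<^sup>2 \<partial>goe_entries N v))"
proof -
  have "(\<integral>a. (cmod (F a - (\<integral>b. F b \<partial>goe_entries N v)))\<^sup>2 \<partial>goe_entries N v) \<le>
    (\<Sum>k\<in>goe_index N. \<integral>a. goe_var v k * (cmod (D k a))\<^sup>2 \<partial>goe_entries N v)"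
    unfolding goe_entries_alt
  proof (rule efron_stein[OF prob_space_gauss_goe_var[OF v] finite_goe_index])
    fix k a assume k: "k \<in> goe_index N"
    show "(\<integral>t. (cmod (F (a(k := t)) - (\<integral>s. F (a(k := s)) \<partial>gauss_measure (goe_var v k))))\<^sup>2 \<partial>gauss_measure (goe_var v k)) \<le>
      (\<integral>t. goe_var v k * (cmod (D k (a(k := t))))\<^sup>2 \<partial>gauss_measure (goe_var v k))"
      using gauss_measure_poincare[OF goe_var_pos[OF v] der[OF k] cont[OF k] F(2) D(2)[OF k], of k a] by simp
    have "(cmod (D k a))\<^sup>2 \<le> C\<^sup>2"
      using D(2)[OF k] by (intro power_mono) auto
    then show "\<bar>goe_var v k * (cmod (D k a))\<^sup>2\<bar> \<le> 2 * v * C\<^sup>2"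
      using v by (auto simp: goe_var_def abs_mult intro!: mult_mono) (smt (verit) zero_le_power2)
  qed (use F D in \<open>auto simp: goe_entries_alt[symmetric]\<close>)
  then show ?thesis by simp
qed

section \<open>Differentiating the resolvent in one matrix entry\<close>

definition resolvent_deriv :: "nat \<Rightarrow> (nat \<times> nat \<Rightarrow> real) \<Rightarrow> complex \<Rightarrow> nat \<times> nat \<Rightarrow> nat \<Rightarrow> nat \<Rightarrow> complex" where
  "resolvent_deriv N a z k p q = - (case k of (i, j) \<Rightarrow>
     if i = j then resolvent N a z p i * resolvent N a z i q
     else resolvent N a z p i * resolvent N a z j q + resolvent N a z p j * resolvent N a z i q)"

text \<open>In the resolvent identity the two matrices differ only at (i, j) and its mirror image, a
  single place if i = j. The result is exact, so it yields both the Lipschitz bound and the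
  derivative -G E G, with E the symmetric matrix unit of the coordinate.\<close>

lemma resolvent_fun_upd_diff:
  assumes z: "Im z \<noteq> 0" and pq: "p < N" "q < N" and ij: "i \<le> j" "j < N"
    and G: "\<And>t. G t = resolvent N (a((i, j) := t)) z"
  shows "G t' p q - G t p q = (t' - t) *\<^sub>R
    (- (if i = j then G t' p i * G t i q else G t' p i * G t j q + G t' p j * G t i q))"
proof -
  let ?f = "\<lambda>(r, s). if (r, s) = (i, j) \<or> (r, s) = (j, i) then
    resolvent N (a((i, j) := t')) z p r * of_real (t - t') * resolvent N (a((i, j) := t)) z s q else 0"
  have "G t' p q - G t p q = (\<Sum>r<N. \<Sum>s<N. ?f (r, s))"
    unfolding G resolvent_identity[OF z pq]
  proof (intro sum.cong refl)
    fix r s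
    have "(min r s, max r s) = (i, j) \<longleftrightarrow> (r, s) = (i, j) \<or> (r, s) = (j, i)"
      using ij by (auto simp: min_def max_def)
    then have "(a((i, j) := t)) (min r s, max r s) - (a((i, j) := t')) (min r s, max r s) =
        (if (r, s) = (i, j) \<or> (r, s) = (j, i) then t - t' else 0)"
      by (simp only: fun_upd_apply) simp
    then show "resolvent N (a((i, j) := t')) z p r *
        of_real ((a((i, j) := t)) (min r s, max r s) - (a((i, j) := t')) (min r s, max r s)) *
        resolvent N (a((i, j) := t)) z s q = ?f (r, s)"
      by (simp only: prod.case) (simp del: fun_upd_apply)
  qed
  also have "\<dots> = (\<Sum>x\<in>{..<N} \<times> {..<N}. ?f x)"
    by (simp add: sum.cartesian_product case_prod_beta' cong: if_cong)
  also have "\<dots> = (\<Sum>x\<in>{(i, j), (j, i)}. ?f x)"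
    by (rule sum.mono_neutral_right) (use ij in \<open>auto split: if_splits\<close>)
  also have "\<dots> = (t' - t) *\<^sub>R (- (if i = j then G t' p i * G t i q else G t' p i * G t j q + G t' p j * G t i q))"
    by (cases "i = j") (auto simp: G scaleR_conv_of_real algebra_simps simp del: fun_upd_apply)
  finally show ?thesis .
qed

lemma cmod_resolvent_deriv_le:
  assumes z: "Im z = 1" and "p < N" "q < N" "k \<in> goe_index N"
  shows "cmod (resolvent_deriv N a z k p q) \<le> 2"
proof -
  have le: "cmod (resolvent N a z p' i * resolvent N a z i' q') \<le> 1" if "p' < N" "q' < N" "i < N" "i' < N" for p' i i' q'
    using cmod_resolvent_le[OF z] that by (auto simp: norm_mult intro!: mult_le_one)
  show ?thesis
    using assms(2-) le[of p q "fst k" "fst k"] le[of p q "fst k" "snd k"] le[of p q "snd k" "fst k"]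
    by (auto simp: resolvent_deriv_def goe_index_def norm_minus_cancel split: prod.split simp del: norm_mult
        intro!: order.trans[OF norm_triangle_ineq])
qed

lemma resolvent_lipschitz:
  assumes z: "Im z = 1" and pq: "p < N" "q < N" and k: "k \<in> goe_index N"
  shows "cmod (resolvent N (a(k := t')) z p q - resolvent N (a(k := t)) z p q) \<le> 2 * \<bar>t' - t\<bar>"
proof -
  obtain i j where [simp]: "k = (i, j)" by (cases k)
  have ij: "i \<le> j" "j < N" using k by (auto simp: goe_index_def)
  have le: "cmod (resolvent N (a(k := t')) z p' i * resolvent N (a(k := t)) z i' q') \<le> 1"
    if "p' < N" "q' < N" "i < N" "i' < N" for p' i i' q'
    using cmod_resolvent_le[OF z] that by (auto simp: norm_mult intro!: mult_le_one)
  let ?e = "if i = j then resolvent N (a(k := t')) z p i * resolvent N (a(k := t)) z i q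
    else resolvent N (a(k := t')) z p i * resolvent N (a(k := t)) z j q + resolvent N (a(k := t')) z p j * resolvent N (a(k := t)) z i q"
  have "cmod ?e \<le> 2"
    using pq ij le[of p q i i] le[of p q i j] le[of p q j i]
    by (auto simp del: norm_mult fun_upd_apply intro!: order.trans[OF norm_triangle_ineq])
  then have "\<bar>t' - t\<bar> * cmod ?e \<le> \<bar>t' - t\<bar> * 2" by (intro mult_left_mono) auto
  moreover have "resolvent N (a(k := t')) z p q - resolvent N (a(k := t)) z p q = (t' - t) *\<^sub>R (- ?e)"
    using resolvent_fun_upd_diff[where G = "\<lambda>t. resolvent N (a((i, j) := t)) z", of z p N q i j a t' t] z pq ij by simp
  ultimately show ?thesis by (simp add: norm_minus_cancel mult.commute)
qed

lemma isCont_resolvent: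
  assumes "Im z = 1" "p < N" "q < N" "k \<in> goe_index N"
  shows "isCont (\<lambda>t. resolvent N (a(k := t)) z p q) t"
  unfolding isCont_def
proof (rule Lim_null[THEN iffD2, OF Lim_null_comparison])
  show "\<forall>\<^sub>F t' in at t. norm (resolvent N (a(k := t')) z p q - resolvent N (a(k := t)) z p q) \<le> 2 * \<bar>t' - t\<bar>"
    using resolvent_lipschitz[OF assms] by (intro always_eventually) auto
  show "(\<lambda>t'. 2 * \<bar>t' - t\<bar>) \<midarrow>t\<rightarrow> 0"
    by (auto intro!: tendsto_eq_intros)
qed

lemma continuous_on_resolvent_deriv:
  assumes "Im z = 1" "p < N" "q < N" "k \<in> goe_index N"
  shows "continuous_on UNIV (\<lambda>t. resolvent_deriv N (a(k := t)) z k p q)"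
proof -
  have c: "continuous_on UNIV (\<lambda>t. resolvent N (a(k := t)) z p q)" if "p < N" "q < N" for p q
    using isCont_resolvent[OF assms(1) that assms(4)] by (simp add: continuous_at_imp_continuous_on)
  show ?thesis
    using assms(2-) c unfolding resolvent_deriv_def
    by (cases k; cases "fst k = snd k") (auto simp: goe_index_def simp del: fun_upd_apply intro!: continuous_intros)
qed

text \<open>The difference quotient is an explicit polynomial in resolvent entries at t and t', so
  continuity in t' already gives its limit.\<close>

lemma has_vector_derivative_resolvent:
  assumes z: "Im z = 1" and pq: "p < N" "q < N" and k: "k \<in> goe_index N"
  shows "((\<lambda>t. resolvent N (a(k := t)) z p q) has_vector_derivative resolvent_deriv N (a(k := t)) z k p q) (at t)"
proof -
  obtain i j where [simp]: "k = (i, j)" by (cases k)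
  have ij: "i \<le> j" "j < N" using k by (auto simp: goe_index_def)
  let ?G = "\<lambda>t. resolvent N (a(k := t)) z"
  let ?d = "\<lambda>t'. - (if i = j then ?G t' p i * ?G t i q else ?G t' p i * ?G t j q + ?G t' p j * ?G t i q)"
  have lim: "(\<lambda>t'. resolvent N (a((i, j) := t')) z r s) \<midarrow>t\<rightarrow> resolvent N (a((i, j) := t)) z r s" if "r < N" "s < N" for r s
    using isCont_resolvent[OF z that k] by (simp add: isCont_def)
  have d: "?d \<midarrow>t\<rightarrow> resolvent_deriv N (a(k := t)) z k p q"
    unfolding resolvent_deriv_def using pq ij lim
    by (cases "i = j") (auto simp del: fun_upd_apply intro!: tendsto_intros)
  have "(\<lambda>t'. cmod (?d t' - resolvent_deriv N (a(k := t)) z k p q)) \<midarrow>t\<rightarrow> 0"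
    using d by (intro tendsto_norm_zero) (simp add: LIM_zero)
  then have "(\<lambda>t'. norm ((?G t' p q - ?G t p q) - (t' - t) *\<^sub>R resolvent_deriv N (a(k := t)) z k p q) / norm (t' - t)) \<midarrow>t\<rightarrow> 0"
  proof (rule Lim_transform_eventually)
    have "cmod (?d t' - resolvent_deriv N (a(k := t)) z k p q) =
      norm ((?G t' p q - ?G t p q) - (t' - t) *\<^sub>R resolvent_deriv N (a(k := t)) z k p q) / norm (t' - t)" if "t' \<noteq> t" for t'
    proof -
      have e: "?G t' p q - ?G t p q = (t' - t) *\<^sub>R ?d t'"
        using resolvent_fun_upd_diff[where G = "\<lambda>t. resolvent N (a((i, j) := t)) z", of z p N q i j a t' t] z pq ij by simp
      show ?thesis unfolding e scaleR_diff_right[symmetric] norm_scaleR using that by simp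
    qed
    then show "\<forall>\<^sub>F t' in at t. cmod (?d t' - resolvent_deriv N (a(k := t)) z k p q) =
      norm ((?G t' p q - ?G t p q) - (t' - t) *\<^sub>R resolvent_deriv N (a(k := t)) z k p q) / norm (t' - t)"
      by (auto simp: eventually_at_filter simp del: fun_upd_apply intro!: always_eventually)
  qed
  then show ?thesis
    unfolding has_vector_derivative_def has_derivative_iff_norm by (simp add: bounded_linear_scaleR_left)
qed

section \<open>The expected trace of the resolvent\<close>

definition resolvent_trace :: "nat \<Rightarrow> (nat \<times> nat \<Rightarrow> real) \<Rightarrow> complex \<Rightarrow> complex" where
  "resolvent_trace N a z = (\<Sum>p<N. resolvent N a z p p)"

lemma borel_measurable_resolvent_goe:
  "p < N \<Longrightarrow> q < N \<Longrightarrow> (\<lambda>a. resolvent N a z p q) \<in> borel_measurable (goe_entries N v)"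
  by (rule borel_measurable_resolvent[where X = "\<lambda>a. a"]) (auto intro: goe_entries_entry_measurable)

lemma cmod_resolvent_trace_le: "Im z = 1 \<Longrightarrow> cmod (resolvent_trace N a z) \<le> N"
  unfolding resolvent_trace_def
  by (rule order.trans[OF norm_sum], rule order.trans[OF sum_mono[where g = "\<lambda>_. 1"]])
    (auto intro: cmod_resolvent_le)

lemma borel_measurable_resolvent_trace_goe:
  "(\<lambda>a. resolvent_trace N a z) \<in> borel_measurable (goe_entries N v)"
  unfolding resolvent_trace_def by (auto intro!: borel_measurable_sum borel_measurable_resolvent_goe)

lemma sum_resolvent_deriv:
  "(\<Sum>p<N. resolvent_deriv N a z (i, j) p p) =
    - (if i = j then resolvent_sq N a z i i else resolvent_sq N a z j i + resolvent_sq N a z i j)"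
  by (simp add: resolvent_deriv_def resolvent_sq_def sum_negf sum.distrib mult.commute)

text \<open>This is the energy of the gradient in the Poincare inequality. Off the diagonal the
  factor 2 comes from \<open>(u + w)\<^sup>2 \<le> 2 * u\<^sup>2 + 2 * w\<^sup>2\<close> for the
  moduli, on the diagonal from the doubled variance, so both kinds of entries add up to twice the
  squared Hilbert-Schmidt norm of the squared resolvent.\<close>

lemma sum_goe_var_resolvent_deriv_le:
  assumes z: "Im z = 1"
  shows "(\<Sum>k\<in>goe_index N. goe_var 1 k * (cmod (\<Sum>p<N. resolvent_deriv N a z k p p))\<^sup>2) \<le>
    2 * Im (resolvent_trace N a z)"
proof -
  let ?c = "\<lambda>i j. (cmod (resolvent_sq N a z i j))\<^sup>2"
  have bound: "goe_var 1 (i, j) * (cmod (\<Sum>p<N. resolvent_deriv N a z (i, j) p p))\<^sup>2 \<le>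
     (if i = j then 2 * ?c i i else 2 * ?c i j + 2 * ?c j i)" for i j
  proof (cases "i = j")
    case False
    have "(cmod (u + w))\<^sup>2 \<le> 2 * (cmod w)\<^sup>2 + 2 * (cmod u)\<^sup>2" for u w :: complex
    proof -
      have "(cmod (u + w))\<^sup>2 \<le> (cmod u + cmod w)\<^sup>2" by (intro power_mono norm_triangle_ineq) simp
      also have "\<dots> \<le> 2 * (cmod w)\<^sup>2 + 2 * (cmod u)\<^sup>2"
        using sum_squares_bound[of "cmod u" "cmod w"] by (simp add: power2_sum)
      finally show ?thesis .
    qed
    then show ?thesis using False unfolding sum_resolvent_deriv norm_minus_cancel by (simp add: goe_var_def)
  qed (simp add: sum_resolvent_deriv goe_var_def)
  let ?h = "\<lambda>(i, j). 2 * ?c i j"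
  have "(\<Sum>k\<in>goe_index N. goe_var 1 k * (cmod (\<Sum>p<N. resolvent_deriv N a z k p p))\<^sup>2) \<le>
    (\<Sum>k\<in>goe_index N. ?h k + (if fst k = snd k then 0 else ?h (prod.swap k)))"
  proof (rule sum_mono)
    fix k :: "nat \<times> nat"
    obtain i j where k: "k = (i, j)" by (cases k)
    show "goe_var 1 k * (cmod (\<Sum>p<N. resolvent_deriv N a z k p p))\<^sup>2 \<le>
        ?h k + (if fst k = snd k then 0 else ?h (prod.swap k))"
      unfolding k using bound[of i j] by (simp split: if_splits)
  qed
  also have "\<dots> = (\<Sum>k\<in>goe_index N. ?h k) + (\<Sum>k\<in>{k\<in>goe_index N. fst k \<noteq> snd k}. ?h (prod.swap k))"
    unfolding sum.distrib
    by (rule arg_cong2[where f = "(+)"], rule refl, rule sum.mono_neutral_cong_right) auto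
  \<comment> \<open>Reflection moves the strict upper triangle to the lower one, disjoint from the
    index set, so both sums fit into one sum over the square.\<close>
  also have "(\<Sum>k\<in>{k\<in>goe_index N. fst k \<noteq> snd k}. ?h (prod.swap k)) =
     (\<Sum>k\<in>prod.swap ` {k\<in>goe_index N. fst k \<noteq> snd k}. ?h k)"
    by (subst sum.reindex) (auto simp: inj_on_def)
  also have "(\<Sum>k\<in>goe_index N. ?h k) + \<dots> = (\<Sum>k\<in>goe_index N \<union> prod.swap ` {k\<in>goe_index N. fst k \<noteq> snd k}. ?h k)"
    by (rule sum.union_disjoint[symmetric], simp, simp, auto simp: goe_index_def)
  also have "\<dots> \<le> (\<Sum>k\<in>{..<N} \<times> {..<N}. ?h k)"
    by (rule sum_mono2) (auto simp: goe_index_def)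
  also have "\<dots> = 2 * (\<Sum>i<N. \<Sum>j<N. ?c i j)"
    by (simp add: sum.cartesian_product[symmetric] sum_distrib_left)
  also have "(\<Sum>i<N. \<Sum>j<N. ?c i j) = (\<Sum>k<N. \<Sum>i<N. ?c i k)"
    by (rule sum.swap)
  also have "2 * \<dots> \<le> 2 * Im (resolvent_trace N a z)"
    using sum_resolvent_sq_le[OF z, of N a] by (simp add: resolvent_trace_def)
  finally show ?thesis by simp
qed

text \<open>Take the trace of A G = 1 + z G and integrate each entry of A by parts. This gives minus
  the expectation of the sum \<open>?Q\<close> of squared entries plus the squared trace.
  \<open>?Q\<close> is bounded by \<open>Im g\<close> through the Ward identity, and replacing the
  expected square of the trace by the square of g costs a variance, at most \<open>2 * Im g\<close>
  by the Poincare inequality. Hence the constant 3.\<close>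

lemma goe_loop_inequality:
  fixes N :: nat
  assumes z: "Im z = 1"
  defines "g \<equiv> (\<integral>a. resolvent_trace N a z \<partial>goe_entries N 1)"
  shows "cmod (of_nat N + z * g + g\<^sup>2) \<le> 3 * Im g"
proof -
  let ?P = "goe_entries N 1"
  interpret P: prob_space ?P by (rule prob_space_goe_entries) simp
  let ?G = "\<lambda>a. resolvent N a z" and ?T = "\<lambda>a. resolvent_trace N a z"
  have Gm: "(\<lambda>a. ?G a p q) \<in> borel_measurable ?P" if "p < N" "q < N" for p q
    using that by (rule borel_measurable_resolvent_goe)
  have Gi: "integrable ?P (\<lambda>a. ?G a p q)" if "p < N" "q < N" for p q
    using Gm[OF that] cmod_resolvent_le[OF z that] by (intro P.integrable_const_bound[where B = 1]) auto
  have GGi: "integrable ?P (\<lambda>a. ?G a p q * ?G a p' q')" if "p < N" "q < N" "p' < N" "q' < N" for p q p' q'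
    using Gm[OF that(1,2)] Gm[OF that(3,4)] cmod_resolvent_le[OF z that(1,2)] cmod_resolvent_le[OF z that(3,4)]
    by (intro P.integrable_const_bound[where B = 1]) (auto simp: norm_mult intro!: mult_le_one)
  have Tm[measurable]: "?T \<in> borel_measurable ?P" by (rule borel_measurable_resolvent_trace_goe)
  have Ti: "integrable ?P ?T"
    using cmod_resolvent_trace_le[OF z] by (intro P.integrable_const_bound[where B = N]) auto
  have T2i: "integrable ?P (\<lambda>a. (?T a)\<^sup>2)"
  proof -
    have "(cmod (?T a))\<^sup>2 \<le> (real N)\<^sup>2" for a
      using cmod_resolvent_trace_le[OF z] by (intro power_mono) auto
    then show ?thesis by (intro P.integrable_const_bound[where B = "(real N)\<^sup>2"]) (auto simp: norm_power)
  qed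
  let ?A = "\<lambda>a p q. complex_of_real (a (min p q, max p q))"
  \<comment> \<open>One formula serves all p and q: on the diagonal the doubled variance produces
    the same two terms as the two mirrored places do off it.\<close>
  have stein: "(\<integral>a. ?A a p q * ?G a q p \<partial>?P) = - (\<integral>a. (?G a q p)\<^sup>2 + ?G a p p * ?G a q q \<partial>?P)"
    and AGi: "integrable ?P (\<lambda>a. ?A a p q * ?G a q p)"
    if pq: "p < N" "q < N" for p q
  proof -
    have k: "(min p q, max p q) \<in> goe_index N" using pq by (auto simp: goe_index_def)
    have dm: "(\<lambda>a. resolvent_deriv N a z (min p q, max p q) q p) \<in> borel_measurable ?P"
      unfolding resolvent_deriv_def using pq by (cases "p = q") (auto intro!: Gm borel_measurable_times borel_measurable_add simp: min_def max_def)
    have "(\<integral>a. ?A a p q * ?G a q p \<partial>?P) =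
      goe_var 1 (min p q, max p q) * (\<integral>a. resolvent_deriv N a z (min p q, max p q) q p \<partial>?P)"
      by (rule goe_entries_stein[OF _ k Gm _ dm _ has_vector_derivative_resolvent[OF z _ _ k]
            continuous_on_resolvent_deriv[OF z _ _ k]])
        (use pq cmod_resolvent_le[OF z] cmod_resolvent_deriv_le[OF z _ _ k] in auto)
    also have "\<dots> = (\<integral>a. goe_var 1 (min p q, max p q) * resolvent_deriv N a z (min p q, max p q) q p \<partial>?P)"
      by simp
    also have "\<dots> = (\<integral>a. - ((?G a q p)\<^sup>2 + ?G a p p * ?G a q q) \<partial>?P)"
      by (rule Bochner_Integration.integral_cong)
        (auto simp: goe_var_def resolvent_deriv_def min_def max_def power2_eq_square algebra_simps)
    finally show "(\<integral>a. ?A a p q * ?G a q p \<partial>?P) = - (\<integral>a. (?G a q p)\<^sup>2 + ?G a p p * ?G a q q \<partial>?P)"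
      unfolding Bochner_Integration.integral_minus .
    show "integrable ?P (\<lambda>a. ?A a p q * ?G a q p)"
    proof (rule Bochner_Integration.integrable_bound)
      show "integrable ?P (\<lambda>a. a (min p q, max p q))"
        by (rule integrable_goe_entries_component[OF _ k]) simp
      show "AE a in ?P. norm (?A a p q * ?G a q p) \<le> norm (a (min p q, max p q))"
        using cmod_resolvent_le[OF z pq(2,1)] by (intro AE_I2) (auto simp: norm_mult intro!: mult_left_le)
    qed (use Gm[OF pq(2,1)] goe_entries_component_measurable[OF k] in simp)
  qed
  have dsum: "(\<integral>a. (\<Sum>p<N. \<Sum>q<N. f p q a) \<partial>?P) = (\<Sum>p<N. \<Sum>q<N. \<integral>a. f p q a \<partial>?P)"
    if f: "\<And>p q. p < N \<Longrightarrow> q < N \<Longrightarrow> integrable ?P (f p q)" for f :: "nat \<Rightarrow> nat \<Rightarrow> _ \<Rightarrow> complex"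
  proof -
    have "(\<integral>a. (\<Sum>p<N. \<Sum>q<N. f p q a) \<partial>?P) = (\<Sum>p<N. \<integral>a. (\<Sum>q<N. f p q a) \<partial>?P)"
      by (rule Bochner_Integration.integral_sum) (auto intro!: Bochner_Integration.integrable_sum f)
    also have "\<dots> = (\<Sum>p<N. \<Sum>q<N. \<integral>a. f p q a \<partial>?P)"
      by (intro sum.cong refl Bochner_Integration.integral_sum) (auto intro!: f)
    finally show ?thesis .
  qed
  let ?Q = "\<lambda>a. \<Sum>p<N. \<Sum>q<N. (?G a q p)\<^sup>2"
  have Qi: "integrable ?P ?Q"
    unfolding power2_eq_square by (intro Bochner_Integration.integrable_sum GGi) auto
  have "of_nat N + z * ?T a = (\<Sum>p<N. \<Sum>q<N. ?A a p q * ?G a q p)" for a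
  proof -
    have "(\<Sum>p<N. (\<Sum>q<N. ?A a p q * ?G a q p) - z * ?G a p p) = (\<Sum>p<N. 1)"
      using resolvent_right[of z _ N _ a] z by (intro sum.cong) auto
    then show ?thesis by (simp add: sum_subtractf resolvent_trace_def sum_distrib_left algebra_simps)
  qed
  then have "(\<integral>a. of_nat N + z * ?T a \<partial>?P) = (\<integral>a. (\<Sum>p<N. \<Sum>q<N. ?A a p q * ?G a q p) \<partial>?P)"
    by simp
  also have "\<dots> = (\<Sum>p<N. \<Sum>q<N. \<integral>a. ?A a p q * ?G a q p \<partial>?P)"
    by (rule dsum) (rule AGi)
  also have "\<dots> = - (\<Sum>p<N. \<Sum>q<N. (\<integral>a. (?G a q p)\<^sup>2 + ?G a p p * ?G a q q \<partial>?P))"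
    by (simp add: stein sum_negf)
  also have "(\<Sum>p<N. \<Sum>q<N. (\<integral>a. (?G a q p)\<^sup>2 + ?G a p p * ?G a q q \<partial>?P)) =
      (\<integral>a. (\<Sum>p<N. \<Sum>q<N. (?G a q p)\<^sup>2 + ?G a p p * ?G a q q) \<partial>?P)"
    by (rule dsum[symmetric]) (auto simp: power2_eq_square intro!: GGi)
  also have "(\<lambda>a. \<Sum>p<N. \<Sum>q<N. (?G a q p)\<^sup>2 + ?G a p p * ?G a q q) = (\<lambda>a. ?Q a + (?T a)\<^sup>2)"
    by (simp add: sum.distrib resolvent_trace_def power2_eq_square sum_product)
  also have "(\<integral>a. ?Q a + (?T a)\<^sup>2 \<partial>?P) = (\<integral>a. ?Q a \<partial>?P) + (\<integral>a. (?T a)\<^sup>2 \<partial>?P)"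
    using Qi T2i by (rule Bochner_Integration.integral_add)
  finally have loop: "of_nat N + z * g = - ((\<integral>a. ?Q a \<partial>?P) + (\<integral>a. (?T a)\<^sup>2 \<partial>?P))"
    using Ti by (simp add: g_def P.prob_space)
  have var: "(\<integral>a. (?T a)\<^sup>2 \<partial>?P) - g\<^sup>2 = (\<integral>a. (?T a - g)\<^sup>2 \<partial>?P)"
  proof -
    have "(\<integral>a. (?T a - g)\<^sup>2 \<partial>?P) = (\<integral>a. (?T a)\<^sup>2 + (g\<^sup>2 - 2 * g * ?T a) \<partial>?P)"
      by (rule Bochner_Integration.integral_cong) (auto simp: power2_diff algebra_simps)
    also have "\<dots> = (\<integral>a. (?T a)\<^sup>2 \<partial>?P) + (g\<^sup>2 - 2 * g * g)"
      using Ti T2i by (subst Bochner_Integration.integral_add) (auto simp: P.prob_space g_def)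
    finally show ?thesis by (simp add: power2_eq_square)
  qed
  have Im_g: "(\<integral>a. Im (?T a) \<partial>?P) = Im g"
    unfolding g_def using Ti by (rule integral_Im)
  have ImTi: "integrable ?P (\<lambda>a. Im (?T a))" using Ti by (rule integrable_Im)
  have "cmod (\<integral>a. ?Q a \<partial>?P) \<le> (\<integral>a. cmod (?Q a) \<partial>?P)" by (rule integral_norm_bound)
  also have "\<dots> \<le> (\<integral>a. Im (?T a) \<partial>?P)"
  proof (rule integral_mono)
    fix a
    have "cmod (?Q a) \<le> (\<Sum>p<N. \<Sum>q<N. (cmod (?G a q p))\<^sup>2)"
      by (intro order.trans[OF norm_sum] sum_mono) (simp add: norm_power)
    also have "\<dots> = (\<Sum>p<N. Im (?G a p p))"
      using resolvent_ward[of z _ N a] z by (intro sum.cong) auto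
    finally show "cmod (?Q a) \<le> Im (?T a)" by (simp add: resolvent_trace_def)
  qed (use Qi ImTi in auto)
  finally have Q: "cmod (\<integral>a. ?Q a \<partial>?P) \<le> Im g" by (simp add: Im_g)
  let ?D = "\<lambda>k a. \<Sum>p<N. resolvent_deriv N a z k p p"
  have Dm: "?D k \<in> borel_measurable ?P" if "k \<in> goe_index N" for k
    using that unfolding resolvent_deriv_def
    by (cases k; cases "fst k = snd k") (auto simp: goe_index_def intro!: Gm borel_measurable_diff borel_measurable_times borel_measurable_add borel_measurable_sum borel_measurable_uminus)
  have DB: "cmod (?D k a) \<le> 2 * N" if "k \<in> goe_index N" for k a
    by (rule order.trans[OF norm_sum], rule order.trans[OF sum_mono[where g = "\<lambda>_. 2"]],
        rule cmod_resolvent_deriv_le[OF z _ _ that]) auto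
  have Di: "integrable ?P (\<lambda>a. (cmod (?D k a))\<^sup>2)" if "k \<in> goe_index N" for k
  proof -
    have "(cmod (?D k a))\<^sup>2 \<le> (2 * real N)\<^sup>2" for a
      using DB[OF that] by (intro power_mono) auto
    then show ?thesis using Dm[OF that] by (intro P.integrable_const_bound[where B = "(2 * real N)\<^sup>2"]) auto
  qed
  have "(\<integral>a. (cmod (?T a - g))\<^sup>2 \<partial>?P) \<le> (\<Sum>k\<in>goe_index N. goe_var 1 k * (\<integral>a. (cmod (?D k a))\<^sup>2 \<partial>?P))"
    unfolding g_def
  proof (rule goe_entries_poincare[OF _ Tm cmod_resolvent_trace_le[OF z] Dm DB])
    fix k a t assume k: "k \<in> goe_index N"
    show "((\<lambda>t. ?T (a(k := t))) has_vector_derivative ?D k (a(k := t))) (at t)"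
      unfolding resolvent_trace_def
      by (intro has_vector_derivative_sum has_vector_derivative_resolvent[OF z _ _ k]) auto
    show "continuous_on UNIV (\<lambda>t. ?D k (a(k := t)))"
      by (intro continuous_on_sum continuous_on_resolvent_deriv[OF z _ _ k]) auto
  qed auto
  also have "\<dots> = (\<integral>a. (\<Sum>k\<in>goe_index N. goe_var 1 k * (cmod (?D k a))\<^sup>2) \<partial>?P)"
    using Di by (subst Bochner_Integration.integral_sum) auto
  also have "\<dots> \<le> (\<integral>a. 2 * Im (?T a) \<partial>?P)"
    using Di ImTi sum_goe_var_resolvent_deriv_le[OF z]
    by (intro integral_mono) (auto intro!: Bochner_Integration.integrable_sum)
  finally have "(\<integral>a. (cmod (?T a - g))\<^sup>2 \<partial>?P) \<le> 2 * Im g" by (simp add: Im_g)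
  moreover have "cmod (\<integral>a. (?T a - g)\<^sup>2 \<partial>?P) \<le> (\<integral>a. (cmod (?T a - g))\<^sup>2 \<partial>?P)"
    using integral_norm_bound[of ?P "\<lambda>a. (?T a - g)\<^sup>2"] by (simp add: norm_power)
  moreover have "of_nat N + z * g + g\<^sup>2 = - (\<integral>a. ?Q a \<partial>?P) - (\<integral>a. (?T a - g)\<^sup>2 \<partial>?P)"
    unfolding loop var[symmetric] by (simp add: algebra_simps)
  ultimately show ?thesis
    using Q norm_triangle_ineq4[of "- (\<integral>a. ?Q a \<partial>?P)" "\<integral>a. (?T a - g)\<^sup>2 \<partial>?P"] by simp
qed

text \<open>The quadratic inequality confines \<open>g / \<surd>N\<close> to a neighbourhood of the root \<open>\<i>\<close>
  of \<open>1 + u\<^sup>2\<close> in the upper half plane; the other root is excluded by \<open>Im u \<ge> 0\<close>.\<close>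

lemma goe_local_law:
  assumes z: "Im z = 1" and N: "0 < N"
  defines "u \<equiv> (\<integral>a. resolvent_trace N a z \<partial>goe_entries N 1) / of_real (sqrt N)"
  shows "cmod (u - \<i>) \<le> (cmod z + 3) * (cmod z + 4) / sqrt N"
proof -
  define g where "g = (\<integral>a. resolvent_trace N a z \<partial>goe_entries N 1)"
  have s1: "1 \<le> sqrt N" using N by simp
  then have s: "0 < sqrt N" by linarith
  have g: "g = of_real (sqrt N) * u" using s by (simp add: u_def g_def)
  have ss: "complex_of_real (sqrt N) * complex_of_real (sqrt N) = of_nat N"
    by (metis of_real_mult of_real_of_nat_eq of_nat_0_le_iff real_sqrt_mult_self abs_of_nat)
  have L: "cmod (of_nat N + z * g + g\<^sup>2) \<le> 3 * Im g"
    unfolding g_def by (rule goe_loop_inequality[OF z])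
  \<comment> \<open>The sign of \<open>Im g\<close> comes for free, since \<open>3 * Im g\<close>
    bounds a norm.\<close>
  have "0 \<le> Im g" using order.trans[OF norm_ge_zero L] by simp
  then have Imu: "0 \<le> Im u" using s unfolding g by (simp add: zero_le_mult_iff)
  have "of_nat N + z * g + g\<^sup>2 = of_real (sqrt N) * (of_real (sqrt N) * (1 + u\<^sup>2) + z * u)"
    unfolding g ss[symmetric] by (simp add: power2_eq_square algebra_simps)
  then have "sqrt N * cmod (of_real (sqrt N) * (1 + u\<^sup>2) + z * u) \<le> sqrt N * (3 * Im u)"
    using L s unfolding g by (simp add: norm_mult mult.left_commute)
  then have "cmod (of_real (sqrt N) * (1 + u\<^sup>2) + z * u) \<le> 3 * Im u"
    using s by (simp add: mult_le_cancel_left_pos)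
  also have "\<dots> \<le> 3 * cmod u" using abs_Im_le_cmod[of u] by linarith
  finally have "cmod (of_real (sqrt N) * (1 + u\<^sup>2)) \<le> 3 * cmod u + cmod (z * u)"
    using norm_triangle_ineq4[of "of_real (sqrt N) * (1 + u\<^sup>2) + z * u" "z * u"] by simp
  then have a: "sqrt N * cmod (1 + u\<^sup>2) \<le> (cmod z + 3) * cmod u"
    using s by (simp only: norm_mult norm_of_real) (simp add: algebra_simps)
  \<comment> \<open>A crude a priori bound: for large u the quadratic term would dominate the right
    side of \<open>a\<close>, even with \<open>sqrt N\<close> weakened to 1.\<close>
  have c: "cmod u \<le> cmod z + 4"
  proof (cases "cmod u \<le> 1")
    case False
    have "cmod (1 + u\<^sup>2) \<le> sqrt N * cmod (1 + u\<^sup>2)"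
      using mult_right_mono[OF s1 norm_ge_zero[of "1 + u\<^sup>2"]] by simp
    then have "cmod (u\<^sup>2) \<le> 1 + (cmod z + 3) * cmod u"
      using a norm_triangle_ineq4[of "1 + u\<^sup>2" 1] by simp
    then have "cmod u * cmod u \<le> (cmod z + 4) * cmod u"
      using False by (simp add: power2_eq_square norm_mult algebra_simps)
    then show ?thesis using False by (cases "u = 0") (auto simp: mult_le_cancel_right)
  qed (use norm_ge_zero[of z] in linarith)
  have "sqrt N * cmod (1 + u\<^sup>2) \<le> (cmod z + 3) * (cmod z + 4)"
    using a mult_left_mono[OF c, of "cmod z + 3"] by simp
  then have b: "cmod (1 + u\<^sup>2) \<le> (cmod z + 3) * (cmod z + 4) / sqrt N"
    using s by (simp add: pos_le_divide_eq mult.commute)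
  \<comment> \<open>\<open>1 + u\<^sup>2\<close> is the product of \<open>u - \<i>\<close> and
    \<open>u + \<i>\<close>, and the second factor stays away from 0 on the closed upper half
    plane.\<close>
  have "1 \<le> cmod (u + \<i>)"
    using abs_Im_le_cmod[of "u + \<i>"] Imu by simp
  then have "cmod (u - \<i>) * 1 \<le> cmod (u - \<i>) * cmod (u + \<i>)"
    by (intro mult_left_mono) auto
  also have "\<dots> = cmod (1 + u\<^sup>2)"
    by (simp add: norm_mult[symmetric] algebra_simps power2_eq_square)
  finally show ?thesis using b by simp
qed

section \<open>Cauchy's formula on a strip\<close>

lemma has_contour_integral_linepath_same_Im_iff:
  assumes "Im z = c" "Im z' = c" "Re z = a" "Re z' = b" "a < b"
  shows "(f has_contour_integral I) (linepath z z') \<longleftrightarrow> ((\<lambda>x. f (Complex x c)) has_integral I) {a..b}"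
proof -
  have eq: "linepath z z' x = of_real (linepath a b x) + of_real c * \<i>" for x
    using assms by (simp add: linepath_def complex_eq_iff algebra_simps)
  have "(f has_contour_integral I) (linepath z z') \<longleftrightarrow>
      ((\<lambda>w. f (w + of_real c * \<i>)) has_contour_integral I) (linepath (of_real a) (of_real b))"
    using assms unfolding has_contour_integral_linepath eq
    by (intro has_integral_cong) (auto simp: linepath_def complex_eq_iff scaleR_conv_of_real)
  also have "\<dots> \<longleftrightarrow> ((\<lambda>x. f (Complex x c)) has_integral I) {a..b}"
    using assms by (subst has_contour_integral_linepath_Reals_iff) (auto simp: Complex_eq mult.commute)
  finally show ?thesis .
qed

lemma tendsto_integral_symmetric_interval:
  fixes f :: "real \<Rightarrow> complex"
  assumes f: "integrable lborel f"
  shows "((\<lambda>R. integral {-R..R} f) \<longlongrightarrow> (\<integral>x. f x \<partial>lborel)) at_top"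
proof (rule tendsto_at_topI_sequentially)
  fix X :: "nat \<Rightarrow> real" assume X: "filterlim X at_top sequentially"
  have [measurable]: "f \<in> borel_measurable borel" using f by simp
  have "(\<lambda>n. \<integral>x. indicator {-X n..X n} x *\<^sub>R f x \<partial>lborel) \<longlonglongrightarrow> (\<integral>x. f x \<partial>lborel)"
  proof (rule integral_dominated_convergence[where w = "\<lambda>x. norm (f x)"])
    show "AE x in lborel. (\<lambda>n. indicator {-X n..X n} x *\<^sub>R f x) \<longlonglongrightarrow> f x"
    proof (rule AE_I2)
      fix x
      have "eventually (\<lambda>n. \<bar>x\<bar> \<le> X n) sequentially"
        using X unfolding filterlim_at_top by blast
      then have "eventually (\<lambda>n. indicator {-X n..X n} x *\<^sub>R f x = f x) sequentially"
        by eventually_elim (auto simp: indicator_def)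
      then show "(\<lambda>n. indicator {-X n..X n} x *\<^sub>R f x) \<longlonglongrightarrow> f x"
        by (rule tendsto_eventually)
    qed
  qed (use f in \<open>auto simp: indicator_def\<close>)
  moreover have "(\<integral>x. indicator {-X n..X n} x *\<^sub>R f x \<partial>lborel) = integral {-X n..X n} f" for n
  proof -
    have "set_integrable lborel {-X n..X n} f"
      unfolding set_integrable_def by (rule integrable_mult_indicator[OF _ f]) simp
    from set_borel_integral_eq_integral(2)[OF this] show ?thesis
      by (simp add: set_lebesgue_integral_def)
  qed
  ultimately show "(\<lambda>n. integral {-X n..X n} f) \<longlonglongrightarrow> (\<integral>x. f x \<partial>lborel)" by simp
qed

text \<open>Cauchy's formula on the rectangles \<open>[-R, R] \<times> [-1, 1]\<close> as \<open>R \<rightarrow> \<infinity>\<close>.\<close>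

lemma cauchy_strip_formula:
  fixes F :: "complex \<Rightarrow> complex" and l :: real
  assumes hol: "F holomorphic_on UNIV"
    and int: "integrable lborel (\<lambda>x. F (Complex x 1))" "integrable lborel (\<lambda>x. F (Complex x (- 1)))"
    and bd: "\<And>z. \<bar>Im z\<bar> \<le> 1 \<Longrightarrow> cmod (F z) \<le> B"
  shows "2 * pi * \<i> * F l =
    (\<integral>x. F (Complex x (- 1)) / (Complex x (- 1) - of_real l) \<partial>lborel) -
    (\<integral>x. F (Complex x 1) / (Complex x 1 - of_real l) \<partial>lborel)"
proof -
  let ?f = "\<lambda>z. F z / (z - of_real l)"
  have contF: "continuous_on UNIV F" using hol by (rule holomorphic_on_imp_continuous_on)
  \<comment> \<open>On both boundary lines the denominator has modulus at least 1, so integrability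
    is inherited from F.\<close>
  have intf: "integrable lborel (\<lambda>x. ?f (Complex x c))"
    if c: "\<bar>c\<bar> = 1" and i: "integrable lborel (\<lambda>x. F (Complex x c))" for c
  proof (rule Bochner_Integration.integrable_bound[OF i])
    have contC: "continuous_on UNIV (\<lambda>x. Complex x c)"
      unfolding Complex_eq by (intro continuous_intros)
    have ne: "Complex x c - of_real l \<noteq> 0" for x using c by (auto simp: complex_eq_iff)
    have "continuous_on UNIV (\<lambda>x. ?f (Complex x c))"
      using ne by (intro continuous_intros contC continuous_on_compose2[OF contF contC]) auto
    then show "(\<lambda>x. ?f (Complex x c)) \<in> borel_measurable lborel"
      by (simp add: borel_measurable_continuous_onI)
    have "1 \<le> cmod (Complex x c - of_real l)" for x
      using abs_Im_le_cmod[of "Complex x c - of_real l"] c by simp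
    then show "AE x in lborel. norm (?f (Complex x c)) \<le> norm (F (Complex x c))"
      by (intro AE_I2) (simp add: norm_divide divide_le_eq_1 divide_le_eq mult_left_le_one_le mult_le_cancel_left1)
  qed
  have lim1: "((\<lambda>R. integral {-R..R} (\<lambda>x. ?f (Complex x 1))) \<longlongrightarrow> (\<integral>x. ?f (Complex x 1) \<partial>lborel)) at_top"
    by (intro tendsto_integral_symmetric_interval intf int) simp
  have lim2: "((\<lambda>R. integral {-R..R} (\<lambda>x. ?f (Complex x (-1)))) \<longlongrightarrow> (\<integral>x. ?f (Complex x (-1)) \<partial>lborel)) at_top"
    by (intro tendsto_integral_symmetric_interval intf int) simp
  have B0: "0 \<le> B" using order.trans[OF norm_ge_zero bd[of 0]] by simp
  \<comment> \<open>The error consists of the two vertical sides. Each has length 2 and distance at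
    least \<open>R - \<bar>l\<bar>\<close> from l, hence the factor 4.\<close>
  have main: "cmod (integral {-R..R} (\<lambda>x. ?f (Complex x (-1))) - integral {-R..R} (\<lambda>x. ?f (Complex x 1)) - 2 * pi * \<i> * F l)
      \<le> 4 * B / (R - \<bar>l\<bar>)" if R: "\<bar>l\<bar> < R" for R
  proof -
    define a1 a2 a3 a4 where "a1 = Complex (-R) (-1)" "a2 = Complex R (-1)" "a3 = Complex R 1" "a4 = Complex (-R) 1"
    note a = this
    have R0: "0 < R" using R by linarith
    have on: "path_image (rectpath a1 a3) \<subseteq> UNIV - {complex_of_real l}"
      using R by (auto simp: path_image_rectpath a)
    have w: "winding_number (rectpath a1 a3) (of_real l) = 1"
      using R by (intro winding_number_rectpath) (auto simp: in_box_complex_iff a)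
    have "(?f has_contour_integral (2 * pi * \<i> * winding_number (rectpath a1 a3) l * F l)) (rectpath a1 a3)"
      by (rule Cauchy_integral_formula_convex_simple[OF convex_UNIV hol]) (use on in auto)
    then have C: "(?f has_contour_integral (2 * pi * \<i> * F l)) (rectpath a1 a3)"
      by (simp add: w)
    have ci: "?f contour_integrable_on linepath p q" if "closed_segment p q \<subseteq> path_image (rectpath a1 a3)" for p q
      using that on by (intro contour_integrable_continuous_linepath continuous_intros continuous_on_subset[OF contF]) auto
    have im: "path_image (rectpath a1 a3) = closed_segment a1 a2 \<union> (closed_segment a2 a3 \<union> (closed_segment a3 a4 \<union> closed_segment a4 a1))"
      by (simp add: rectpath_def Let_def path_image_join a)
    define I1 I2 I3 I4 where "I1 = contour_integral (linepath a1 a2) ?f" "I2 = contour_integral (linepath a2 a3) ?f"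
      "I3 = contour_integral (linepath a3 a4) ?f" "I4 = contour_integral (linepath a4 a1) ?f"
    note I = this
    have h: "(?f has_contour_integral I1) (linepath a1 a2)" "(?f has_contour_integral I2) (linepath a2 a3)"
      "(?f has_contour_integral I3) (linepath a3 a4)" "(?f has_contour_integral I4) (linepath a4 a1)"
      unfolding I by (intro has_contour_integral_integral ci; simp add: im; blast)+
    have "(?f has_contour_integral (I1 + (I2 + (I3 + I4)))) (rectpath a1 a3)"
      unfolding rectpath_def Let_def using h by (intro has_contour_integral_join) (auto simp: a)
    then have sum: "2 * pi * \<i> * F l = I1 + (I2 + (I3 + I4))"
      by (rule has_contour_integral_unique[OF C])
    have I1: "I1 = integral {-R..R} (\<lambda>x. ?f (Complex x (-1)))"
      using has_contour_integral_linepath_same_Im_iff[of a1 "-1" a2 "-R" R ?f I1] h(1) R0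
      by (auto simp: a intro: integral_unique[symmetric])
    \<comment> \<open>The rectangle traverses its top side from right to left, hence the minus
      sign.\<close>
    have "(?f has_contour_integral (- I3)) (linepath a4 a3)"
      using has_contour_integral_reversepath[OF _ h(3)] by simp
    then have I3: "- I3 = integral {-R..R} (\<lambda>x. ?f (Complex x 1))"
      using has_contour_integral_linepath_same_Im_iff[of a4 1 a3 "-R" R ?f "- I3"] R0
      by (auto simp: a intro: integral_unique[symmetric])
    have side: "cmod J \<le> B / (R - \<bar>l\<bar>) * 2" if J: "(?f has_contour_integral J) (linepath p q)"
      and pq: "\<bar>Re p\<bar> = R" "Re q = Re p" "\<bar>Im p\<bar> = 1" "\<bar>Im q\<bar> = 1" "cmod (q - p) = 2" for J p q
    proof -
      have "norm J \<le> B / (R - \<bar>l\<bar>) * norm (q - p)"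
      proof (rule has_contour_integral_bound_linepath[OF J])
        show "0 \<le> B / (R - \<bar>l\<bar>)" using B0 R by simp
        fix x assume x: "x \<in> closed_segment p q"
        have xs: "Re x = Re p" "\<bar>Im x\<bar> \<le> 1"
        proof -
          obtain u where u: "0 \<le> u" "u \<le> 1" "x = (1 - u) *\<^sub>R p + u *\<^sub>R q"
            using x by (auto simp: closed_segment_def)
          show "Re x = Re p" unfolding u(3) using pq by (simp add: algebra_simps)
          have "\<bar>Im x\<bar> \<le> (1 - u) * \<bar>Im p\<bar> + u * \<bar>Im q\<bar>"
            unfolding u(3) using u(1,2) by (auto simp: abs_mult intro!: order.trans[OF abs_triangle_ineq])
          then show "\<bar>Im x\<bar> \<le> 1" using pq by simp
        qed
        have "R - \<bar>l\<bar> \<le> \<bar>Re (x - of_real l)\<bar>" using xs pq by auto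
        also have "\<dots> \<le> cmod (x - of_real l)" by (rule abs_Re_le_cmod)
        finally show "norm (?f x) \<le> B / (R - \<bar>l\<bar>)"
          unfolding norm_divide using bd[OF xs(2)] R B0 by (intro frac_le) auto
      qed
      then show ?thesis using pq by simp
    qed
    have two: "cmod (Complex 0 2) = 2" "cmod (Complex 0 (-2)) = 2" by (simp_all add: cmod_def)
    have "cmod I2 \<le> B / (R - \<bar>l\<bar>) * 2"
      using R0 two by (intro side[OF h(2)]) (auto simp: a complex_diff)
    moreover have "cmod I4 \<le> B / (R - \<bar>l\<bar>) * 2"
      using R0 two by (intro side[OF h(4)]) (auto simp: a complex_diff)
    moreover have "integral {-R..R} (\<lambda>x. ?f (Complex x (-1))) - integral {-R..R} (\<lambda>x. ?f (Complex x 1)) - 2 * pi * \<i> * F l = - (I2 + I4)"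
      unfolding sum I1[symmetric] I3[symmetric] by simp
    ultimately show ?thesis
      using norm_triangle_ineq[of I2 I4] by (simp add: norm_minus_cancel del: minus_add_distrib)
  qed
  have "((\<lambda>R. integral {-R..R} (\<lambda>x. ?f (Complex x (-1))) - integral {-R..R} (\<lambda>x. ?f (Complex x 1)) - 2 * pi * \<i> * F l) \<longlongrightarrow> 0) at_top"
  proof (rule Lim_null_comparison)
    show "\<forall>\<^sub>F R in at_top. cmod (integral {-R..R} (\<lambda>x. ?f (Complex x (-1))) - integral {-R..R} (\<lambda>x. ?f (Complex x 1)) - 2 * pi * \<i> * F l)
      \<le> 4 * B / (R - \<bar>l\<bar>)"
      using eventually_gt_at_top[of "\<bar>l\<bar>"] by eventually_elim (rule main)
    show "((\<lambda>R. 4 * B / (R - \<bar>l\<bar>)) \<longlongrightarrow> 0) at_top" by real_asymp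
  qed
  then have "(\<integral>x. ?f (Complex x (-1)) \<partial>lborel) - (\<integral>x. ?f (Complex x 1) \<partial>lborel) - 2 * pi * \<i> * F l = 0"
    by (rule tendsto_unique[OF _ tendsto_diff[OF tendsto_diff[OF lim2 lim1] tendsto_const], rotated]) simp
  then show ?thesis by (simp add: algebra_simps)
qed

section \<open>Linear spectral statistics\<close>

lemma integrable_inverse_1_plus_square_lborel: "integrable lborel (\<lambda>x::real. 1 / (1 + x\<^sup>2))"
  using integrable_inverse_1_plus_square by (simp add: set_integrable_def inverse_eq_divide)

lemma integral_inverse_1_plus_square_lborel: "(\<integral>x. 1 / (1 + x\<^sup>2) \<partial>lborel) = pi"
  using LBINT_inverse_1_plus_square
  by (simp add: interval_lebesgue_integral_def set_lebesgue_integral_def inverse_eq_divide)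

text \<open>The imaginary part is \<pi> times the Poisson kernel of width e centred at l; substitute
  \<open>x = l + e * u\<close>.\<close>

lemma integral_poisson_kernel:
  fixes f :: "real \<Rightarrow> real"
  assumes cont: "continuous_on UNIV f" and b: "\<And>x. \<bar>f x\<bar> \<le> B" and e: "0 < e"
  shows "integrable lborel (\<lambda>x. f x * Im (1 / (of_real l - Complex x e)))"
    and "(\<integral>x. f x * Im (1 / (of_real l - Complex x e)) \<partial>lborel) = (\<integral>u. f (l + e * u) / (1 + u\<^sup>2) \<partial>lborel)"
proof -
  have [measurable]: "f \<in> borel_measurable borel" using cont by (rule borel_measurable_continuous_onI)
  have ker: "Im (1 / (of_real l - Complex (l + e * u) e)) = 1 / (e * (1 + u\<^sup>2))" for u
  proof -
    have "Im (1 / (of_real l - Complex (l + e * u) e)) = e / ((e * u)\<^sup>2 + e\<^sup>2)"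
      by (simp add: Im_divide)
    also have "(e * u)\<^sup>2 + e\<^sup>2 = e * (e * (1 + u\<^sup>2))" by (simp add: power2_eq_square algebra_simps)
    finally show ?thesis using e by simp
  qed
  have "integrable lborel (\<lambda>u. f (l + e * u) * (1 / (1 + u\<^sup>2)))"
  proof (rule Bochner_Integration.integrable_bound)
    show "integrable lborel (\<lambda>u. B * (1 / (1 + u\<^sup>2)))"
      by (intro integrable_mult_right integrable_inverse_1_plus_square_lborel)
    show "AE u in lborel. norm (f (l + e * u) * (1 / (1 + u\<^sup>2))) \<le> norm (B * (1 / (1 + u\<^sup>2)))"
      unfolding real_norm_def abs_mult
      by (intro AE_I2 mult_right_mono order.trans[OF b abs_ge_self] abs_ge_zero)
  qed simp
  then have "integrable lborel (\<lambda>u. (1 / e) * (f (l + e * u) * (1 / (1 + u\<^sup>2))))"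
    by (rule integrable_mult_right)
  then have "integrable lborel (\<lambda>u. f (l + e * u) * Im (1 / (of_real l - Complex (l + e * u) e)))"
    unfolding ker using e by (simp add: mult_ac)
  then show "integrable lborel (\<lambda>x. f x * Im (1 / (of_real l - Complex x e)))"
    using e by (subst (asm) lborel_integrable_real_affine_iff) auto
  show "(\<integral>x. f x * Im (1 / (of_real l - Complex x e)) \<partial>lborel) = (\<integral>u. f (l + e * u) / (1 + u\<^sup>2) \<partial>lborel)"
    using e by (subst lborel_integral_real_affine[where c = e and t = l])
      (auto simp: ker integral_mult_right_zero[symmetric] simp del: integral_mult_right_zero intro!: Bochner_Integration.integral_cong)
qed

text \<open>After rescaling, the kernel is free of the width and only the argument of f moves, so
  the fixed kernel times B dominates.\<close>

lemma poisson_kernel_tendsto: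
  fixes f :: "real \<Rightarrow> real"
  assumes cont: "continuous_on UNIV f" and b: "\<And>x. \<bar>f x\<bar> \<le> B"
  shows "(\<lambda>n. \<integral>x. f x * Im (1 / (of_real l - Complex x (1 / real (Suc n)))) \<partial>lborel) \<longlonglongrightarrow> f l * pi"
proof -
  have [measurable]: "f \<in> borel_measurable borel" using cont by (rule borel_measurable_continuous_onI)
  have "(\<lambda>n. \<integral>u. f (l + 1 / real (Suc n) * u) / (1 + u\<^sup>2) \<partial>lborel) \<longlonglongrightarrow> (\<integral>u. f l / (1 + u\<^sup>2) \<partial>lborel)"
  proof (rule integral_dominated_convergence[where w = "\<lambda>u. B * (1 / (1 + u\<^sup>2))"])
    show "integrable lborel (\<lambda>u. B * (1 / (1 + u\<^sup>2)))"
      by (intro integrable_mult_right integrable_inverse_1_plus_square_lborel)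
    show "AE u in lborel. (\<lambda>n. f (l + 1 / real (Suc n) * u) / (1 + u\<^sup>2)) \<longlonglongrightarrow> f l / (1 + u\<^sup>2)"
    proof (rule AE_I2)
      fix u :: real
      have "(\<lambda>n. 1 / real (Suc n) * u) \<longlonglongrightarrow> 0 * u"
        by (intro tendsto_mult tendsto_const) (use LIMSEQ_inverse_real_of_nat in \<open>simp add: inverse_eq_divide\<close>)
      then have "(\<lambda>n. l + 1 / real (Suc n) * u) \<longlonglongrightarrow> l"
        using tendsto_add[OF tendsto_const[of l]] by fastforce
      moreover have "isCont f l" using cont by (simp add: continuous_on_eq_continuous_at)
      ultimately have "(\<lambda>n. f (l + 1 / real (Suc n) * u)) \<longlonglongrightarrow> f l"
        by (rule isCont_tendsto_compose[rotated])
      moreover have "1 + u\<^sup>2 \<noteq> 0" by (smt (verit) zero_le_power2)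
      ultimately show "(\<lambda>n. f (l + 1 / real (Suc n) * u) / (1 + u\<^sup>2)) \<longlonglongrightarrow> f l / (1 + u\<^sup>2)"
        by (intro tendsto_divide tendsto_const)
    qed
    show "AE u in lborel. norm (f (l + 1 / real (Suc n) * u) / (1 + u\<^sup>2)) \<le> B * (1 / (1 + u\<^sup>2))" for n
      using b by (intro AE_I2) (auto simp: intro!: divide_right_mono)
  qed simp_all
  also have "(\<integral>u. f l / (1 + u\<^sup>2) \<partial>lborel) = f l * pi"
    using integral_mult_right_zero[of lborel "f l" "\<lambda>u. 1 / (1 + u\<^sup>2)"]
    by (simp add: integral_inverse_1_plus_square_lborel del: integral_mult_right_zero)
  finally show ?thesis
    using integral_poisson_kernel(2)[OF cont b, where l = l] by simp
qed

lemma integrable_sum_mset: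
  fixes f :: "'i \<Rightarrow> 'a \<Rightarrow> 'b::{banach, second_countable_topology}"
  assumes "\<And>x. integrable M (f x)"
  shows "integrable M (\<lambda>\<omega>. \<Sum>x\<in>#A. f x \<omega>)" "(\<integral>\<omega>. (\<Sum>x\<in>#A. f x \<omega>) \<partial>M) = (\<Sum>x\<in>#A. \<integral>\<omega>. f x \<omega> \<partial>M)"
proof -
  show i: "integrable M (\<lambda>\<omega>. \<Sum>x\<in>#A. f x \<omega>)" for A
    by (induct A) (auto intro: assms)
  show "(\<integral>\<omega>. (\<Sum>x\<in>#A. f x \<omega>) \<partial>M) = (\<Sum>x\<in>#A. \<integral>\<omega>. f x \<omega> \<partial>M)"
  proof (induct A)
    case (add x A)
    show ?case by (simp add: Bochner_Integration.integral_add[OF assms i] add)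
  qed simp
qed

lemma tendsto_sum_mset:
  fixes g :: "'i \<Rightarrow> nat \<Rightarrow> 'b::real_normed_vector"
  assumes "\<And>x. g x \<longlonglongrightarrow> l x"
  shows "(\<lambda>n. \<Sum>x\<in>#A. g x n) \<longlonglongrightarrow> (\<Sum>x\<in>#A. l x)"
  by (induct A) (auto intro!: tendsto_add assms)

lemma Im_sum_mset: "Im (\<Sum>x\<in>#A. f x) = (\<Sum>x\<in>#A. Im (f x))"
  by (induct A) auto

lemma Re_sum_mset: "Re (\<Sum>x\<in>#A. f x) = (\<Sum>x\<in>#A. Re (f x))"
  by (induct A) auto

lemma norm_sum_mset_le:
  fixes f :: "'i \<Rightarrow> 'b::real_normed_vector" and B :: real
  assumes "\<And>x. norm (f x) \<le> B"
  shows "norm (\<Sum>x\<in>#A. f x) \<le> size A * B"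
  by (induct A) (auto simp: algebra_simps intro!: order.trans[OF norm_triangle_ineq] add_mono assms)

lemma norm_sum_spec_le:
  fixes f :: "real \<Rightarrow> 'b::real_normed_vector" and B :: real
  assumes "\<And>x. norm (f x) \<le> B"
  shows "norm (\<Sum>x\<in>#spec N a. f x) \<le> N * B"
  using norm_sum_mset_le[OF assms, where A = "spec N a"] by simp

lemma resolvent_trace_eq: "Im z \<noteq> 0 \<Longrightarrow> resolvent_trace N a z = (\<Sum>x\<in>#spec N a. 1 / (of_real x - z))"
  unfolding resolvent_trace_def by (rule sum_resolvent_diag)

text \<open>Individual eigenvalues are not manifestly measurable functions of the entries; the traces of
  the resolvent are, and Poisson smoothing recovers every linear statistic from them.\<close>

lemma borel_measurable_sum_spec_real:
  fixes f :: "'a \<Rightarrow> real \<Rightarrow> real"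
  assumes X: "\<And>i j. i \<le> j \<Longrightarrow> j < N \<Longrightarrow> (\<lambda>\<omega>. X \<omega> (i, j)) \<in> borel_measurable M"
    and f: "(\<lambda>(\<omega>, x). f \<omega> x) \<in> borel_measurable (M \<Otimes>\<^sub>M lborel)"
    and cont: "\<And>\<omega>. continuous_on UNIV (f \<omega>)" and b: "\<And>\<omega> x. \<bar>f \<omega> x\<bar> \<le> B"
  shows "(\<lambda>\<omega>. \<Sum>x\<in>#spec N (X \<omega>). f \<omega> x) \<in> borel_measurable M"
proof -
  define P where "P n \<omega> = (\<integral>x. f \<omega> x * Im (resolvent_trace N (X \<omega>) (Complex x (1 / real (Suc n)))) \<partial>lborel)" for n \<omega>
  have P_meas: "P n \<in> borel_measurable M" for n
  proof -
    have c: "(\<lambda>p::'a \<times> real. Complex (snd p) (1 / real (Suc n))) \<in> borel_measurable (M \<Otimes>\<^sub>M lborel)"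
      unfolding Complex_eq by measurable
    have "(\<lambda>p. resolvent_trace N (X (fst p)) (Complex (snd p) (1 / real (Suc n)))) \<in> borel_measurable (M \<Otimes>\<^sub>M lborel)"
      unfolding resolvent_trace_def
      by (intro borel_measurable_sum borel_measurable_resolvent c measurable_compose[OF measurable_fst X]) auto
    then have "(\<lambda>(\<omega>, x). f \<omega> x * Im (resolvent_trace N (X \<omega>) (Complex x (1 / real (Suc n))))) \<in> borel_measurable (M \<Otimes>\<^sub>M lborel)"
      using f by (auto simp: case_prod_beta')
    then show ?thesis
      unfolding P_def by (rule lborel.borel_measurable_lebesgue_integral)
  qed
  have lim: "(\<lambda>n. P n \<omega>) \<longlonglongrightarrow> (\<Sum>x\<in>#spec N (X \<omega>). f \<omega> x * pi)" for \<omega>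
  proof -
    have "P n \<omega> = (\<Sum>l\<in>#spec N (X \<omega>). \<integral>x. f \<omega> x * Im (1 / (of_real l - Complex x (1 / real (Suc n)))) \<partial>lborel)" for n
    proof -
      have "P n \<omega> = (\<integral>x. (\<Sum>l\<in>#spec N (X \<omega>). f \<omega> x * Im (1 / (of_real l - Complex x (1 / real (Suc n))))) \<partial>lborel)"
        unfolding P_def by (simp add: resolvent_trace_eq Im_sum_mset sum_mset_distrib_left image_mset.compositionality comp_def)
      also have "\<dots> = (\<Sum>l\<in>#spec N (X \<omega>). \<integral>x. f \<omega> x * Im (1 / (of_real l - Complex x (1 / real (Suc n)))) \<partial>lborel)"
        by (intro integrable_sum_mset(2) integral_poisson_kernel(1)[OF cont b]) simp
      finally show ?thesis .
    qed
    then show ?thesis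
      using tendsto_sum_mset[OF poisson_kernel_tendsto[OF cont b]] by simp
  qed
  have "(\<lambda>\<omega>. \<Sum>x\<in>#spec N (X \<omega>). f \<omega> x * pi) \<in> borel_measurable M"
    by (rule borel_measurable_LIMSEQ_real[OF lim P_meas])
  then have "(\<lambda>\<omega>. (\<Sum>x\<in>#spec N (X \<omega>). f \<omega> x * pi) / pi) \<in> borel_measurable M"
    by simp
  then show ?thesis
    by (simp add: sum_mset_distrib_right[symmetric])
qed

lemma borel_measurable_sum_spec:
  fixes f :: "'a \<Rightarrow> real \<Rightarrow> complex"
  assumes X: "\<And>i j. i \<le> j \<Longrightarrow> j < N \<Longrightarrow> (\<lambda>\<omega>. X \<omega> (i, j)) \<in> borel_measurable M"
    and f: "(\<lambda>(\<omega>, x). f \<omega> x) \<in> borel_measurable (M \<Otimes>\<^sub>M lborel)"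
    and cont: "\<And>\<omega>. continuous_on UNIV (f \<omega>)" and b: "\<And>\<omega> x. cmod (f \<omega> x) \<le> B"
  shows "(\<lambda>\<omega>. \<Sum>x\<in>#spec N (X \<omega>). f \<omega> x) \<in> borel_measurable M"
proof -
  have "(\<lambda>\<omega>. \<Sum>x\<in>#spec N (X \<omega>). Re (f \<omega> x)) \<in> borel_measurable M"
    using f by (intro borel_measurable_sum_spec_real[where X = X and B = B] X continuous_intros cont order.trans[OF abs_Re_le_cmod b])
      (auto simp: case_prod_beta')
  moreover have "(\<lambda>\<omega>. \<Sum>x\<in>#spec N (X \<omega>). Im (f \<omega> x)) \<in> borel_measurable M"
    using f by (intro borel_measurable_sum_spec_real[where X = X and B = B] X continuous_intros cont order.trans[OF abs_Im_le_cmod b])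
      (auto simp: case_prod_beta')
  ultimately show ?thesis
    by (subst borel_measurable_complex_iff) (simp add: Re_sum_mset Im_sum_mset)
qed

lemma borel_measurable_sum_spec_goe:
  fixes f :: "real \<Rightarrow> complex"
  assumes cont: "continuous_on UNIV f" and b: "\<And>x. cmod (f x) \<le> B"
  shows "(\<lambda>a. \<Sum>x\<in>#spec N a. f x) \<in> borel_measurable (goe_entries N v)"
proof -
  have [measurable]: "f \<in> borel_measurable borel" using cont by (rule borel_measurable_continuous_onI)
  show ?thesis
    by (rule borel_measurable_sum_spec[where X = "\<lambda>a. a"])
      (auto intro: goe_entries_entry_measurable cont b)
qed

lemma integrable_sum_spec_goe:
  fixes f :: "real \<Rightarrow> complex"
  assumes v: "0 < v" and cont: "continuous_on UNIV f" and b: "\<And>x. cmod (f x) \<le> B"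
  shows "integrable (goe_entries N v) (\<lambda>a. \<Sum>x\<in>#spec N a. f x)"
proof -
  interpret prob_space "goe_entries N v" using v by (rule prob_space_goe_entries)
  show ?thesis
    by (rule integrable_const_bound[where B = "N * B"])
      (use norm_sum_spec_le[OF b] borel_measurable_sum_spec_goe[OF cont b] in auto)
qed

lemma sym_mat_dim [simp]: "dim_row (sym_mat N a) = N" "dim_col (sym_mat N a) = N"
  by (simp_all add: sym_mat_def)

text \<open>The characteristic polynomial of c A + s at y is the N-th power of c times that of A at
  \<open>(y - s) / c\<close>. The case c = 1 serves the diagonal shifts, the case s = 0 the change
  of variance.\<close>

lemma spec_affine:
  assumes c: "0 < c" and a': "\<And>i j. i \<le> j \<Longrightarrow> j < N \<Longrightarrow> a' (i, j) = c * a (i, j) + (if i = j then s else 0)"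
  shows "spec N a' = image_mset (\<lambda>x. c * x + s) (spec N a)"
proof -
  obtain bs where bs: "char_poly (sym_mat N a) = (\<Prod>b\<leftarrow>bs. [:- b, 1:])" "length bs = N" "spec N a = mset bs"
    by (rule obtain_spec)
  have prod: "poly (\<Prod>b\<leftarrow>bs. [:- b, 1:]) y = (\<Prod>b\<leftarrow>bs. y - b)" for bs and y :: real
    by (induct bs) (auto simp: algebra_simps)
  have "poly (char_poly (sym_mat N a')) y = poly (\<Prod>b\<leftarrow>map (\<lambda>x. c * x + s) bs. [:- b, 1:]) y" for y
  proof -
    let ?y = "(y - s) / c"
    have m: "- char_matrix (sym_mat N a') y = c \<cdot>\<^sub>m (- char_matrix (sym_mat N a) ?y)"
      using c by (intro eq_matI) (auto simp: char_matrix_def a' field_simps)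
    have "poly (char_poly (sym_mat N a')) y = Determinant.det (c \<cdot>\<^sub>m (- char_matrix (sym_mat N a) ?y))"
      by (simp add: char_poly_matrix[OF sym_mat_carrier] m)
    also have "\<dots> = c ^ N * poly (char_poly (sym_mat N a)) ?y"
      by (subst det_smult) (simp add: char_poly_matrix[OF sym_mat_carrier] char_matrix_def)
    also have "poly (char_poly (sym_mat N a)) ?y = (\<Prod>b\<leftarrow>bs. ?y - b)"
      by (simp add: bs(1) prod)
    also have "c ^ N * \<dots> = (\<Prod>b\<leftarrow>bs. y - (c * b + s))"
      unfolding bs(2)[symmetric] using c by (induct bs) (auto simp: field_simps)
    also have "\<dots> = poly (\<Prod>b\<leftarrow>map (\<lambda>x. c * x + s) bs. [:- b, 1:]) y"
      using prod[of "map (\<lambda>x. c * x + s) bs" y] by (simp only: map_map comp_def)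
    finally show ?thesis .
  qed
  then have "char_poly (sym_mat N a') = (\<Prod>b\<leftarrow>map (\<lambda>x. c * x + s) bs. [:- b, 1:])"
    by (intro poly_eq_poly_eq_iff[THEN iffD1] ext)
  then show ?thesis
    by (simp only: proots_linear_factors bs(3) mset_map)
qed

section \<open>The density of the Gaussian orthogonal ensemble\<close>

lemma nn_integral_gauss_measure:
  assumes "0 < v" and [measurable]: "h \<in> borel_measurable borel"
  shows "(\<integral>\<^sup>+x. h x \<partial>gauss_measure v) = (\<integral>\<^sup>+x. ennreal (normal_density 0 (sqrt v) x) * h x \<partial>lborel)"
  using assms(1) by (simp add: gauss_measure_def nn_integral_density)

text \<open>The Cameron-Martin formula in one dimension: the exponential is the ratio of the
  densities at x - s and at x.\<close>

lemma nn_integral_gauss_shift: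
  assumes v: "0 < v" and [measurable]: "h \<in> borel_measurable borel"
  shows "(\<integral>\<^sup>+x. h (x + s) \<partial>gauss_measure v) =
    (\<integral>\<^sup>+x. h x * ennreal (exp (s * x / v - s\<^sup>2 / (2 * v))) \<partial>gauss_measure v)"
proof -
  let ?n = "normal_density 0 (sqrt v)" and ?w = "\<lambda>x. exp (s * x / v - s\<^sup>2 / (2 * v))"
  have eq: "?n (s + x) * ?w (s + x) = ?n x" for x
  proof -
    have "- (s + x - 0)\<^sup>2 / (2 * (sqrt v)\<^sup>2) + (s * (s + x) / v - s\<^sup>2 / (2 * v)) = - (x - 0)\<^sup>2 / (2 * (sqrt v)\<^sup>2)"
      using v by (simp add: field_simps power2_eq_square)
    then show ?thesis unfolding normal_density_def by (simp add: exp_add[symmetric] mult.assoc)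
  qed
  have "(\<integral>\<^sup>+x. h x * ennreal (?w x) \<partial>gauss_measure v) = (\<integral>\<^sup>+x. ennreal (?n x) * (h x * ennreal (?w x)) \<partial>lborel)"
    using v by (rule nn_integral_gauss_measure) simp
  also have "\<dots> = (\<integral>\<^sup>+x. ennreal (?n (s + x)) * (h (s + x) * ennreal (?w (s + x))) \<partial>lborel)"
    by (subst nn_integral_real_affine[where c = 1 and t = s]) auto
  also have "\<dots> = (\<integral>\<^sup>+x. ennreal (?n (s + x) * ?w (s + x)) * h (s + x) \<partial>lborel)"
    by (simp add: ennreal_mult mult_ac)
  also have "\<dots> = (\<integral>\<^sup>+x. h (x + s) \<partial>gauss_measure v)"
    unfolding eq using v by (subst nn_integral_gauss_measure) (auto simp: add.commute)
  finally show ?thesis by simp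
qed

text \<open>The shift leaves coordinates outside D alone. For D inside the index set, points of the
  product space therefore keep their undefined values elsewhere and stay in the space.\<close>

definition shift_on :: "'i set \<Rightarrow> real \<Rightarrow> ('i \<Rightarrow> real) \<Rightarrow> 'i \<Rightarrow> real" where
  "shift_on D s a = (\<lambda>k. if k \<in> D then a k + s else a k)"

lemma measurable_shift_on:
  assumes "D \<subseteq> goe_index N"
  shows "shift_on D s \<in> measurable (goe_entries N v) (goe_entries N v)"
  unfolding goe_entries_alt shift_on_def
proof (rule measurable_PiM_single')
  fix k assume k: "k \<in> goe_index N"
  have "(\<lambda>a. a k) \<in> borel_measurable (Pi\<^sub>M (goe_index N) (\<lambda>k. gauss_measure (goe_var v k)))"
    using goe_entries_component_measurable[OF k, of v] by (simp add: goe_entries_alt)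
  then show "(\<lambda>a. if k \<in> D then a k + s else a k) \<in>
      measurable (Pi\<^sub>M (goe_index N) (\<lambda>k. gauss_measure (goe_var v k))) (gauss_measure (goe_var v k))"
    by (auto cong: measurable_cong_sets)
next
  show "(\<lambda>a k. if k \<in> D then a k + s else a k) \<in> space (Pi\<^sub>M (goe_index N) (\<lambda>k. gauss_measure (goe_var v k))) \<rightarrow>
      (\<Pi>\<^sub>E k\<in>goe_index N. space (gauss_measure (goe_var v k)))"
    using assms by (auto simp: space_PiM PiE_def extensional_def)
qed

lemma nn_integral_goe_shift_one:
  assumes v: "0 < v" and k: "k \<in> goe_index N" and H: "H \<in> borel_measurable (goe_entries N v)"
  shows "(\<integral>\<^sup>+a. H (a(k := a k + s)) \<partial>goe_entries N v) =
    (\<integral>\<^sup>+a. H a * ennreal (exp (s * a k / goe_var v k - s\<^sup>2 / (2 * goe_var v k))) \<partial>goe_entries N v)"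
proof -
  let ?g = "\<lambda>k. gauss_measure (goe_var v k)" and ?J = "goe_index N - {k}"
  interpret G: prob_space "?g l" for l
    using v by (rule prob_space_gauss_goe_var)
  interpret product_sigma_finite ?g by unfold_locales
  have J: "insert k ?J = goe_index N" using k by auto
  have split: "(\<integral>\<^sup>+a. f a \<partial>goe_entries N v) = (\<integral>\<^sup>+y. (\<integral>\<^sup>+t. f (y(k := t)) \<partial>?g k) \<partial>Pi\<^sub>M ?J ?g)"
    if "f \<in> borel_measurable (goe_entries N v)" for f
    using product_nn_integral_insert[of ?J k f] that by (simp add: goe_entries_alt J insert_absorb[OF k])
  have upd: "(\<lambda>t. H (y(k := t))) \<in> borel_measurable borel" if "y \<in> space (Pi\<^sub>M ?J ?g)" for y
  proof -
    have "(\<lambda>t. y(k := t)) \<in> measurable (?g k) (goe_entries N v)"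
      unfolding goe_entries_alt by (rule measurable_fun_upd_const[OF that J])
    from measurable_compose[OF this H] show ?thesis by (simp cong: measurable_cong_sets)
  qed
  have kmeas: "(\<lambda>a. a k) \<in> borel_measurable (goe_entries N v)"
    using k by (rule goe_entries_component_measurable)
  have shift: "(\<lambda>a. a(k := a k + s)) \<in> measurable (goe_entries N v) (goe_entries N v)"
  proof -
    have "shift_on {k} s = (\<lambda>a. a(k := a k + s))" by (auto simp: shift_on_def fun_eq_iff)
    then show ?thesis using measurable_shift_on[of "{k}" N s v] k by simp
  qed
  have "(\<integral>\<^sup>+a. H (a(k := a k + s)) \<partial>goe_entries N v) = (\<integral>\<^sup>+y. (\<integral>\<^sup>+t. H (y(k := t + s)) \<partial>?g k) \<partial>Pi\<^sub>M ?J ?g)"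
    by (subst split[OF measurable_compose[OF shift H]]) simp
  also have "\<dots> = (\<integral>\<^sup>+y. (\<integral>\<^sup>+t. H (y(k := t)) * ennreal (exp (s * t / goe_var v k - s\<^sup>2 / (2 * goe_var v k))) \<partial>?g k) \<partial>Pi\<^sub>M ?J ?g)"
    by (intro nn_integral_cong nn_integral_gauss_shift goe_var_pos v upd)
  also have "\<dots> = (\<integral>\<^sup>+a. H a * ennreal (exp (s * a k / goe_var v k - s\<^sup>2 / (2 * goe_var v k))) \<partial>goe_entries N v)"
    by (subst split) (use H kmeas in auto)
  finally show ?thesis .
qed

text \<open>Shift one coordinate at a time; the density ratios multiply and their exponents
  add.\<close>

lemma nn_integral_goe_shift_on:
  assumes v: "0 < v" and D: "D \<subseteq> goe_index N" and F: "F \<in> borel_measurable (goe_entries N v)"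
  shows "(\<integral>\<^sup>+a. F (shift_on D s a) \<partial>goe_entries N v) =
    (\<integral>\<^sup>+a. F a * ennreal (exp (\<Sum>k\<in>D. s * a k / goe_var v k - s\<^sup>2 / (2 * goe_var v k))) \<partial>goe_entries N v)"
proof -
  have "finite D" using D finite_goe_index by (rule finite_subset)
  then show ?thesis using D F
  proof (induct D arbitrary: F rule: finite_induct)
    case (insert k D)
    let ?w = "\<lambda>a. exp (s * a k / goe_var v k - s\<^sup>2 / (2 * goe_var v k))"
    have k: "k \<in> goe_index N" and D: "D \<subseteq> goe_index N" using insert.prems by auto
    note F[measurable] = insert.prems(2)
    have [measurable]: "(\<lambda>a. a k) \<in> borel_measurable (goe_entries N v)"
      using k by (rule goe_entries_component_measurable)
    have "shift_on (insert k D) s a = shift_on D s (a(k := a k + s))" for a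
      using insert.hyps by (auto simp: shift_on_def fun_eq_iff)
    then have "(\<integral>\<^sup>+a. F (shift_on (insert k D) s a) \<partial>goe_entries N v) =
        (\<integral>\<^sup>+a. F (shift_on D s a) * ennreal (?w a) \<partial>goe_entries N v)"
      using nn_integral_goe_shift_one[OF v k measurable_compose[OF measurable_shift_on[OF D] F], of s s] by simp
    \<comment> \<open>As k is not in D, its weight may be evaluated after the shift, which lets the
      induction hypothesis take in the whole product.\<close>
    also have "\<dots> = (\<integral>\<^sup>+a. F (shift_on D s a) * ennreal (?w (shift_on D s a)) \<partial>goe_entries N v)"
      using insert.hyps by (simp add: shift_on_def)
    also have "\<dots> = (\<integral>\<^sup>+a. F a * ennreal (?w a) * ennreal (exp (\<Sum>k\<in>D. s * a k / goe_var v k - s\<^sup>2 / (2 * goe_var v k))) \<partial>goe_entries N v)"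
      by (rule insert.hyps(3)[OF D]) measurable
    also have "\<dots> = (\<integral>\<^sup>+a. F a * ennreal (exp (\<Sum>k\<in>insert k D. s * a k / goe_var v k - s\<^sup>2 / (2 * goe_var v k))) \<partial>goe_entries N v)"
      using insert.hyps by (simp add: exp_add ennreal_mult mult.assoc)
    finally show ?case .
  qed (simp add: shift_on_def)
qed

section \<open>The normalized trace and the traceless part\<close>

definition diag_mean :: "nat \<Rightarrow> (nat \<times> nat \<Rightarrow> real) \<Rightarrow> real" where
  "diag_mean N a = (\<Sum>i<N. a (i, i)) / real N"

abbreviation diag_shift :: "nat \<Rightarrow> real \<Rightarrow> (nat \<times> nat \<Rightarrow> real) \<Rightarrow> nat \<times> nat \<Rightarrow> real" where
  "diag_shift N \<equiv> shift_on ((\<lambda>i. (i, i)) ` {..<N})"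

lemma borel_measurable_diag_mean [measurable]: "diag_mean N \<in> borel_measurable (goe_entries N v)"
  unfolding diag_mean_def[abs_def]
  by (intro borel_measurable_divide borel_measurable_sum borel_measurable_const goe_entries_entry_measurable) auto

lemma diag_mean_shift: "0 < N \<Longrightarrow> diag_mean N (diag_shift N s a) = diag_mean N a + s"
  by (simp add: diag_mean_def shift_on_def image_iff sum.distrib field_simps)

lemma spec_diag_shift: "spec N (diag_shift N s a) = image_mset (\<lambda>x. x + s) (spec N a)"
proof -
  have "diag_shift N s a (i, j) = 1 * a (i, j) + (if i = j then s else 0)" if "i \<le> j" "j < N" for i j
    using that by (auto simp: shift_on_def)
  then show ?thesis
    using spec_affine[where c = 1 and a = a and a' = "diag_shift N s a" and s = s and N = N] by simp
qed

text \<open>The normalized trace of a Gaussian orthogonal matrix is a Gaussian of variance \<open>2 v / N\<close>,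
  independent of the traceless part. In place of this independence, the Cameron-Martin formula
  for the shifts \<open>A + s I\<close> is integrated over \<open>s\<close>.\<close>

lemma nn_integral_goe_trace_smoothing:
  assumes v: "0 < v" and N: "0 < N" and F[measurable]: "F \<in> borel_measurable (goe_entries N v)"
    and joint: "(\<lambda>(a, s). F (diag_shift N s a)) \<in> borel_measurable (goe_entries N v \<Otimes>\<^sub>M lborel)"
  shows "(\<integral>\<^sup>+a. F a \<partial>goe_entries N v) =
    (\<integral>\<^sup>+a. \<integral>\<^sup>+s. ennreal (normal_density 0 (sqrt (2 * v / N)) (diag_mean N a + s)) * F (diag_shift N s a) \<partial>lborel \<partial>goe_entries N v)"
proof -
  let ?P = "goe_entries N v" and ?n = "normal_density 0 (sqrt (2 * v / N))"
  interpret P: prob_space ?P using v by (rule prob_space_goe_entries)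
  interpret PL: pair_sigma_finite ?P lborel ..
  have D: "(\<lambda>i. (i, i)) ` {..<N} \<subseteq> goe_index N" by (auto simp: goe_index_def)
  \<comment> \<open>The Cameron-Martin weight of a diagonal shift only translates the Gaussian
    density of the normalized trace.\<close>
  have wt: "?n x * exp (s * (N * x) / (2 * v) - N * (s\<^sup>2 / (4 * v))) = ?n (x - s)" for x s :: real
  proof -
    have "- (x - 0)\<^sup>2 / (2 * (sqrt (2 * v / N))\<^sup>2) + (s * (N * x) / (2 * v) - N * (s\<^sup>2 / (4 * v))) =
        - (x - s - 0)\<^sup>2 / (2 * (sqrt (2 * v / N))\<^sup>2)"
      using v N by (simp add: field_simps power2_eq_square)
    then show ?thesis unfolding normal_density_def by (simp add: exp_add[symmetric] mult.assoc)
  qed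
  have ex: "(\<Sum>k\<in>(\<lambda>i. (i, i)) ` {..<N}. s * a k / goe_var v k - s\<^sup>2 / (2 * goe_var v k)) =
      s * (N * diag_mean N a) / (2 * v) - N * (s\<^sup>2 / (4 * v))" for s a
    using N by (subst sum.reindex) (auto simp: inj_on_def goe_var_def sum_subtractf diag_mean_def sum_divide_distrib[symmetric] sum_distrib_left[symmetric])
  have one: "(\<integral>\<^sup>+s. ennreal (?n (x - s)) \<partial>lborel) = 1" for x
  proof -
    have sd: "0 < sqrt (2 * v / N)" using v N by simp
    have "(\<integral>\<^sup>+s. ennreal (?n (x - s)) \<partial>lborel) = (\<integral>\<^sup>+s. ennreal (?n s) \<partial>lborel)"
      by (subst (2) nn_integral_real_affine[where c = "-1" and t = x]) auto
    also have "\<dots> = ennreal (\<integral>s. ?n s \<partial>lborel)"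
      using sd by (intro nn_integral_eq_integral) auto
    finally show ?thesis using sd by simp
  qed
  \<comment> \<open>For fixed s the change of variables frees F from s. What remains is a translated
    density, of total mass 1 in s.\<close>
  have inner: "(\<integral>\<^sup>+a. ennreal (?n (diag_mean N a + s)) * F (diag_shift N s a) \<partial>?P) =
     (\<integral>\<^sup>+a. F a * ennreal (?n (diag_mean N a - s)) \<partial>?P)" for s
  proof -
    have "(\<integral>\<^sup>+a. ennreal (?n (diag_mean N a + s)) * F (diag_shift N s a) \<partial>?P) =
      (\<integral>\<^sup>+a. (\<lambda>b. ennreal (?n (diag_mean N b)) * F b) (diag_shift N s a) \<partial>?P)"
      using N by (simp add: diag_mean_shift)
    also have "\<dots> = (\<integral>\<^sup>+a. ennreal (?n (diag_mean N a)) * F a * ennreal (exp (s * (N * diag_mean N a) / (2 * v) - N * (s\<^sup>2 / (4 * v)))) \<partial>?P)"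
      unfolding ex[symmetric] by (rule nn_integral_goe_shift_on[OF v D]) measurable
    also have "\<dots> = (\<integral>\<^sup>+a. F a * ennreal (?n (diag_mean N a - s)) \<partial>?P)"
      unfolding wt[symmetric] by (simp add: ennreal_mult mult_ac)
    finally show ?thesis .
  qed
  have "(\<integral>\<^sup>+a. \<integral>\<^sup>+s. ennreal (?n (diag_mean N a + s)) * F (diag_shift N s a) \<partial>lborel \<partial>?P) =
    (\<integral>\<^sup>+s. \<integral>\<^sup>+a. ennreal (?n (diag_mean N a + s)) * F (diag_shift N s a) \<partial>?P \<partial>lborel)"
    by (rule PL.Fubini'[symmetric]) (use joint in \<open>simp add: case_prod_beta'\<close>)
  also have "\<dots> = (\<integral>\<^sup>+s. \<integral>\<^sup>+a. F a * ennreal (?n (diag_mean N a - s)) \<partial>?P \<partial>lborel)"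
    by (simp add: inner)
  also have "\<dots> = (\<integral>\<^sup>+a. \<integral>\<^sup>+s. F a * ennreal (?n (diag_mean N a - s)) \<partial>lborel \<partial>?P)"
    by (rule PL.Fubini') measurable
  also have "\<dots> = (\<integral>\<^sup>+a. F a * (\<integral>\<^sup>+s. ennreal (?n (diag_mean N a - s)) \<partial>lborel) \<partial>?P)"
    by (intro nn_integral_cong nn_integral_cmult) measurable
  finally show ?thesis by (simp add: one)
qed

text \<open>The sum runs over the eigenvalues of the traceless part \<open>A - (tr A / N) I\<close>.\<close>

definition goe_mixture :: "nat \<Rightarrow> real \<Rightarrow> (real \<Rightarrow> real) \<Rightarrow> real \<Rightarrow> real \<Rightarrow> real \<Rightarrow> real" where
  "goe_mixture N v W \<alpha> c y =
     (\<integral>a. (\<Sum>x\<in>#spec N a. W (x - diag_mean N a) * normal_density (\<alpha> * (x - diag_mean N a)) (sqrt c) y) \<partial>goe_entries N v)"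

lemma sum_mset_nonneg_real:
  fixes f :: "'i \<Rightarrow> real"
  shows "(\<And>x. 0 \<le> f x) \<Longrightarrow> 0 \<le> (\<Sum>x\<in>#A. f x)"
  by (induct A) auto

lemma normal_density_le: "0 < s \<Longrightarrow> normal_density m s x \<le> 1 / sqrt (2 * pi * s\<^sup>2)"
  by (simp add: normal_density_def divide_right_mono)

text \<open>Fubini and the Fourier transform of each Gaussian. The point is the last formula: its
  expectation does not involve c, so lowering c divides out a Gaussian factor while the mixture
  stays nonnegative. This is the mechanism of the deconvolution.\<close>

lemma goe_mixture:
  fixes W :: "real \<Rightarrow> real"
  assumes v: "0 < v" and c: "0 < c" and W: "continuous_on UNIV W" "\<And>x. 0 \<le> W x" "\<And>x. W x \<le> K"
  shows goe_mixture_nonneg: "0 \<le> goe_mixture N v W \<alpha> c y"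
    and integrable_goe_mixture: "integrable lborel (goe_mixture N v W \<alpha> c)"
    and integrable_goe_mixture_kernel: "integrable (goe_entries N v \<Otimes>\<^sub>M lborel) (\<lambda>(a, y).
      \<Sum>x\<in>#spec N a. W (x - diag_mean N a) * normal_density (\<alpha> * (x - diag_mean N a)) (sqrt c) y)"
    and integral_goe_mixture_iexp: "(\<integral>y. goe_mixture N v W \<alpha> c y *\<^sub>R iexp (t * y) \<partial>lborel) =
      of_real (exp (- c * t\<^sup>2 / 2)) *
      (\<integral>a. (\<Sum>x\<in>#spec N a. W (x - diag_mean N a) *\<^sub>R iexp (t * (\<alpha> * (x - diag_mean N a)))) \<partial>goe_entries N v)"
proof -
  let ?P = "goe_entries N v"
  interpret P: prob_space ?P using v by (rule prob_space_goe_entries)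
  interpret PL: pair_sigma_finite ?P lborel ..
  have sc: "0 < sqrt c" using c by simp
  have [measurable]: "W \<in> borel_measurable borel" using W(1) by (rule borel_measurable_continuous_onI)
  let ?f = "\<lambda>a y x. W (x - diag_mean N a) * normal_density (\<alpha> * (x - diag_mean N a)) (sqrt c) y"
  define h where "h a y = (\<Sum>x\<in>#spec N a. ?f a y x)" for a y
  have f0: "0 \<le> ?f a y x" for a y x using W(2) by simp
  have K: "0 \<le> K" using W(2)[of 0] W(3)[of 0] by linarith
  have fB: "\<bar>?f a y x\<bar> \<le> K * (1 / sqrt (2 * pi * (sqrt c)\<^sup>2))" for a y x
    unfolding abs_of_nonneg[OF f0] using W K normal_density_le[OF sc] by (intro mult_mono) auto
  have cW: "continuous_on UNIV (\<lambda>x. W (x - m))" for m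
    using W(1) by (rule continuous_on_compose2) (auto intro!: continuous_intros)
  have fc: "continuous_on UNIV (?f a y)" for a y
    unfolding normal_density_def by (intro continuous_intros cW) (use c in auto)
  have hm[measurable]: "(\<lambda>(a, y). h a y) \<in> borel_measurable (?P \<Otimes>\<^sub>M lborel)"
    unfolding h_def case_prod_beta'
  proof (rule borel_measurable_sum_spec_real[where X = fst and M = "?P \<Otimes>\<^sub>M lborel" and f = "\<lambda>p. ?f (fst p) (snd p)", OF _ _ fc fB])
    show "(\<lambda>\<omega>. fst \<omega> (i, j)) \<in> borel_measurable (?P \<Otimes>\<^sub>M lborel)" if "i \<le> j" "j < N" for i j
      using that by (intro measurable_compose[OF measurable_fst] goe_entries_entry_measurable)
    show "(\<lambda>(\<omega>, x). ?f (fst \<omega>) (snd \<omega>) x) \<in> borel_measurable ((?P \<Otimes>\<^sub>M lborel) \<Otimes>\<^sub>M lborel)"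
      unfolding normal_density_def case_prod_beta' by measurable
  qed
  have h0: "0 \<le> h a y" for a y unfolding h_def using f0 by (rule sum_mset_nonneg_real)
  have f_y: "integrable lborel (\<lambda>y. ?f a y x)" "(\<integral>y. ?f a y x \<partial>lborel) = W (x - diag_mean N a)" for a x
    using sc by auto
  have h_y: "integrable lborel (h a)" "(\<integral>y. h a y \<partial>lborel) = (\<Sum>x\<in>#spec N a. W (x - diag_mean N a))" for a
    unfolding h_def using integrable_sum_mset[where f = "\<lambda>x y. ?f a y x", OF f_y(1)] by (simp_all only: f_y(2))
  have h_int: "integrable (?P \<Otimes>\<^sub>M lborel) (\<lambda>(a, y). h a y)"
  proof (rule PL.Fubini_integrable[OF hm])
    have "(\<lambda>a. \<integral>y. norm (h a y) \<partial>lborel) = (\<lambda>a. \<Sum>x\<in>#spec N a. W (x - diag_mean N a))"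
      using h0 h_y(2) by simp
    moreover have "integrable ?P (\<lambda>a. \<Sum>x\<in>#spec N a. W (x - diag_mean N a))"
    proof (rule P.integrable_const_bound[where B = "N * K"])
      show "(\<lambda>a. \<Sum>x\<in>#spec N a. W (x - diag_mean N a)) \<in> borel_measurable ?P"
        by (rule borel_measurable_sum_spec_real[where X = "\<lambda>a. a" and B = K])
          (use W in \<open>auto intro!: goe_entries_entry_measurable cW\<close>)
      show "AE a in ?P. norm (\<Sum>x\<in>#spec N a. W (x - diag_mean N a)) \<le> N * K"
        using W by (intro AE_I2 norm_sum_spec_le) auto
    qed
    ultimately show "integrable ?P (\<lambda>a. \<integral>y. norm (case (a, y) of (a, y) \<Rightarrow> h a y) \<partial>lborel)" by simp
  qed (use h_y in simp)
  show "integrable (?P \<Otimes>\<^sub>M lborel) (\<lambda>(a, y). \<Sum>x\<in>#spec N a. ?f a y x)"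
    using h_int unfolding h_def .
  have mix: "goe_mixture N v W \<alpha> c = (\<lambda>y. \<integral>a. h a y \<partial>?P)"
    unfolding goe_mixture_def h_def ..
  show "0 \<le> goe_mixture N v W \<alpha> c y" unfolding mix using h0 by (intro integral_nonneg_AE) auto
  show "integrable lborel (goe_mixture N v W \<alpha> c)"
    unfolding mix using PL.integrable_snd[OF h_int] by simp
  have g_int: "integrable (?P \<Otimes>\<^sub>M lborel) (\<lambda>(a, y). h a y *\<^sub>R iexp (t * y))"
    by (rule Bochner_Integration.integrable_bound[OF h_int]) (use hm in \<open>auto simp: case_prod_beta'\<close>)
  have "(\<integral>y. goe_mixture N v W \<alpha> c y *\<^sub>R iexp (t * y) \<partial>lborel) = (\<integral>y. (\<integral>a. h a y *\<^sub>R iexp (t * y) \<partial>?P) \<partial>lborel)"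
  proof -
    \<comment> \<open>The phase is moved under the expectation only at those y whose section is
      integrable, which is almost all of them.\<close>
    have "AE y in lborel. integrable ?P (\<lambda>a. h a y)"
      using PL.AE_integrable_snd[OF h_int] by simp
    then have "AE y in lborel. goe_mixture N v W \<alpha> c y *\<^sub>R iexp (t * y) = (\<integral>a. h a y *\<^sub>R iexp (t * y) \<partial>?P)"
      by eventually_elim (simp add: mix)
    then show ?thesis
      using PL.integrable_snd[OF h_int] PL.integrable_snd[OF g_int]
      by (intro integral_cong_AE) (auto simp: mix)
  qed
  also have "\<dots> = (\<integral>a. (\<integral>y. h a y *\<^sub>R iexp (t * y) \<partial>lborel) \<partial>?P)"
    using g_int by (rule PL.Fubini_integral)
  also have "(\<lambda>a. \<integral>y. h a y *\<^sub>R iexp (t * y) \<partial>lborel) = (\<lambda>a. of_real (exp (- c * t\<^sup>2 / 2)) *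
      (\<Sum>x\<in>#spec N a. W (x - diag_mean N a) *\<^sub>R iexp (t * (\<alpha> * (x - diag_mean N a)))))"
  proof (rule ext)
    fix a
    let ?m = "\<lambda>x. \<alpha> * (x - diag_mean N a)"
    have i: "integrable lborel (\<lambda>y. W (x - diag_mean N a) *\<^sub>R (normal_density (?m x) (sqrt c) y *\<^sub>R iexp (t * y)))" for x
      by (intro integrable_scaleR_right iexp_normal_density(1) sc)
    have "(\<integral>y. h a y *\<^sub>R iexp (t * y) \<partial>lborel) =
      (\<integral>y. (\<Sum>x\<in>#spec N a. W (x - diag_mean N a) *\<^sub>R (normal_density (?m x) (sqrt c) y *\<^sub>R iexp (t * y))) \<partial>lborel)"
    proof (intro Bochner_Integration.integral_cong refl)
      fix y
      have "(\<Sum>x\<in>#A. g x) *\<^sub>R z = (\<Sum>x\<in>#A. g x *\<^sub>R z)" for A and g :: "real \<Rightarrow> real" and z :: complex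
        by (induct A) (auto simp: scaleR_left.add)
      then show "h a y *\<^sub>R iexp (t * y) = (\<Sum>x\<in>#spec N a. W (x - diag_mean N a) *\<^sub>R (normal_density (?m x) (sqrt c) y *\<^sub>R iexp (t * y)))"
        by (simp add: h_def)
    qed
    also have "\<dots> = (\<Sum>x\<in>#spec N a. \<integral>y. W (x - diag_mean N a) *\<^sub>R (normal_density (?m x) (sqrt c) y *\<^sub>R iexp (t * y)) \<partial>lborel)"
      by (rule integrable_sum_mset(2)[OF i])
    also have "\<dots> = (\<Sum>x\<in>#spec N a. of_real (exp (- c * t\<^sup>2 / 2)) * (W (x - diag_mean N a) *\<^sub>R iexp (t * ?m x)))"
      using c sc by (simp only: integral_scaleR_right iexp_normal_density(2)) (simp add: mult_ac)
    finally show "(\<integral>y. h a y *\<^sub>R iexp (t * y) \<partial>lborel) = of_real (exp (- c * t\<^sup>2 / 2)) *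
      (\<Sum>x\<in>#spec N a. W (x - diag_mean N a) *\<^sub>R iexp (t * ?m x))"
      by (simp add: sum_mset_distrib_left image_mset.compositionality comp_def)
  qed
  finally show "(\<integral>y. goe_mixture N v W \<alpha> c y *\<^sub>R iexp (t * y) \<partial>lborel) =
      of_real (exp (- c * t\<^sup>2 / 2)) *
      (\<integral>a. (\<Sum>x\<in>#spec N a. W (x - diag_mean N a) *\<^sub>R iexp (t * (\<alpha> * (x - diag_mean N a)))) \<partial>goe_entries N v)"
    by (simp only: integral_mult_right_zero)
qed

lemma integrable_mult_normal_density:
  fixes f :: "real \<Rightarrow> real"
  assumes "0 < s" and [measurable]: "f \<in> borel_measurable borel" and b: "\<And>x. \<bar>f x\<bar> \<le> B"
  shows "integrable lborel (\<lambda>x. f x * normal_density m s x)"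
proof (rule Bochner_Integration.integrable_bound)
  show "integrable lborel (\<lambda>x. B * normal_density m s x)"
    using assms(1) by (intro integrable_mult_right) auto
  show "AE x in lborel. norm (f x * normal_density m s x) \<le> norm (B * normal_density m s x)"
    unfolding real_norm_def abs_mult
    by (intro AE_I2 mult_right_mono order.trans[OF b abs_ge_self] abs_ge_zero)
qed simp

text \<open>Apply the trace smoothing to the linear statistic of f. A diagonal shift translates the
  spectrum, so integrating over s averages f against Gaussians centred at the traceless eigenvalues.
  Nonnegative f allows working with nonnegative integrals.\<close>

lemma integral_sum_spec_goe_mixture:
  fixes f :: "real \<Rightarrow> real"
  assumes v: "0 < v" and N: "0 < N"
    and f: "continuous_on UNIV f" "\<And>x. 0 \<le> f x" "\<And>x. f x \<le> B"
  shows "(\<integral>a. (\<Sum>x\<in>#spec N a. f x) \<partial>goe_entries N v) =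
    (\<integral>y. f y * goe_mixture N v (\<lambda>_. 1) 1 (2 * v / N) y \<partial>lborel)"
proof -
  let ?P = "goe_entries N v" and ?s = "sqrt (2 * v / N)"
  interpret P: prob_space ?P using v by (rule prob_space_goe_entries)
  interpret PL: pair_sigma_finite ?P lborel ..
  have c: "0 < 2 * v / N" and s: "0 < ?s" using v N by auto
  have [measurable]: "f \<in> borel_measurable borel" using f(1) by (rule borel_measurable_continuous_onI)
  have fb: "\<bar>f x\<bar> \<le> B" for x using f by auto
  have B0: "0 \<le> B" using f(2,3)[of 0] by linarith
  define h where "h a y = (\<Sum>x\<in>#spec N a. normal_density (x - diag_mean N a) ?s y)" for a y
  have h_int: "integrable (?P \<Otimes>\<^sub>M lborel) (\<lambda>(a, y). h a y)"
    using integrable_goe_mixture_kernel[OF v c, of "\<lambda>_. 1" 1 N 1] by (simp add: h_def)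
  have mix: "goe_mixture N v (\<lambda>_. 1) 1 (2 * v / N) y = (\<integral>a. h a y \<partial>?P)" for y
    by (simp add: goe_mixture_def h_def)
  have h0: "0 \<le> h a y" for a y unfolding h_def by (intro sum_mset_nonneg_real) simp
  have g_int: "integrable (?P \<Otimes>\<^sub>M lborel) (\<lambda>(a, y). f y * h a y)"
  proof (rule Bochner_Integration.integrable_bound)
    show "integrable (?P \<Otimes>\<^sub>M lborel) (\<lambda>p. B * (case p of (a, y) \<Rightarrow> h a y))"
      using h_int by (rule integrable_mult_right)
    show "AE p in ?P \<Otimes>\<^sub>M lborel. norm (case p of (a, y) \<Rightarrow> f y * h a y) \<le> norm (B * (case p of (a, y) \<Rightarrow> h a y))"
      using f h0 B0 by (intro AE_I2) (auto simp: abs_mult intro!: mult_right_mono)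
  qed (use borel_measurable_integrable[OF h_int] in \<open>simp add: case_prod_beta'\<close>)
  have Fm: "(\<lambda>a. \<Sum>x\<in>#spec N a. f x) \<in> borel_measurable ?P"
    by (rule borel_measurable_sum_spec_real[where X = "\<lambda>a. a" and f = "\<lambda>_. f" and B = B])
      (auto intro: goe_entries_entry_measurable f(1) fb)
  have F0: "0 \<le> (\<Sum>x\<in>#spec N a. f x)" for a using f(2) by (rule sum_mset_nonneg_real)
  have Fi: "integrable ?P (\<lambda>a. \<Sum>x\<in>#spec N a. f x)"
    by (rule P.integrable_const_bound[where B = "N * B"]) (use norm_sum_spec_le[of f B] fb Fm in auto)
  have inner: "(\<integral>\<^sup>+s. ennreal (normal_density 0 ?s (diag_mean N a + s)) * ennreal (\<Sum>x\<in>#spec N (diag_shift N s a). f x) \<partial>lborel) =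
      ennreal (\<integral>y. f y * h a y \<partial>lborel)" for a
  proof -
    let ?m = "diag_mean N a"
    have ng: "normal_density 0 ?s (?m + s) = normal_density (- ?m) ?s s" for s
      by (simp add: normal_density_def add.commute)
    have shift: "normal_density (- ?m) ?s (y - x) = normal_density (x - ?m) ?s y" for x y
      by (simp add: normal_density_def algebra_simps)
    have i1: "integrable lborel (\<lambda>s. f (x + s) * normal_density (- ?m) ?s s)" for x
      by (rule integrable_mult_normal_density[OF s _ fb]) simp
    have i2: "integrable lborel (\<lambda>y. f y * normal_density (x - ?m) ?s y)" for x
      by (rule integrable_mult_normal_density[OF s _ fb]) simp
    have "(\<integral>s. f (x + s) * normal_density (- ?m) ?s s \<partial>lborel) = (\<integral>y. f y * normal_density (x - ?m) ?s y \<partial>lborel)" for x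
      using lborel_integral_real_affine[where c = 1 and t = "- x" and f = "\<lambda>s. f (x + s) * normal_density (- ?m) ?s s"]
      by (simp add: shift)
    then have "(\<Sum>x\<in>#spec N a. \<integral>s. f (x + s) * normal_density (- ?m) ?s s \<partial>lborel) =
        (\<Sum>x\<in>#spec N a. \<integral>y. f y * normal_density (x - ?m) ?s y \<partial>lborel)" by simp
    then have "(\<integral>s. (\<Sum>x\<in>#spec N a. f (x + s) * normal_density (- ?m) ?s s) \<partial>lborel) =
        (\<integral>y. (\<Sum>x\<in>#spec N a. f y * normal_density (x - ?m) ?s y) \<partial>lborel)"
      by (simp only: integrable_sum_mset(2)[OF i1] integrable_sum_mset(2)[OF i2])
    moreover have "(\<Sum>x\<in>#spec N a. f y * normal_density (x - ?m) ?s y) = f y * h a y" for y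
      by (simp add: h_def sum_mset_distrib_left image_mset.compositionality comp_def)
    moreover have "(\<integral>\<^sup>+s. ennreal (normal_density 0 ?s (?m + s)) * ennreal (\<Sum>x\<in>#spec N (diag_shift N s a). f x) \<partial>lborel) =
      (\<integral>\<^sup>+s. ennreal (\<Sum>x\<in>#spec N a. f (x + s) * normal_density (- ?m) ?s s) \<partial>lborel)"
    proof (intro nn_integral_cong)
      fix s
      have "(\<Sum>x\<in>#spec N a. f (x + s) * normal_density (- ?m) ?s s) = (\<Sum>x\<in>#spec N a. f (x + s)) * normal_density (- ?m) ?s s"
        by (rule sum_mset_distrib_right[symmetric, unfolded image_mset.compositionality comp_def])
      then show "ennreal (normal_density 0 ?s (?m + s)) * ennreal (\<Sum>x\<in>#spec N (diag_shift N s a). f x) =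
          ennreal (\<Sum>x\<in>#spec N a. f (x + s) * normal_density (- ?m) ?s s)"
        unfolding ng by (simp add: ennreal_mult'' mult.commute spec_diag_shift image_mset.compositionality comp_def)
    qed
    moreover have "\<dots> = ennreal (\<integral>s. (\<Sum>x\<in>#spec N a. f (x + s) * normal_density (- ?m) ?s s) \<partial>lborel)"
      by (intro nn_integral_eq_integral integrable_sum_mset(1) i1 AE_I2 sum_mset_nonneg_real) (use f(2) in simp)
    ultimately show ?thesis by simp
  qed
  have joint: "(\<lambda>(a, s). ennreal (\<Sum>x\<in>#spec N (diag_shift N s a). f x)) \<in> borel_measurable (?P \<Otimes>\<^sub>M lborel)"
  proof -
    have "(\<lambda>p. \<Sum>x\<in>#spec N (fst p). f (x + snd p)) \<in> borel_measurable (?P \<Otimes>\<^sub>M lborel)"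
    proof (rule borel_measurable_sum_spec_real[where B = B])
      show "(\<lambda>p. fst p (i, j)) \<in> borel_measurable (?P \<Otimes>\<^sub>M lborel)" if "i \<le> j" "j < N" for i j
        using that by (intro measurable_compose[OF measurable_fst] goe_entries_entry_measurable)
      show "continuous_on UNIV (\<lambda>x. f (x + snd p))" for p :: "(nat \<times> nat \<Rightarrow> real) \<times> real"
        using f(1) by (rule continuous_on_compose2) (auto intro!: continuous_intros)
    qed (use fb in auto)
    then show ?thesis
      by (simp add: spec_diag_shift image_mset.compositionality comp_def case_prod_beta')
  qed
  have "ennreal (\<integral>a. (\<Sum>x\<in>#spec N a. f x) \<partial>?P) = (\<integral>\<^sup>+a. ennreal (\<Sum>x\<in>#spec N a. f x) \<partial>?P)"
    using Fi F0 by (intro nn_integral_eq_integral[symmetric]) auto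
  also have "\<dots> = (\<integral>\<^sup>+a. ennreal (\<integral>y. f y * h a y \<partial>lborel) \<partial>?P)"
    using nn_integral_goe_trace_smoothing[OF v N _ joint] Fm by (simp add: inner)
  also have "\<dots> = ennreal (\<integral>a. (\<integral>y. f y * h a y \<partial>lborel) \<partial>?P)"
    using PL.integrable_fst[OF g_int] f(2) h0 by (intro nn_integral_eq_integral AE_I2 integral_nonneg_AE) auto
  finally have "(\<integral>a. (\<Sum>x\<in>#spec N a. f x) \<partial>?P) = (\<integral>a. (\<integral>y. f y * h a y \<partial>lborel) \<partial>?P)"
    using F0 f(2) h0 by (subst (asm) ennreal_inj) (auto intro!: integral_nonneg_AE)
  also have "\<dots> = (\<integral>y. (\<integral>a. f y * h a y \<partial>?P) \<partial>lborel)"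
    using g_int by (rule PL.Fubini_integral[symmetric])
  finally show ?thesis by (simp add: mix)
qed

text \<open>The explicit mixture shows that a density exists, so that the chosen
  \<open>goe_density\<close> is a genuine one. A bounded test function is made nonnegative by adding
  its bound B, and the constant B is then subtracted.\<close>

lemma is_goe_density_mixture:
  assumes v: "0 < v" and N: "0 < N"
  shows "is_goe_density N v (\<lambda>y. goe_mixture N v (\<lambda>_. 1) 1 (2 * v / N) y / N)"
proof -
  let ?\<rho> = "goe_mixture N v (\<lambda>_. 1) 1 (2 * v / N)"
  interpret P: prob_space "goe_entries N v" using v by (rule prob_space_goe_entries)
  have c: "0 < 2 * v / N" using v N by auto
  have r: "integrable lborel ?\<rho>" "0 \<le> ?\<rho> y" for y
    by (rule integrable_goe_mixture[OF v c, where W = "\<lambda>_. 1" and K = 1]; simp)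
      (rule goe_mixture_nonneg[OF v c, where W = "\<lambda>_. 1" and K = 1]; simp)
  have "(\<integral>y. f y * (?\<rho> y / N) \<partial>lborel) = 1 / real N * (\<integral>a. trace_fun f (sym_mat N a) \<partial>goe_entries N v)"
    if f: "continuous_on UNIV f" "bounded (range f)" for f :: "real \<Rightarrow> real"
  proof -
    obtain B where B: "\<And>x. \<bar>f x\<bar> \<le> B" using f(2) by (auto simp: bounded_iff)
    have [measurable]: "f \<in> borel_measurable borel" using f(1) by (rule borel_measurable_continuous_onI)
    have B0: "0 \<le> B" using B[of 0] by linarith
    have fi: "integrable lborel (\<lambda>y. f y * ?\<rho> y)"
    proof (rule Bochner_Integration.integrable_bound)
      show "integrable lborel (\<lambda>y. B * ?\<rho> y)" using r(1) by (rule integrable_mult_right)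
      show "AE y in lborel. norm (f y * ?\<rho> y) \<le> norm (B * ?\<rho> y)"
        unfolding real_norm_def abs_mult
        by (intro AE_I2 mult_right_mono order.trans[OF B abs_ge_self] abs_ge_zero)
    qed (use r(1) in simp)
    have Fi: "integrable (goe_entries N v) (\<lambda>a. \<Sum>x\<in>#spec N a. f x)"
    proof (rule P.integrable_const_bound[where B = "N * B"])
      show "(\<lambda>a. \<Sum>x\<in>#spec N a. f x) \<in> borel_measurable (goe_entries N v)"
        by (rule borel_measurable_sum_spec_real[where X = "\<lambda>a. a" and f = "\<lambda>_. f" and B = B])
          (auto intro: goe_entries_entry_measurable f(1) B)
    qed (use norm_sum_spec_le[of f B] B in auto)
    have "(\<integral>a. (\<Sum>x\<in>#spec N a. f x + B) \<partial>goe_entries N v) = (\<integral>y. (f y + B) * ?\<rho> y \<partial>lborel)"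
      by (rule integral_sum_spec_goe_mixture[OF v N, where B = "2 * B"])
        (use B abs_le_iff in \<open>auto intro!: continuous_intros f(1) simp: abs_le_iff add.commute[of _ B]\<close>, (smt (verit) B)+)
    moreover have "(\<integral>a. (\<Sum>x\<in>#spec N a. B) \<partial>goe_entries N v) = (\<integral>y. B * ?\<rho> y \<partial>lborel)"
      by (rule integral_sum_spec_goe_mixture[OF v N, where B = B]) (use B0 in auto)
    moreover have "(\<integral>y. (f y + B) * ?\<rho> y \<partial>lborel) = (\<integral>y. f y * ?\<rho> y \<partial>lborel) + (\<integral>y. B * ?\<rho> y \<partial>lborel)"
      using fi r(1) by (simp add: distrib_right)
    moreover have "(\<integral>a. (\<Sum>x\<in>#spec N a. f x + B) \<partial>goe_entries N v) =
      (\<integral>a. (\<Sum>x\<in>#spec N a. f x) \<partial>goe_entries N v) + (\<integral>a. (\<Sum>x\<in>#spec N a. B) \<partial>goe_entries N v)"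
      using Fi by (simp add: sum_mset.distrib)
    ultimately have "(\<integral>y. f y * ?\<rho> y \<partial>lborel) = (\<integral>a. (\<Sum>x\<in>#spec N a. f x) \<partial>goe_entries N v)" by linarith
    then show ?thesis by (simp add: trace_fun_def)
  qed
  then show ?thesis
    unfolding is_goe_density_def using r by auto
qed

lemma is_goe_density_goe_density: "0 < v \<Longrightarrow> 0 < N \<Longrightarrow> is_goe_density N v (goe_density N v)"
  unfolding goe_density_def by (rule someI[where P = "is_goe_density N v"]) (rule is_goe_density_mixture)

lemma is_goe_density_complex:
  fixes f :: "real \<Rightarrow> complex"
  assumes v: "0 < v" and d: "is_goe_density N v \<rho>"
    and f: "continuous_on UNIV f" "\<And>x. cmod (f x) \<le> B"
  shows "integrable lborel (\<lambda>x. \<rho> x *\<^sub>R f x)"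
    and "(\<integral>x. \<rho> x *\<^sub>R f x \<partial>lborel) = (\<integral>a. (\<Sum>x\<in>#spec N a. f x) \<partial>goe_entries N v) / N"
proof -
  have \<rho>: "integrable lborel \<rho>" "\<And>x. 0 \<le> \<rho> x"
    and eq: "\<And>f. continuous_on UNIV f \<Longrightarrow> bounded (range f) \<Longrightarrow>
      (\<integral>x. f x * \<rho> x \<partial>lborel) = 1 / real N * (\<integral>a. trace_fun f (sym_mat N a) \<partial>goe_entries N v)"
    using d by (auto simp: is_goe_density_def)
  have [measurable]: "f \<in> borel_measurable borel" using f(1) by (rule borel_measurable_continuous_onI)
  show i: "integrable lborel (\<lambda>x. \<rho> x *\<^sub>R f x)"
  proof (rule Bochner_Integration.integrable_bound)
    show "integrable lborel (\<lambda>x. B * \<rho> x)" using \<rho>(1) by (rule integrable_mult_right)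
    show "AE x in lborel. norm (\<rho> x *\<^sub>R f x) \<le> norm (B * \<rho> x)"
      unfolding norm_scaleR real_norm_def abs_mult mult.commute[of "\<bar>B\<bar>"]
      by (intro AE_I2 mult_left_mono order.trans[OF f(2) abs_ge_self] abs_ge_zero)
  qed (use \<rho>(1) in simp)
  have Fi: "integrable (goe_entries N v) (\<lambda>a. \<Sum>x\<in>#spec N a. f x)"
    by (rule integrable_sum_spec_goe[OF v f])
  have bd: "bounded (range (\<lambda>x. Re (f x)))" "bounded (range (\<lambda>x. Im (f x)))"
    using order.trans[OF abs_Re_le_cmod f(2)] order.trans[OF abs_Im_le_cmod f(2)] by (auto simp: bounded_iff)
  show "(\<integral>x. \<rho> x *\<^sub>R f x \<partial>lborel) = (\<integral>a. (\<Sum>x\<in>#spec N a. f x) \<partial>goe_entries N v) / N"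
  proof (rule complex_eqI)
    have "Re (\<integral>x. \<rho> x *\<^sub>R f x \<partial>lborel) = (\<integral>x. Re (f x) * \<rho> x \<partial>lborel)"
      using integral_Re[OF i] by (simp add: mult.commute)
    also have "\<dots> = (\<integral>a. Re (\<Sum>x\<in>#spec N a. f x) \<partial>goe_entries N v) / N"
      using eq[OF _ bd(1)] f(1) by (simp add: trace_fun_def Re_sum_mset continuous_on_Re)
    finally show "Re (\<integral>x. \<rho> x *\<^sub>R f x \<partial>lborel) = Re ((\<integral>a. (\<Sum>x\<in>#spec N a. f x) \<partial>goe_entries N v) / N)"
      using integral_Re[OF Fi] by (simp add: Re_divide_of_nat)
    have "Im (\<integral>x. \<rho> x *\<^sub>R f x \<partial>lborel) = (\<integral>x. Im (f x) * \<rho> x \<partial>lborel)"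
      using integral_Im[OF i] by (simp add: mult.commute)
    also have "\<dots> = (\<integral>a. Im (\<Sum>x\<in>#spec N a. f x) \<partial>goe_entries N v) / N"
      using eq[OF _ bd(2)] f(1) by (simp add: trace_fun_def Im_sum_mset continuous_on_Im)
    finally show "Im (\<integral>x. \<rho> x *\<^sub>R f x \<partial>lborel) = Im ((\<integral>a. (\<Sum>x\<in>#spec N a. f x) \<partial>goe_entries N v) / N)"
      using integral_Im[OF Fi] by (simp add: Im_divide_of_nat)
  qed
qed

lemma gauss_measure_scale:
  assumes "0 < v" "0 < c"
  shows "distr (gauss_measure v) (gauss_measure (c\<^sup>2 * v)) (\<lambda>x. c * x) = gauss_measure (c\<^sup>2 * v)"
proof (rule Levy_uniqueness)
  interpret prob_space "gauss_measure v" using assms by (intro prob_space_gauss_measure) simp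
  show "real_distribution (distr (gauss_measure v) (gauss_measure (c\<^sup>2 * v)) (\<lambda>x. c * x))"
    by (auto simp: real_distribution_def real_distribution_axioms_def intro!: prob_space_distr)
  show "real_distribution (gauss_measure (c\<^sup>2 * v))"
    using assms by (intro real_distribution_gauss_measure) simp
  show "char (distr (gauss_measure v) (gauss_measure (c\<^sup>2 * v)) (\<lambda>x. c * x)) = char (gauss_measure (c\<^sup>2 * v))"
  proof
    fix t
    have "char (distr (gauss_measure v) (gauss_measure (c\<^sup>2 * v)) (\<lambda>x. c * x)) t = char (gauss_measure v) (t * c)"
      unfolding char_def by (subst integral_distr) (auto simp: mult_ac)
    also have "\<dots> = char (gauss_measure (c\<^sup>2 * v)) t"
      using assms by (simp add: char_gauss_measure power_mult_distrib mult_ac)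
    finally show "char (distr (gauss_measure v) (gauss_measure (c\<^sup>2 * v)) (\<lambda>x. c * x)) t = char (gauss_measure (c\<^sup>2 * v)) t" .
  qed
qed

text \<open>The ensemble of variance v is the image of the unit one under multiplication by
  \<open>sqrt v\<close>. Using \<open>compose\<close> on the index set keeps the image in the
  product space.\<close>

lemma integral_sum_spec_goe_scale:
  fixes f :: "real \<Rightarrow> complex"
  assumes v: "0 < v" and f: "continuous_on UNIV f" "\<And>x. cmod (f x) \<le> B"
  shows "(\<integral>a. (\<Sum>x\<in>#spec N a. f x) \<partial>goe_entries N v) = (\<integral>a. (\<Sum>x\<in>#spec N a. f (sqrt v * x)) \<partial>goe_entries N 1)"
proof -
  let ?I = "goe_index N" and ?g = "\<lambda>v k. gauss_measure (goe_var v k)"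
  have gv: "goe_var v k = (sqrt v)\<^sup>2 * goe_var 1 k" for k using v by (simp add: goe_var_def)
  have "distr (Pi\<^sub>M ?I (?g 1)) (Pi\<^sub>M ?I (?g v)) (compose ?I (\<lambda>x. sqrt v * x)) =
      Pi\<^sub>M ?I (\<lambda>k. distr (?g 1 k) (?g v k) (\<lambda>x. sqrt v * x))"
    by (rule distr_PiM_finite_prob_space') (use v in \<open>auto intro: prob_space_gauss_goe_var\<close>)
  also have "(\<lambda>k. distr (?g 1 k) (?g v k) (\<lambda>x. sqrt v * x)) = ?g v"
    unfolding gv using v by (intro ext gauss_measure_scale goe_var_pos) auto
  finally have D: "goe_entries N v = distr (goe_entries N 1) (goe_entries N v) (compose ?I (\<lambda>x. sqrt v * x))"
    by (simp add: goe_entries_alt)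
  have m: "compose ?I (\<lambda>x. sqrt v * x) \<in> measurable (goe_entries N 1) (goe_entries N v)"
    unfolding goe_entries_alt compose_def
  proof (rule measurable_restrict)
    fix k assume k: "k \<in> ?I"
    show "(\<lambda>a. sqrt v * a k) \<in> measurable (Pi\<^sub>M ?I (?g 1)) (?g v k)"
      using goe_entries_component_measurable[OF k, of 1] by (simp add: goe_entries_alt cong: measurable_cong_sets)
  qed
  have "(\<integral>a. (\<Sum>x\<in>#spec N a. f x) \<partial>goe_entries N v) =
      (\<integral>a. (\<Sum>x\<in>#spec N (compose ?I (\<lambda>x. sqrt v * x) a). f x) \<partial>goe_entries N 1)"
    by (subst D, subst integral_distr[OF m borel_measurable_sum_spec_goe[OF f]]) simp
  also have "\<dots> = (\<integral>a. (\<Sum>x\<in>#spec N a. f (sqrt v * x)) \<partial>goe_entries N 1)"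
  proof (intro Bochner_Integration.integral_cong refl)
    fix a
    have "compose ?I (\<lambda>x. sqrt v * x) a (i, j) = sqrt v * a (i, j) + (if i = j then 0 else 0)" if "i \<le> j" "j < N" for i j
      using that by (simp add: compose_def goe_index_def)
    then have "spec N (compose ?I (\<lambda>x. sqrt v * x) a) = image_mset (\<lambda>x. sqrt v * x + 0) (spec N a)"
      using v by (intro spec_affine) auto
    then show "(\<Sum>x\<in>#spec N (compose ?I (\<lambda>x. sqrt v * x) a). f x) = (\<Sum>x\<in>#spec N a. f (sqrt v * x))"
      by (simp add: image_mset.compositionality comp_def)
  qed
  finally show ?thesis .
qed

section \<open>Moments of radial weights\<close>

interpretation lborel_product: product_sigma_finite "\<lambda>_::nat. lborel :: real measure"
  by unfold_locales

lemma measurable_lebesgue_pow_component: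
  "i \<in> {1..m} \<Longrightarrow> (\<lambda>x. x i) \<in> borel_measurable (lebesgue_pow m)"
  unfolding lebesgue_pow_def by measurable

lemma borel_measurable_eucl_norm [measurable]: "eucl_norm m \<in> borel_measurable (lebesgue_pow m)"
  unfolding eucl_norm_def[abs_def]
  by (intro borel_measurable_sqrt[THEN measurable_compose[rotated]] borel_measurable_sum borel_measurable_power measurable_lebesgue_pow_component)

lemma nn_integral_lebesgue_pow_split:
  assumes i: "i \<in> {1..m}" and j: "j \<in> {1..m}" and ij: "i \<noteq> j"
    and F: "F \<in> borel_measurable (lebesgue_pow m)"
  shows "(\<integral>\<^sup>+x. F x \<partial>lebesgue_pow m) =
    (\<integral>\<^sup>+y. (\<integral>\<^sup>+s. \<integral>\<^sup>+t. F (y(i := s, j := t)) \<partial>lborel \<partial>lborel) \<partial>Pi\<^sub>M ({1..m} - {i, j}) (\<lambda>_. lborel))"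
proof -
  let ?J = "{1..m} - {i, j}" and ?L = "\<lambda>_::nat. lborel :: real measure"
  have J: "insert i ?J = {1..m} - {j}" "insert j ({1..m} - {j}) = {1..m}" using i j ij by auto
  note F' = F[unfolded lebesgue_pow_def]
  have G: "(\<lambda>x. \<integral>\<^sup>+t. F (x(j := t)) \<partial>lborel) \<in> borel_measurable (Pi\<^sub>M ({1..m} - {j}) ?L)"
  proof (rule lborel.borel_measurable_nn_integral)
    have "(\<lambda>p. (fst p)(j := snd p)) \<in> measurable (Pi\<^sub>M ({1..m} - {j}) ?L \<Otimes>\<^sub>M lborel) (Pi\<^sub>M {1..m} ?L)"
      by (rule measurable_fun_upd[where J = "{1..m} - {j}"]) (use J in auto)
    from measurable_compose[OF this F']
    show "(\<lambda>(x, t). F (x(j := t))) \<in> borel_measurable (Pi\<^sub>M ({1..m} - {j}) ?L \<Otimes>\<^sub>M lborel)"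
      unfolding case_prod_beta' .
  qed
  have "(\<integral>\<^sup>+x. F x \<partial>Pi\<^sub>M (insert j ({1..m} - {j})) ?L) = (\<integral>\<^sup>+x. \<integral>\<^sup>+t. F (x(j := t)) \<partial>lborel \<partial>Pi\<^sub>M ({1..m} - {j}) ?L)"
    by (rule lborel_product.product_nn_integral_insert) (simp, simp, simp only: J F')
  also have "\<dots> = (\<integral>\<^sup>+x. \<integral>\<^sup>+t. F (x(j := t)) \<partial>lborel \<partial>Pi\<^sub>M (insert i ?J) ?L)"
    by (simp only: J)
  also have "\<dots> = (\<integral>\<^sup>+y. (\<integral>\<^sup>+s. \<integral>\<^sup>+t. F (y(i := s, j := t)) \<partial>lborel \<partial>lborel) \<partial>Pi\<^sub>M ?J ?L)"
    by (rule lborel_product.product_nn_integral_insert) (simp, simp add: ij, simp only: J G)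
  finally show ?thesis by (simp only: J lebesgue_pow_def)
qed

text \<open>Fubini singles out two coordinates, and the invariance of the planar integral is the
  hypothesis \<open>inv\<close>. It is supplied for the exchange of the coordinates and for the
  orthogonal map below.\<close>

lemma nn_integral_lebesgue_pow_transform:
  fixes T1 T2 :: "real \<Rightarrow> real \<Rightarrow> real"
  assumes i: "i \<in> {1..m}" and j: "j \<in> {1..m}" and ij: "i \<noteq> j"
    and F: "F \<in> borel_measurable (lebesgue_pow m)"
    and T: "(\<lambda>p. T1 (fst p) (snd p)) \<in> borel_measurable (borel \<Otimes>\<^sub>M borel)" "(\<lambda>p. T2 (fst p) (snd p)) \<in> borel_measurable (borel \<Otimes>\<^sub>M borel)"
    and inv: "\<And>G. (\<lambda>p. G (fst p) (snd p)) \<in> borel_measurable (lborel \<Otimes>\<^sub>M lborel) \<Longrightarrow>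
      (\<integral>\<^sup>+s. \<integral>\<^sup>+t. G s t \<partial>lborel \<partial>lborel) = (\<integral>\<^sup>+s. \<integral>\<^sup>+t. G (T1 s t) (T2 s t) \<partial>lborel \<partial>lborel)"
  shows "(\<integral>\<^sup>+x. F x \<partial>lebesgue_pow m) = (\<integral>\<^sup>+x. F (x(i := T1 (x i) (x j), j := T2 (x i) (x j))) \<partial>lebesgue_pow m)"
proof -
  let ?J = "{1..m} - {i, j}" and ?L = "\<lambda>_::nat. lborel :: real measure"
  have J: "insert i ?J = {1..m} - {j}" "insert j ({1..m} - {j}) = {1..m}" using i j ij by auto
  have comp: "(\<lambda>x. (x i, x j)) \<in> measurable (lebesgue_pow m) (borel \<Otimes>\<^sub>M borel)"
    using measurable_lebesgue_pow_component[OF i] measurable_lebesgue_pow_component[OF j] by (rule measurable_Pair)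
  have FT: "(\<lambda>x. F (x(i := T1 (x i) (x j), j := T2 (x i) (x j)))) \<in> borel_measurable (lebesgue_pow m)"
  proof -
    have "(\<lambda>x. x(i := T1 (x i) (x j))) \<in> measurable (lebesgue_pow m) (Pi\<^sub>M {1..m} ?L)"
      using measurable_compose[OF comp T(1)] i
      by (intro measurable_fun_upd[where J = "{1..m}"]) (auto simp: lebesgue_pow_def)
    from measurable_fun_upd[OF _ this, of "{1..m}" j "\<lambda>x. T2 (x i) (x j)"]
    have "(\<lambda>x. x(i := T1 (x i) (x j), j := T2 (x i) (x j))) \<in> measurable (lebesgue_pow m) (lebesgue_pow m)"
      using measurable_compose[OF comp T(2)] j by (simp add: lebesgue_pow_def insert_absorb)
    from measurable_compose[OF this F] show ?thesis .
  qed
  have "(\<integral>\<^sup>+x. F x \<partial>lebesgue_pow m) = (\<integral>\<^sup>+y. (\<integral>\<^sup>+s. \<integral>\<^sup>+t. F (y(i := s, j := t)) \<partial>lborel \<partial>lborel) \<partial>Pi\<^sub>M ?J ?L)"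
    by (rule nn_integral_lebesgue_pow_split[OF i j ij F])
  also have "\<dots> = (\<integral>\<^sup>+y. (\<integral>\<^sup>+s. \<integral>\<^sup>+t. F (y(i := T1 s t, j := T2 s t)) \<partial>lborel \<partial>lborel) \<partial>Pi\<^sub>M ?J ?L)"
  proof (rule nn_integral_cong, rule inv)
    fix y assume y: "y \<in> space (Pi\<^sub>M ?J ?L)"
    have "(\<lambda>p. y(i := fst p)) \<in> measurable (lborel \<Otimes>\<^sub>M lborel) (Pi\<^sub>M ({1..m} - {j}) ?L)"
      by (rule measurable_fun_upd[where J = ?J]) (use J y in auto)
    then have "(\<lambda>p. y(i := fst p, j := snd p)) \<in> measurable (lborel \<Otimes>\<^sub>M lborel) (lebesgue_pow m)"
      unfolding lebesgue_pow_def by (rule measurable_fun_upd[where J = "{1..m} - {j}", rotated]) (use J in auto)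
    from measurable_compose[OF this F] show "(\<lambda>p. F (y(i := fst p, j := snd p))) \<in> borel_measurable (lborel \<Otimes>\<^sub>M lborel)" .
  qed
  also have "\<dots> = (\<integral>\<^sup>+x. F (x(i := T1 (x i) (x j), j := T2 (x i) (x j))) \<partial>lebesgue_pow m)"
    unfolding nn_integral_lebesgue_pow_split[OF i j ij FT]
    using ij by (simp add: fun_upd_twist)
  finally show ?thesis .
qed

lemma nn_integral_lborel_swap:
  fixes G :: "real \<Rightarrow> real \<Rightarrow> ennreal"
  assumes "(\<lambda>p. G (fst p) (snd p)) \<in> borel_measurable (lborel \<Otimes>\<^sub>M lborel)"
  shows "(\<integral>\<^sup>+s. \<integral>\<^sup>+t. G s t \<partial>lborel \<partial>lborel) = (\<integral>\<^sup>+s. \<integral>\<^sup>+t. G t s \<partial>lborel \<partial>lborel)"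
  by (rule lborel_pair.Fubini'[symmetric]) (use assms in \<open>simp add: case_prod_beta'\<close>)

text \<open>The orthogonal map is composed of two affine substitutions in one variable each, with
  Jacobians \<open>sqrt 2\<close> and \<open>1 / sqrt 2\<close>, which cancel.\<close>

lemma nn_integral_lborel_rotate:
  fixes G :: "real \<Rightarrow> real \<Rightarrow> ennreal"
  assumes G[measurable]: "(\<lambda>p. G (fst p) (snd p)) \<in> borel_measurable (lborel \<Otimes>\<^sub>M lborel)"
  shows "(\<integral>\<^sup>+s. \<integral>\<^sup>+t. G s t \<partial>lborel \<partial>lborel) =
    (\<integral>\<^sup>+s. \<integral>\<^sup>+t. G ((s + t) / sqrt 2) ((s - t) / sqrt 2) \<partial>lborel \<partial>lborel)"
proof -
  have Gb: "(\<lambda>p. G (fst p) (snd p)) \<in> borel_measurable (borel \<Otimes>\<^sub>M borel)"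
    using G by (subst measurable_cong_sets[OF sets_pair_measure_cong[OF sets_lborel sets_lborel] refl, symmetric])
  have M: "(\<lambda>p. G (f p) (g p)) \<in> borel_measurable (lborel \<Otimes>\<^sub>M lborel)"
    if "f \<in> borel_measurable (lborel \<Otimes>\<^sub>M lborel)" "g \<in> borel_measurable (lborel \<Otimes>\<^sub>M lborel)"
    for f g :: "real \<times> real \<Rightarrow> real"
    using measurable_compose[OF measurable_Pair[OF that] Gb] by simp
  have M2: "(\<lambda>s. G (f s) (g s)) \<in> borel_measurable borel" if "f \<in> borel_measurable borel" "g \<in> borel_measurable borel" for f g :: "real \<Rightarrow> real"
    using measurable_compose[OF measurable_Pair[OF that] Gb] by simp
  let ?c = "1 / sqrt 2"
  have "(\<integral>\<^sup>+s. \<integral>\<^sup>+t. G s t \<partial>lborel \<partial>lborel) = (\<integral>\<^sup>+t. \<integral>\<^sup>+s. G s t \<partial>lborel \<partial>lborel)"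
    by (rule nn_integral_lborel_swap[OF G])
  also have "\<dots> = (\<integral>\<^sup>+t. ennreal (sqrt 2) * (\<integral>\<^sup>+s. G (t + sqrt 2 * s) t \<partial>lborel) \<partial>lborel)"
    by (intro nn_integral_cong, subst nn_integral_real_affine[where c = "sqrt 2"]) (auto intro!: M2)
  also have "\<dots> = ennreal (sqrt 2) * (\<integral>\<^sup>+t. \<integral>\<^sup>+s. G (t + sqrt 2 * s) t \<partial>lborel \<partial>lborel)"
    by (intro nn_integral_cmult lborel.borel_measurable_nn_integral) (simp add: case_prod_beta', intro M, auto)
  also have "(\<integral>\<^sup>+t. \<integral>\<^sup>+s. G (t + sqrt 2 * s) t \<partial>lborel \<partial>lborel) = (\<integral>\<^sup>+s. \<integral>\<^sup>+t. G (t + sqrt 2 * s) t \<partial>lborel \<partial>lborel)"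
    by (rule nn_integral_lborel_swap) (intro M, auto)
  also have "\<dots> = (\<integral>\<^sup>+s. ennreal ?c * (\<integral>\<^sup>+t. G ((- ?c * s + ?c * t) + sqrt 2 * s) (- ?c * s + ?c * t) \<partial>lborel) \<partial>lborel)"
    by (intro nn_integral_cong, subst nn_integral_real_affine[where c = ?c and t = "- ?c * _"]) (auto intro!: M2)
  also have "\<dots> = ennreal ?c * (\<integral>\<^sup>+s. (\<integral>\<^sup>+t. G ((- ?c * s + ?c * t) + sqrt 2 * s) (- ?c * s + ?c * t) \<partial>lborel) \<partial>lborel)"
    by (intro nn_integral_cmult lborel.borel_measurable_nn_integral) (simp add: case_prod_beta', intro M, auto)
  also have "ennreal (sqrt 2) * \<dots> = (\<integral>\<^sup>+s. (\<integral>\<^sup>+t. G ((- ?c * s + ?c * t) + sqrt 2 * s) (- ?c * s + ?c * t) \<partial>lborel) \<partial>lborel)"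
    by (simp add: mult.assoc[symmetric] ennreal_mult[symmetric])
  also have "\<dots> = (\<integral>\<^sup>+s. (\<integral>\<^sup>+t. G ((t + s) / sqrt 2) ((t - s) / sqrt 2) \<partial>lborel) \<partial>lborel)"
  proof -
    have "(- ?c * s + ?c * t) + sqrt 2 * s = (t + s) / sqrt 2" "- ?c * s + ?c * t = (t - s) / sqrt 2" for s t
      by (auto simp: field_simps)
    then show ?thesis by simp
  qed
  also have "\<dots> = (\<integral>\<^sup>+s. (\<integral>\<^sup>+t. G ((s + t) / sqrt 2) ((s - t) / sqrt 2) \<partial>lborel) \<partial>lborel)"
    by (rule nn_integral_lborel_swap) (intro M, auto)
  finally show ?thesis .
qed

lemma eucl_norm_fun_upd2:
  assumes "i \<in> {1..m}" "j \<in> {1..m}" "i \<noteq> j" "s\<^sup>2 + t\<^sup>2 = (x i)\<^sup>2 + (x j)\<^sup>2"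
  shows "eucl_norm m (x(i := s, j := t)) = eucl_norm m x"
proof -
  have "(\<Sum>k\<in>{1..m}. ((x(i := s, j := t)) k)\<^sup>2) = (\<Sum>k\<in>{1..m}. (x k)\<^sup>2)"
    using assms by (simp add: sum.remove[of _ i] sum.remove[of _ j])
  then show ?thesis by (simp add: eucl_norm_def del: fun_upd_apply)
qed

text \<open>Each factor \<open>1 + t\<^sup>2\<close> splits the claim into those for j and j + 2, so
  j has to vary in the induction.\<close>

lemma schwartz_decay:
  assumes "schwartz w"
  shows "\<exists>C. \<forall>t. \<bar>t ^ j * w t\<bar> * (1 + t\<^sup>2) ^ k \<le> C"
proof (induct k arbitrary: j)
  case 0
  have "bounded (range (\<lambda>x. x ^ j * (deriv ^^ 0) w x))"
    using assms unfolding schwartz_def by blast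
  then show ?case by (auto simp: bounded_iff abs_mult)
next
  case (Suc k)
  obtain C1 C2 where C: "\<And>t. \<bar>t ^ j * w t\<bar> * (1 + t\<^sup>2) ^ k \<le> C1" "\<And>t. \<bar>t ^ (j + 2) * w t\<bar> * (1 + t\<^sup>2) ^ k \<le> C2"
    using Suc[of j] Suc[of "j + 2"] by blast
  have "\<bar>t ^ j * w t\<bar> * (1 + t\<^sup>2) ^ Suc k = \<bar>t ^ j * w t\<bar> * (1 + t\<^sup>2) ^ k + \<bar>t ^ (j + 2) * w t\<bar> * (1 + t\<^sup>2) ^ k" for t
    by (simp add: abs_mult power_add algebra_simps power2_eq_square power_abs)
  then have "\<bar>t ^ j * w t\<bar> * (1 + t\<^sup>2) ^ Suc k \<le> C1 + C2" for t
    using C[of t] by simp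
  then show ?case by blast
qed

text \<open>The bound on m makes the coordinates 1 and 2 in \<open>h_const\<close> genuine
  ones.\<close>

locale radial_weight =
  fixes w :: "real \<Rightarrow> real" and m :: nat
  assumes schwartz: "schwartz w" and nonneg: "\<And>x. 0 \<le> w x" and even: "\<And>x. w (- x) = w x"
    and nonzero: "\<exists>x. w x \<noteq> 0" and m2: "2 \<le> m"
begin

declare measurable_lebesgue_pow_component [measurable]

abbreviation "LP \<equiv> lebesgue_pow m"
abbreviation "W \<equiv> \<lambda>x. w (eucl_norm m x)"

lemma isCont_w: "isCont w x"
proof -
  have "((deriv ^^ 0) w) field_differentiable (at x)"
    using schwartz unfolding schwartz_def by blast
  then show ?thesis by (simp add: field_differentiable_imp_continuous_at)
qed

lemma borel_measurable_w [measurable]: "w \<in> borel_measurable borel"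
  using isCont_w by (intro borel_measurable_continuous_onI) (simp add: continuous_at_imp_continuous_on)

lemma sq_eucl_norm: "(eucl_norm m x)\<^sup>2 = (\<Sum>i\<in>{1..m}. (x i)\<^sup>2)"
  by (simp add: eucl_norm_def sum_nonneg)

lemma component_sq_le: "i \<in> {1..m} \<Longrightarrow> (x i)\<^sup>2 \<le> (eucl_norm m x)\<^sup>2"
  unfolding sq_eucl_norm by (rule member_le_sum) auto

text \<open>The product of the \<open>1 + (x i)\<^sup>2\<close> is at most the m-th power of one
  plus the squared norm. Decay of order 2 + m in that quantity thus pays for the growth of P and
  leaves an integrable product of one-dimensional kernels.\<close>

lemma integrable_W:
  assumes [measurable]: "P \<in> borel_measurable LP" and P: "\<And>x. \<bar>P x\<bar> \<le> K * (1 + (eucl_norm m x)\<^sup>2)\<^sup>2"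
  shows "integrable LP (\<lambda>x. P x * W x)"
proof -
  obtain C where C: "\<And>t. \<bar>w t\<bar> * (1 + t\<^sup>2) ^ (2 + m) \<le> C"
    using schwartz_decay[OF schwartz, of 0 "2 + m"] by auto
  have C0: "0 \<le> C" using C[of 0] by (smt (verit) abs_ge_zero mult_nonneg_nonneg zero_le_power zero_le_power2)
  have K0: "0 \<le> K"
  proof -
    have "0 \<le> K * (1 + (eucl_norm m (\<lambda>_. 0))\<^sup>2)\<^sup>2" using P[of "\<lambda>_. 0"] abs_ge_zero order.trans by blast
    then show ?thesis by (simp add: eucl_norm_def)
  qed
  have "integrable LP (\<lambda>x. \<Prod>i\<in>{1..m}. 1 / (1 + (x i)\<^sup>2))"
    unfolding lebesgue_pow_def
    by (rule lborel_product.product_integrable_prod)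
      (use integrable_inverse_1_plus_square in \<open>auto simp: set_integrable_def inverse_eq_divide\<close>)
  then have "integrable LP (\<lambda>x. (K * C) * (\<Prod>i\<in>{1..m}. 1 / (1 + (x i)\<^sup>2)))"
    by (rule integrable_mult_right)
  then show ?thesis
  proof (rule Bochner_Integration.integrable_bound)
    have "\<bar>P x * W x\<bar> \<le> (K * C) * (\<Prod>i\<in>{1..m}. 1 / (1 + (x i)\<^sup>2))" for x
    proof -
      let ?n = "eucl_norm m x"
      have pos: "0 < 1 + ?n\<^sup>2" by (smt (verit) zero_le_power2)
      have "(\<Prod>i\<in>{1..m}. 1 + (x i)\<^sup>2) \<le> (\<Prod>i\<in>{1..m}. 1 + ?n\<^sup>2)"
        using component_sq_le by (intro prod_mono) auto
      then have pr: "(\<Prod>i\<in>{1..m}. 1 + (x i)\<^sup>2) \<le> (1 + ?n\<^sup>2) ^ m" by simp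
      have prpos: "0 < (\<Prod>i\<in>{1..m}. 1 + (x i)\<^sup>2)"
        by (intro prod_pos) (smt (verit) zero_le_power2)
      have "\<bar>P x * W x\<bar> = \<bar>P x\<bar> * \<bar>W x\<bar>" by (rule abs_mult)
      also have "\<dots> \<le> K * (1 + ?n\<^sup>2)\<^sup>2 * \<bar>W x\<bar>" by (intro mult_right_mono P) simp
      also have "\<dots> = K * (\<bar>W x\<bar> * (1 + ?n\<^sup>2) ^ (2 + m)) / (1 + ?n\<^sup>2) ^ m"
        using pos by (simp add: power_add power2_eq_square)
      also have "\<dots> \<le> K * C / (1 + ?n\<^sup>2) ^ m"
        using pos C[of ?n] K0 by (intro divide_right_mono mult_left_mono) auto
      also have "\<dots> \<le> K * C / (\<Prod>i\<in>{1..m}. 1 + (x i)\<^sup>2)"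
        using pr prpos K0 C0 pos by (intro divide_left_mono) auto
      finally show ?thesis by (simp add: prod_dividef)
    qed
    moreover have "0 \<le> (K * C) * (\<Prod>i\<in>{1..m}. 1 / (1 + (x i)\<^sup>2))" for x :: "nat \<Rightarrow> real"
      using K0 C0 by (intro mult_nonneg_nonneg prod_nonneg) auto
    ultimately show "AE x in LP. norm (P x * W x) \<le> norm ((K * C) * (\<Prod>i\<in>{1..m}. 1 / (1 + (x i)\<^sup>2)))"
      by (intro AE_I2) (simp del: prod_dividef)
  qed measurable
qed

text \<open>Evenness moves a point of positivity to the right half line; starting at
  \<open>\<bar>t0\<bar> + d / 3\<close> keeps the left end positive even for t0 = 0.\<close>

lemma w_pos_interval:
  obtains \<alpha> \<beta> where "0 < \<alpha>" "\<alpha> < \<beta>" "\<And>t. \<alpha> \<le> t \<Longrightarrow> t \<le> \<beta> \<Longrightarrow> 0 < w t"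
proof -
  obtain t0 where t0: "w t0 \<noteq> 0" using nonzero by blast
  have p: "0 < w \<bar>t0\<bar>" using t0 nonneg[of t0] even[of t0] by (auto simp: abs_if)
  have "\<forall>\<^sub>F t in at \<bar>t0\<bar>. 0 < w t"
    using isCont_w[of "\<bar>t0\<bar>"] p unfolding isCont_def by (rule order_tendstoD(1))
  then obtain d where d: "0 < d" "\<And>t. t \<noteq> \<bar>t0\<bar> \<Longrightarrow> dist t \<bar>t0\<bar> < d \<Longrightarrow> 0 < w t"
    unfolding eventually_at by auto
  show thesis
    by (rule that[of "\<bar>t0\<bar> + d / 3" "\<bar>t0\<bar> + d / 2"]) (use d in \<open>auto simp: dist_real_def intro!: d(2)\<close>)
qed

text \<open>On the cube with all coordinates between \<open>\<alpha> / sqrt m\<close> and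
  \<open>\<beta> / sqrt m\<close> the norm lies between \<alpha> and \<beta>, so the integrand is
  positive on a set of positive measure.\<close>

lemma integral_W_pos:
  assumes P: "P \<in> borel_measurable LP" "\<And>x. \<bar>P x\<bar> \<le> K * (1 + (eucl_norm m x)\<^sup>2)\<^sup>2" "\<And>x. 0 \<le> P x"
    and ab: "0 < \<alpha>" "\<alpha> < \<beta>" "\<And>t. \<alpha> \<le> t \<Longrightarrow> t \<le> \<beta> \<Longrightarrow> 0 < w t"
    and pos: "\<And>x. \<alpha> \<le> eucl_norm m x \<Longrightarrow> eucl_norm m x \<le> \<beta> \<Longrightarrow> (\<And>i. i \<in> {1..m} \<Longrightarrow> 0 < x i) \<Longrightarrow> 0 < P x"
  shows "0 < (\<integral>x. P x * W x \<partial>LP)"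
proof -
  have i: "integrable LP (\<lambda>x. P x * W x)" by (rule integrable_W[OF P(1,2)])
  have nn: "0 \<le> P x * W x" for x using P(3) nonneg by simp
  have sm: "0 < sqrt (real m)" using m2 by simp
  let ?a = "\<alpha> / sqrt m" and ?b = "\<beta> / sqrt m"
  let ?U = "Pi\<^sub>E {1..m} (\<lambda>_. {?a..?b})"
  have U: "0 < P x * W x" if x: "x \<in> ?U" for x
  proof -
    have xi: "?a \<le> x i" "x i \<le> ?b" if "i \<in> {1..m}" for i
      using x that by (auto simp: PiE_def Pi_def)
    have a0: "0 < ?a" using ab sm by simp
    have sq: "?a\<^sup>2 \<le> (x i)\<^sup>2" "(x i)\<^sup>2 \<le> ?b\<^sup>2" if "i \<in> {1..m}" for i
      using xi[OF that] a0 by (auto intro!: power_mono)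
    have "(\<Sum>i\<in>{1..m}. ?a\<^sup>2) \<le> (eucl_norm m x)\<^sup>2" "(eucl_norm m x)\<^sup>2 \<le> (\<Sum>i\<in>{1..m}. ?b\<^sup>2)"
      unfolding sq_eucl_norm by (intro sum_mono sq; assumption)+
    then have "\<alpha>\<^sup>2 \<le> (eucl_norm m x)\<^sup>2" "(eucl_norm m x)\<^sup>2 \<le> \<beta>\<^sup>2"
      using m2 by (auto simp: power_divide)
    moreover have "0 \<le> eucl_norm m x" by (simp add: eucl_norm_def sum_nonneg)
    ultimately have n: "\<alpha> \<le> eucl_norm m x" "eucl_norm m x \<le> \<beta>"
      using ab by (auto intro: power2_le_imp_le)
    have "0 < P x" using n xi(1) a0 by (intro pos) (auto intro: less_le_trans)
    then show ?thesis using ab(3)[OF n] by simp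
  qed
  have "(\<integral>x. P x * W x \<partial>LP) \<noteq> 0"
  proof
    assume "(\<integral>x. P x * W x \<partial>LP) = 0"
    then have "AE x in LP. P x * W x = 0"
      using integral_nonneg_eq_0_iff_AE[OF i] nn by simp
    then have "AE x in LP. x \<notin> ?U" by eventually_elim (use U in force)
    moreover have sU: "?U \<in> sets LP"
      unfolding lebesgue_pow_def by (rule sets_PiM_I_finite) auto
    ultimately have "emeasure LP ?U = 0"
      using sets.sets_into_space[OF sU] by (subst (asm) AE_iff_measurable[OF sU]) auto
    moreover have "emeasure LP ?U = (\<Prod>i\<in>{1..m}. emeasure lborel {?a..?b})"
      unfolding lebesgue_pow_def by (rule lborel_product.emeasure_PiM) auto
    moreover have "emeasure lborel {?a..?b} \<noteq> 0" using ab sm by (simp add: divide_right_mono field_simps)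
    ultimately show False by simp
  qed
  moreover have "0 \<le> (\<integral>x. P x * W x \<partial>LP)" using nn by simp
  ultimately show ?thesis by linarith
qed

lemma poly_bounds:
  fixes n :: real
  shows "1 \<le> (1 + n\<^sup>2)\<^sup>2" "n\<^sup>2 \<le> (1 + n\<^sup>2)\<^sup>2" "n ^ 4 \<le> (1 + n\<^sup>2)\<^sup>2"
proof -
  have e: "(1 + n\<^sup>2)\<^sup>2 = 1 + 2 * n\<^sup>2 + n ^ 4" by (simp add: power2_eq_square power4_eq_xxxx algebra_simps)
  show "1 \<le> (1 + n\<^sup>2)\<^sup>2" "n\<^sup>2 \<le> (1 + n\<^sup>2)\<^sup>2" "n ^ 4 \<le> (1 + n\<^sup>2)\<^sup>2"
    unfolding e by (auto simp: add_nonneg_nonneg)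
qed

lemma quartic_le:
  assumes "i \<in> {1..m}" "j \<in> {1..m}"
  shows "(x i)\<^sup>2 * (x j)\<^sup>2 \<le> (1 + (eucl_norm m x)\<^sup>2)\<^sup>2"
proof -
  have "(x i)\<^sup>2 * (x j)\<^sup>2 \<le> (eucl_norm m x)\<^sup>2 * (eucl_norm m x)\<^sup>2"
    using component_sq_le assms by (intro mult_mono) auto
  also have "\<dots> = (eucl_norm m x) ^ 4" by (simp add: power2_eq_square power4_eq_xxxx)
  finally show ?thesis using poly_bounds(3)[of "eucl_norm m x"] by linarith
qed

lemma integrable_monomials:
  shows "integrable LP W"
    and "i \<in> {1..m} \<Longrightarrow> integrable LP (\<lambda>x. (x i)\<^sup>2 * W x)"
    and "i \<in> {1..m} \<Longrightarrow> j \<in> {1..m} \<Longrightarrow> integrable LP (\<lambda>x. (x i)\<^sup>2 * (x j)\<^sup>2 * W x)"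
proof -
  show "integrable LP W"
    using integrable_W[of "\<lambda>_. 1" 1] poly_bounds(1) by simp
  show "integrable LP (\<lambda>x. (x i)\<^sup>2 * W x)" if i: "i \<in> {1..m}"
    by (rule integrable_W[where K = 1])
      (use i order.trans[OF component_sq_le[OF i] poly_bounds(2)] in auto)
  show "integrable LP (\<lambda>x. (x i)\<^sup>2 * (x j)\<^sup>2 * W x)" if "i \<in> {1..m}" "j \<in> {1..m}"
    by (rule integrable_W[where K = 1]) (use that quartic_le[OF that] in auto)
qed

lemma integral_transform:
  fixes T1 T2 :: "real \<Rightarrow> real \<Rightarrow> real"
  assumes ij: "i \<in> {1..m}" "j \<in> {1..m}" "i \<noteq> j"
    and T: "(\<lambda>p. T1 (fst p) (snd p)) \<in> borel_measurable (borel \<Otimes>\<^sub>M borel)" "(\<lambda>p. T2 (fst p) (snd p)) \<in> borel_measurable (borel \<Otimes>\<^sub>M borel)"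
    and inv: "\<And>G. (\<lambda>p. G (fst p) (snd p)) \<in> borel_measurable (lborel \<Otimes>\<^sub>M lborel) \<Longrightarrow>
      (\<integral>\<^sup>+s. \<integral>\<^sup>+t. G s t \<partial>lborel \<partial>lborel) = (\<integral>\<^sup>+s. \<integral>\<^sup>+t. G (T1 s t) (T2 s t) \<partial>lborel \<partial>lborel)"
    and iso: "\<And>s t. (T1 s t)\<^sup>2 + (T2 s t)\<^sup>2 = s\<^sup>2 + t\<^sup>2"
    and Pm: "(\<lambda>x. P (x i) (x j)) \<in> borel_measurable LP" "(\<lambda>x. P (T1 (x i) (x j)) (T2 (x i) (x j))) \<in> borel_measurable LP"
    and P0: "\<And>s t. 0 \<le> P s t"
  shows "(\<integral>x. P (x i) (x j) * W x \<partial>LP) = (\<integral>x. P (T1 (x i) (x j)) (T2 (x i) (x j)) * W x \<partial>LP)"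
proof -
  have "(\<integral>\<^sup>+x. ennreal (P (x i) (x j) * W x) \<partial>LP) = (\<integral>\<^sup>+x. ennreal (P (T1 (x i) (x j)) (T2 (x i) (x j)) * W x) \<partial>LP)"
    using nn_integral_lebesgue_pow_transform[OF ij _ T inv, of "\<lambda>x. ennreal (P (x i) (x j) * W x)"] Pm(1) ij
    by (simp add: eucl_norm_fun_upd2[OF ij iso] del: fun_upd_apply) (simp add: fun_upd_apply)
  then show ?thesis
    using Pm P0 nonneg by (subst (1 2) integral_eq_nn_integral) auto
qed

lemma integral_swap:
  assumes ij: "i \<in> {1..m}" "j \<in> {1..m}"
  shows "(\<integral>x. (x i) ^ (2 * k) * W x \<partial>LP) = (\<integral>x. (x j) ^ (2 * k) * W x \<partial>LP)"
proof (cases "i = j")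
  case False
  show ?thesis
    by (rule integral_transform[OF ij False, where P = "\<lambda>s t. s ^ (2 * k)" and ?T1.0 = "\<lambda>s t. t" and ?T2.0 = "\<lambda>s t. s"])
      (use ij nn_integral_lborel_swap in auto)
qed simp

text \<open>The orthogonal map turns the product of the two squares into
  \<open>((x i)\<^sup>2 - (x j)\<^sup>2)\<^sup>2 / 4\<close>. With h the mixed and K the fourth
  moment this reads \<open>h = K / 2 - h / 2\<close>.\<close>

lemma integral_rotate:
  assumes ij: "i \<in> {1..m}" "j \<in> {1..m}" "i \<noteq> j"
  shows "(\<integral>x. (x i)\<^sup>2 * (x j)\<^sup>2 * W x \<partial>LP) = (\<integral>x. (x 1) ^ 4 * W x \<partial>LP) / 3"
proof -
  let ?K = "\<integral>x. (x 1) ^ 4 * W x \<partial>LP" and ?h = "\<integral>x. (x i)\<^sup>2 * (x j)\<^sup>2 * W x \<partial>LP"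
  have one: "1 \<in> {1..m}" using m2 by simp
  have K: "(\<integral>x. (x l) ^ 4 * W x \<partial>LP) = ?K" if "l \<in> {1..m}" for l
    using integral_swap[OF that one, of 2] by simp
  have Ki: "integrable LP (\<lambda>x. (x l) ^ 4 * W x)" if "l \<in> {1..m}" for l
    using integrable_monomials(3)[OF that that] by (simp add: power2_eq_square power4_eq_xxxx mult.assoc)
  have "?h = (\<integral>x. ((x i + x j) / sqrt 2)\<^sup>2 * ((x i - x j) / sqrt 2)\<^sup>2 * W x \<partial>LP)"
    by (rule integral_transform[OF ij, where P = "\<lambda>s t. s\<^sup>2 * t\<^sup>2" and ?T1.0 = "\<lambda>s t. (s + t) / sqrt 2" and ?T2.0 = "\<lambda>s t. (s - t) / sqrt 2"])
      (use ij in \<open>auto simp: power_divide power2_sum power2_diff field_simps intro!: nn_integral_lborel_rotate\<close>)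
  also have "\<dots> = (\<integral>x. ((x i) ^ 4 * W x + (x j) ^ 4 * W x) / 4 - (x i)\<^sup>2 * (x j)\<^sup>2 * W x / 2 \<partial>LP)"
    by (intro Bochner_Integration.integral_cong refl)
      (simp add: power_divide power2_eq_square power4_eq_xxxx field_simps)
  also have "\<dots> = (?K + ?K) / 4 - ?h / 2"
    using Ki[OF ij(1)] Ki[OF ij(2)] K[OF ij(1)] K[OF ij(2)] integrable_monomials(3)[OF ij(1,2)] by simp
  finally show ?thesis by simp
qed

text \<open>Every coordinate has the same second moment d. The fourth power of the norm has m (m -
  1) mixed terms, each contributing h, and m pure ones, each contributing 3 h.\<close>

lemma moment_sums:
  fixes d h :: real
  assumes d_def: "d = (\<integral>x. (x 1)\<^sup>2 * W x \<partial>LP)" and h_def: "h = (\<integral>x. (x 1)\<^sup>2 * (x 2)\<^sup>2 * W x \<partial>LP)"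
  shows "(\<integral>x. (eucl_norm m x)\<^sup>2 * W x \<partial>LP) = m * d"
    and "(\<integral>x. (eucl_norm m x) ^ 4 * W x \<partial>LP) = m * (m + 2) * h"
proof -
  let ?K = "\<integral>x. (x 1) ^ 4 * W x \<partial>LP"
  have one: "1 \<in> {1..m}" and two: "2 \<in> {1..m}" using m2 by auto
  have "(\<integral>x. (eucl_norm m x)\<^sup>2 * W x \<partial>LP) = (\<Sum>i\<in>{1..m}. \<integral>x. (x i)\<^sup>2 * W x \<partial>LP)"
    unfolding sq_eucl_norm sum_distrib_right
    by (rule Bochner_Integration.integral_sum) (rule integrable_monomials(2))
  also have "\<dots> = (\<Sum>i\<in>{1..m}. d)"
    unfolding d_def
  proof (intro sum.cong refl)
    show "(\<integral>x. (x i)\<^sup>2 * W x \<partial>LP) = (\<integral>x. (x 1)\<^sup>2 * W x \<partial>LP)" if "i \<in> {1..m}" for i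
      using integral_swap[OF that one, of 1] by simp
  qed
  finally show "(\<integral>x. (eucl_norm m x)\<^sup>2 * W x \<partial>LP) = m * d" by simp
  have h: "?K = 3 * h" using integral_rotate[OF one two] by (simp add: h_def)
  have q: "(\<integral>x. (x i)\<^sup>2 * (x j)\<^sup>2 * W x \<partial>LP) = h + (if i = j then 2 * h else 0)"
    if ij: "i \<in> {1..m}" "j \<in> {1..m}" for i j
  proof (cases "i = j")
    case True
    have "(\<integral>x. (x i)\<^sup>2 * (x j)\<^sup>2 * W x \<partial>LP) = (\<integral>x. (x i) ^ (2 * 2) * W x \<partial>LP)"
      using True by (simp add: power2_eq_square power4_eq_xxxx mult.assoc)
    also have "\<dots> = ?K" using integral_swap[OF ij(1) one, of 2] by simp
    finally show ?thesis using True h by simp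
  qed (use integral_rotate[OF ij] h in simp)
  have e: "(eucl_norm m x) ^ 4 * W x = (\<Sum>i\<in>{1..m}. \<Sum>j\<in>{1..m}. (x i)\<^sup>2 * (x j)\<^sup>2 * W x)" for x
  proof -
    have "(eucl_norm m x) ^ 4 = (\<Sum>i\<in>{1..m}. (x i)\<^sup>2) * (\<Sum>j\<in>{1..m}. (x j)\<^sup>2)"
      unfolding sq_eucl_norm[symmetric] by (simp add: power2_eq_square power4_eq_xxxx mult.assoc)
    also have "\<dots> = (\<Sum>i\<in>{1..m}. \<Sum>j\<in>{1..m}. (x i)\<^sup>2 * (x j)\<^sup>2)"
      by (rule sum_product)
    finally show ?thesis by (simp only: sum_distrib_right)
  qed
  have "(\<integral>x. (eucl_norm m x) ^ 4 * W x \<partial>LP) = (\<Sum>i\<in>{1..m}. \<integral>x. (\<Sum>j\<in>{1..m}. (x i)\<^sup>2 * (x j)\<^sup>2 * W x) \<partial>LP)"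
    unfolding e by (rule Bochner_Integration.integral_sum)
      (auto intro!: Bochner_Integration.integrable_sum integrable_monomials(3))
  also have "\<dots> = (\<Sum>i\<in>{1..m}. \<Sum>j\<in>{1..m}. \<integral>x. (x i)\<^sup>2 * (x j)\<^sup>2 * W x \<partial>LP)"
    by (intro sum.cong refl Bochner_Integration.integral_sum integrable_monomials(3))
  also have "\<dots> = (\<Sum>i\<in>{1..m}. \<Sum>j\<in>{1..m}. h + (if i = j then 2 * h else 0))"
    by (intro sum.cong refl q)
  also have "\<dots> = m * (m + 2) * h"
    by (simp add: sum.distrib algebra_simps)
  finally show "(\<integral>x. (eucl_norm m x) ^ 4 * W x \<partial>LP) = m * (m + 2) * h" .
qed

lemma moments_pos:
  shows "0 < (\<integral>x. W x \<partial>LP)" and "0 < (\<integral>x. (x 1)\<^sup>2 * W x \<partial>LP)"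
    and "0 < (\<integral>x. (x 1)\<^sup>2 * (x 2)\<^sup>2 * W x \<partial>LP)"
proof -
  obtain \<alpha> \<beta> where ab: "0 < \<alpha>" "\<alpha> < \<beta>" "\<And>t. \<alpha> \<le> t \<Longrightarrow> t \<le> \<beta> \<Longrightarrow> 0 < w t"
    using w_pos_interval by blast
  have one: "1 \<in> {1..m}" and two: "2 \<in> {1..m}" using m2 by auto
  show "0 < (\<integral>x. W x \<partial>LP)"
    using integral_W_pos[of "\<lambda>_. 1" 1, OF _ _ _ ab] poly_bounds(1) by simp
  show "0 < (\<integral>x. (x 1)\<^sup>2 * W x \<partial>LP)"
    by (rule integral_W_pos[where K = 1, OF _ _ _ ab])
      (use one order.trans[OF component_sq_le[OF one] poly_bounds(2)] in \<open>auto simp: less_imp_neq[THEN not_sym]\<close>)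
  show "0 < (\<integral>x. (x 1)\<^sup>2 * (x 2)\<^sup>2 * W x \<partial>LP)"
    by (rule integral_W_pos[where K = 1, OF _ _ _ ab])
      (use one two quartic_le[OF one two] in \<open>auto simp: less_imp_neq[THEN not_sym]\<close>)
qed

text \<open>Strict Cauchy-Schwarz; equality would force \<open>w\<close> to live on a sphere.\<close>

lemma moment_inequality:
  "m * (\<integral>x. (x 1)\<^sup>2 * W x \<partial>LP)\<^sup>2 < (m + 2) * ((\<integral>x. W x \<partial>LP) * (\<integral>x. (x 1)\<^sup>2 * (x 2)\<^sup>2 * W x \<partial>LP))"
proof -
  define s d h where "s = (\<integral>x. W x \<partial>LP)" "d = (\<integral>x. (x 1)\<^sup>2 * W x \<partial>LP)" "h = (\<integral>x. (x 1)\<^sup>2 * (x 2)\<^sup>2 * W x \<partial>LP)"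
  note sdh = this
  have s0: "0 < s" unfolding sdh by (rule moments_pos)
  \<comment> \<open>The mean of the squared norm under the normalized weight; the claim is that the
    squared norm has positive variance.\<close>
  define c where "c = m * d / s"
  obtain \<alpha>0 \<beta>0 where ab0: "0 < \<alpha>0" "\<alpha>0 < \<beta>0" "\<And>t. \<alpha>0 \<le> t \<Longrightarrow> t \<le> \<beta>0 \<Longrightarrow> 0 < w t"
    using w_pos_interval by blast
  \<comment> \<open>An interval of positivity that also avoids the sphere of squared radius c: the
    lower half of the given one if c lies above its midpoint, otherwise the upper quarter.\<close>
  obtain \<alpha> \<beta> where ab: "0 < \<alpha>" "\<alpha> < \<beta>" "\<And>t. \<alpha> \<le> t \<Longrightarrow> t \<le> \<beta> \<Longrightarrow> 0 < w t"
    and c: "\<And>t. \<alpha> \<le> t \<Longrightarrow> t \<le> \<beta> \<Longrightarrow> t\<^sup>2 \<noteq> c"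
  proof (cases "c > ((\<alpha>0 + \<beta>0) / 2)\<^sup>2")
    case True
    have "t\<^sup>2 \<le> ((\<alpha>0 + \<beta>0) / 2)\<^sup>2" if "\<alpha>0 \<le> t" "t \<le> (\<alpha>0 + \<beta>0) / 2" for t
      using that ab0 by (intro power_mono) auto
    then have "t\<^sup>2 < c" if "\<alpha>0 \<le> t" "t \<le> (\<alpha>0 + \<beta>0) / 2" for t
      using le_less_trans[OF _ True] that by blast
    then show thesis using ab0 by (intro that[of "\<alpha>0" "(\<alpha>0 + \<beta>0) / 2"]) force+
  next
    case False
    have "((\<alpha>0 + \<beta>0) / 2)\<^sup>2 < t\<^sup>2" if "(\<alpha>0 + 3 * \<beta>0) / 4 \<le> t" for t
      using that ab0 by (intro power_strict_mono) auto
    then have "c < t\<^sup>2" if "(\<alpha>0 + 3 * \<beta>0) / 4 \<le> t" for t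
      using False that by (meson le_less_trans not_le)
    then show thesis using ab0 by (intro that[of "(\<alpha>0 + 3 * \<beta>0) / 4" \<beta>0]) force+
  qed
  have eb: "\<bar>((eucl_norm m x)\<^sup>2 - c)\<^sup>2\<bar> \<le> (1 + \<bar>c\<bar>)\<^sup>2 * (1 + (eucl_norm m x)\<^sup>2)\<^sup>2" for x
  proof -
    have "\<bar>(eucl_norm m x)\<^sup>2 - c\<bar> \<le> (1 + \<bar>c\<bar>) * (1 + (eucl_norm m x)\<^sup>2)"
      by (auto simp: abs_le_iff algebra_simps intro: add_mono order.trans[OF abs_ge_self] mult_nonneg_nonneg)
        (smt (verit) mult_nonneg_nonneg zero_le_power2 abs_ge_zero)+
    then have "\<bar>(eucl_norm m x)\<^sup>2 - c\<bar>\<^sup>2 \<le> ((1 + \<bar>c\<bar>) * (1 + (eucl_norm m x)\<^sup>2))\<^sup>2"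
      by (intro power_mono) auto
    then show ?thesis by (simp add: power_mult_distrib)
  qed
  have "0 < (\<integral>x. ((eucl_norm m x)\<^sup>2 - c)\<^sup>2 * W x \<partial>LP)"
    by (rule integral_W_pos[OF _ eb _ ab]) (use c in auto)
  also have "\<dots> = (\<integral>x. (eucl_norm m x) ^ 4 * W x - 2 * c * ((eucl_norm m x)\<^sup>2 * W x) + c\<^sup>2 * W x \<partial>LP)"
    by (intro Bochner_Integration.integral_cong refl) (simp add: power2_eq_square power4_eq_xxxx algebra_simps)
  also have "\<dots> = m * (m + 2) * h - 2 * c * (m * d) + c\<^sup>2 * s"
  proof -
    have "integrable LP (\<lambda>x. (eucl_norm m x) ^ 4 * W x)"
      by (rule integrable_W[where K = 1]) (use poly_bounds(3) in auto)
    moreover have "integrable LP (\<lambda>x. (eucl_norm m x)\<^sup>2 * W x)"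
      by (rule integrable_W[where K = 1]) (use poly_bounds(2) in auto)
    ultimately show ?thesis
      using integrable_monomials(1) by (simp add: moment_sums[OF sdh(2,3)] sdh(1)[symmetric])
  qed
  also have "\<dots> = (m * (m + 2) * (s * h) - (m * d)\<^sup>2) / s"
    using s0 by (simp add: c_def field_simps power2_eq_square)
  finally have "(m * d)\<^sup>2 < m * (m + 2) * (s * h)"
    using s0 by (simp add: zero_less_divide_iff)
  then have "m * (m * d\<^sup>2) < m * ((m + 2) * (s * h))"
    by (simp add: power2_eq_square algebra_simps)
  then show ?thesis
    using m2 unfolding sdh[symmetric] by (simp add: mult_less_cancel_left_pos)
qed

lemma constants_pos: "0 < s_const w m" "0 < d_const w m" "0 < h_const w m"
  using moments_pos by (simp_all add: s_const_def d_const_def h_const_def)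

lemma q_const_gt: "m / (m + 2) < q_const w m"
proof -
  let ?k = "1 / (2 * pi) ^ m"
  define s d h where "s = (\<integral>x. W x \<partial>LP)" "d = (\<integral>x. (x 1)\<^sup>2 * W x \<partial>LP)" "h = (\<integral>x. (x 1)\<^sup>2 * (x 2)\<^sup>2 * W x \<partial>LP)"
  note sdh = this
  have d0: "0 < d" unfolding sdh by (rule moments_pos)
  have "q_const w m = s * h / d\<^sup>2"
    unfolding q_const_def s_const_def d_const_def h_const_def sdh
    by (simp add: power2_eq_square field_simps)
  moreover have "m * d\<^sup>2 < (m + 2) * (s * h)"
    using moment_inequality by (simp add: sdh)
  ultimately have "m * d\<^sup>2 < ((m + 2) * q_const w m) * d\<^sup>2"
    using d0 by simp
  then have "m < (m + 2) * q_const w m"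
    using d0 by (simp only: mult_less_cancel_right_pos zero_less_power)
  then show ?thesis
    by (subst pos_divide_less_eq) (simp_all add: mult.commute)
qed

text \<open>As \<open>s_check\<close> equals \<open>r * d\<^sup>2 / h\<close>, the ratio is
  \<open>1 - q / r\<close>. For q \<ge> 1 it vanishes; for q < 1 it is 1 - q with r = 1. So a
  nontrivial deconvolution occurs only where no outer Gaussian smoothing is present, and its
  variance is below the \<open>2 / (N + 1)\<close> available for N = m + 1.\<close>

lemma omega_ratio:
  shows "omega_const w m / s_check w m = 1 - q_const w m / r_const w m"
    and "0 \<le> omega_const w m / s_check w m"
    and "omega_const w m / s_check w m < 2 / (m + 2)"
    and "r_const w m = 1 \<or> omega_const w m / s_check w m = 0"
    and "1 \<le> r_const w m"
proof -
  show r1: "1 \<le> r_const w m" by (simp add: r_const_def)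
  have sc: "s_check w m = r_const w m * (d_const w m)\<^sup>2 / h_const w m"
    by (simp add: s_check_def omega_const_def)
  show e: "omega_const w m / s_check w m = 1 - q_const w m / r_const w m"
    unfolding sc omega_const_def q_const_def using constants_pos r1
    by (simp add: field_simps)
  show "0 \<le> omega_const w m / s_check w m"
    unfolding e using r1 by (simp add: r_const_def field_simps)
  show "omega_const w m / s_check w m < 2 / (m + 2)"
  proof (cases "1 \<le> q_const w m")
    case True
    then show ?thesis unfolding e by (simp add: r_const_def)
  next
    case False
    then show ?thesis unfolding e using q_const_gt by (simp add: r_const_def max_def field_simps)
  qed
  show "r_const w m = 1 \<or> omega_const w m / s_check w m = 0"
    unfolding e by (auto simp: r_const_def max_def)
qed

end

section \<open>Characteristic functions of densities and convolutions\<close>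

lemma density_lborel_char:
  fixes p :: "real \<Rightarrow> real"
  assumes p: "integrable lborel p" "\<And>y. 0 \<le> p y" and Z: "Z = (\<integral>y. p y \<partial>lborel)" "0 < Z"
  shows "real_distribution (density lborel (\<lambda>y. ennreal (p y / Z)))"
    and "char (density lborel (\<lambda>y. ennreal (p y / Z))) t = (\<integral>y. p y *\<^sub>R iexp (t * y) \<partial>lborel) / of_real Z"
proof -
  have [measurable]: "p \<in> borel_measurable borel" using p(1) by simp
  have "(\<integral>\<^sup>+y. ennreal (p y / Z) \<partial>lborel) = ennreal (\<integral>y. p y / Z \<partial>lborel)"
    using p Z by (intro nn_integral_eq_integral) auto
  also have "\<dots> = 1" using Z by simp
  finally have "prob_space (density lborel (\<lambda>y. ennreal (p y / Z)))"
    by (intro prob_spaceI) (simp add: emeasure_density)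
  then show "real_distribution (density lborel (\<lambda>y. ennreal (p y / Z)))"
    by (simp add: real_distribution_def real_distribution_axioms_def)
  have "char (density lborel (\<lambda>y. ennreal (p y / Z))) t = (\<integral>y. (1 / Z) *\<^sub>R (p y *\<^sub>R iexp (t * y)) \<partial>lborel)"
    unfolding char_def using p(2) Z(2) by (subst integral_density) auto
  also have "\<dots> = (1 / Z) *\<^sub>R (\<integral>y. p y *\<^sub>R iexp (t * y) \<partial>lborel)"
    by (rule integral_scaleR_right)
  finally show "char (density lborel (\<lambda>y. ennreal (p y / Z))) t = (\<integral>y. p y *\<^sub>R iexp (t * y) \<partial>lborel) / of_real Z"
    by (simp add: scaleR_conv_of_real)
qed

lemma convolution_char:
  assumes "real_distribution \<mu>" "real_distribution \<nu>"
  shows "real_distribution (convolution \<mu> \<nu>)" and "char (convolution \<mu> \<nu>) t = char \<mu> t * char \<nu> t"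
proof -
  interpret M: real_distribution \<mu> by fact
  interpret N: real_distribution \<nu> by fact
  interpret MN: pair_prob_space \<mu> \<nu> ..
  have m[measurable]: "(\<lambda>(x, y). x + y) \<in> borel_measurable (\<mu> \<Otimes>\<^sub>M \<nu>)"
    by measurable
  show "real_distribution (convolution \<mu> \<nu>)"
    unfolding real_distribution_def real_distribution_axioms_def convolution_def
    using MN.prob_space_distr[OF m] by simp
  have i: "integrable (\<mu> \<Otimes>\<^sub>M \<nu>) (\<lambda>(x, y). iexp (t * x) * iexp (t * y))"
    by (rule MN.integrable_const_bound[where B = 1]) (auto simp: norm_mult)
  have "char (convolution \<mu> \<nu>) t = (\<integral>p. (case p of (x, y) \<Rightarrow> iexp (t * x) * iexp (t * y)) \<partial>(\<mu> \<Otimes>\<^sub>M \<nu>))"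
    unfolding char_def convolution_def
    by (subst integral_distr[OF m]) (auto simp: case_prod_beta' exp_add[symmetric] algebra_simps intro!: Bochner_Integration.integral_cong)
  also have "\<dots> = (\<integral>x. (\<integral>y. iexp (t * x) * iexp (t * y) \<partial>\<nu>) \<partial>\<mu>)"
    using MN.integral_fst[OF i] by simp
  also have "\<dots> = char \<mu> t * char \<nu> t"
    unfolding char_def by (simp only: integral_mult_right_zero integral_mult_left_zero)
  finally show "char (convolution \<mu> \<nu>) t = char \<mu> t * char \<nu> t" .
qed

text \<open>The Gaussian characteristic function never vanishes, so it can be divided out, and
  Levy's uniqueness theorem identifies the measures.\<close>

lemma gauss_deconvolution_unique:
  assumes k: "0 \<le> \<kappa>" and s: "real_distribution \<sigma>\<^sub>0" and c: "real_distribution \<mu>"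
    and eq: "\<And>t. char \<sigma>\<^sub>0 t = of_real (exp (\<kappa> * t\<^sup>2 / 2)) * char \<mu> t"
  shows "(THE \<sigma>. real_distribution \<sigma> \<and> convolution (gauss_measure \<kappa>) \<sigma> = \<mu>) = \<sigma>\<^sub>0"
proof (rule the_equality)
  note g = real_distribution_gauss_measure[OF k]
  have one: "of_real (exp (- \<kappa> * t\<^sup>2 / 2)) * complex_of_real (exp (\<kappa> * t\<^sup>2 / 2)) = 1" for t
    by (simp add: of_real_mult[symmetric] exp_add[symmetric] del: of_real_mult)
  have "convolution (gauss_measure \<kappa>) \<sigma>\<^sub>0 = \<mu>"
  proof (rule Levy_uniqueness[OF convolution_char(1)[OF g s] c], rule ext)
    fix t
    show "char (convolution (gauss_measure \<kappa>) \<sigma>\<^sub>0) t = char \<mu> t"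
      unfolding convolution_char(2)[OF g s] char_gauss_measure[OF k] eq mult.assoc[symmetric] one by simp
  qed
  then show "real_distribution \<sigma>\<^sub>0 \<and> convolution (gauss_measure \<kappa>) \<sigma>\<^sub>0 = \<mu>" using s by simp
  fix \<sigma> assume \<sigma>: "real_distribution \<sigma> \<and> convolution (gauss_measure \<kappa>) \<sigma> = \<mu>"
  show "\<sigma> = \<sigma>\<^sub>0"
  proof (rule Levy_uniqueness[OF _ s], use \<sigma> in blast, rule ext)
    fix t
    have cm: "char \<mu> t = of_real (exp (- \<kappa> * t\<^sup>2 / 2)) * char \<sigma> t"
      using \<sigma> convolution_char(2)[OF g, of \<sigma> t] char_gauss_measure[OF k] by auto
    have one': "complex_of_real (exp (\<kappa> * t\<^sup>2 / 2)) * of_real (exp (- \<kappa> * t\<^sup>2 / 2)) = 1"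
      using one[of t] by (simp only: mult.commute)
    show "char \<sigma> t = char \<sigma>\<^sub>0 t"
      unfolding eq cm mult.assoc[symmetric] one' by simp
  qed
qed

text \<open>Completing the square: the product of the density of \<open>\<gamma>\<^bsub>r-1\<^esub>\<close> at \<open>y - u\<close> with that of
  \<open>\<gamma>\<^sub>1\<close> at \<open>y\<close> is the density of \<open>\<gamma>\<^sub>r\<close> at \<open>u\<close> times a Gaussian density in \<open>y\<close> centred at \<open>u / r\<close>.\<close>

lemma normal_density_complete_square:
  assumes r: "1 < r"
  shows "normal_density 0 (sqrt (r - 1)) (y - u) * exp (u\<^sup>2 / (4 * r)) * normal_density 0 1 y =
    1 / sqrt (2 * pi * r) * exp (- (1 / (4 * r)) * u\<^sup>2) * normal_density (u / r) (sqrt ((r - 1) / r)) y"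
proof -
  have c: "1 / sqrt (2 * pi * (r - 1)) * (1 / sqrt (2 * pi)) = 1 / sqrt (2 * pi * r) * (1 / sqrt (2 * pi * ((r - 1) / r)))"
    using r by (simp add: real_sqrt_mult real_sqrt_divide field_simps)
  have s: "(sqrt (r - 1))\<^sup>2 = r - 1" "(sqrt ((r - 1) / r))\<^sup>2 = (r - 1) / r"
    using r by auto
  have e: "- (y - u - 0)\<^sup>2 / (2 * (r - 1)) + u\<^sup>2 / (4 * r) + - (y - 0)\<^sup>2 / (2 * 1\<^sup>2) =
      - (1 / (4 * r)) * u\<^sup>2 + - (y - u / r)\<^sup>2 / (2 * ((r - 1) / r))"
  proof -
    define q where "q = r - 1"
    have q: "0 < q" "r = q + 1" using r by (auto simp: q_def)
    show ?thesis unfolding q(2) using q(1) by (simp add: divide_simps) (simp add: power2_eq_square algebra_simps)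
  qed
  have "normal_density 0 (sqrt (r - 1)) (y - u) * exp (u\<^sup>2 / (4 * r)) * normal_density 0 1 y =
    (1 / sqrt (2 * pi * (r - 1)) * (1 / sqrt (2 * pi))) *
    exp (- (y - u - 0)\<^sup>2 / (2 * (r - 1)) + u\<^sup>2 / (4 * r) + - (y - 0)\<^sup>2 / (2 * 1\<^sup>2))"
    unfolding normal_density_def s exp_add by simp
  also have "\<dots> = 1 / sqrt (2 * pi * r) * exp (- (1 / (4 * r)) * u\<^sup>2) * normal_density (u / r) (sqrt ((r - 1) / r)) y"
    unfolding c e normal_density_def s exp_add by simp
  finally show ?thesis .
qed

text \<open>Completing the square absorbs the growth of \<open>exp (u\<^sup>2 / (4 * r))\<close>:
  the weight becomes a mixture, over \<open>\<rho> u * exp (- (1 / (4 * r)) * u\<^sup>2)\<close>, of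
  Gaussians centred at u / r with variance (r - 1) / r, and Fubini gives its transform. The case r =
  1 is separate because the convolving measure is then a Dirac mass.\<close>

lemma theta_weight:
  fixes \<rho> :: "real \<Rightarrow> real"
  assumes r: "1 \<le> r" and \<rho>: "integrable lborel \<rho>" "\<And>x. 0 \<le> \<rho> x"
  defines "p \<equiv> \<lambda>y. conv_fun (gauss_measure (r - 1)) (\<lambda>x. \<rho> x * exp (x\<^sup>2 / (4 * r))) y * normal_density 0 1 y"
  shows "integrable lborel p" and "0 \<le> p y"
    and "(\<integral>y. p y *\<^sub>R iexp (t * y) \<partial>lborel) = of_real (1 / sqrt (2 * pi * r) * exp (- ((r - 1) / r) * t\<^sup>2 / 2)) *
      (\<integral>u. \<rho> u *\<^sub>R (exp (- (1 / (4 * r)) * u\<^sup>2) *\<^sub>R iexp (t * u / r)) \<partial>lborel)"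
proof -
  have \<rho>m[measurable]: "\<rho> \<in> borel_measurable borel" using \<rho>(1) by simp
  show "0 \<le> p y" for y
    unfolding p_def conv_fun_def using \<rho>(2) by (intro mult_nonneg_nonneg integral_nonneg_AE) auto
  define \<rho>' where "\<rho>' u = \<rho> u * exp (- (1 / (4 * r)) * u\<^sup>2)" for u
  have \<rho>'i: "integrable lborel \<rho>'"
    unfolding \<rho>'_def
    by (rule Bochner_Integration.integrable_bound[OF \<rho>(1)]) (use r \<rho>(2) in \<open>auto simp: abs_mult intro!: mult_left_le\<close>)
  have \<rho>'0: "0 \<le> \<rho>' u" for u using \<rho>(2) by (simp add: \<rho>'_def)
  have [measurable]: "\<rho>' \<in> borel_measurable borel" using \<rho>'i by simp
  have goal: "integrable lborel p \<and> (\<integral>y. p y *\<^sub>R iexp (t * y) \<partial>lborel) = of_real (1 / sqrt (2 * pi * r) * exp (- ((r - 1) / r) * t\<^sup>2 / 2)) *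
      (\<integral>u. \<rho>' u *\<^sub>R iexp (t * u / r) \<partial>lborel)"
  proof (cases "r = 1")
    case True
    have "p y = (1 / sqrt (2 * pi)) * \<rho>' y" for y
    proof -
      have "exp (y\<^sup>2 / 4) * exp (- y\<^sup>2 / 2) = exp (- (1 / 4) * y\<^sup>2)" by (simp add: exp_add[symmetric])
      then show ?thesis
        unfolding p_def conv_fun_def \<rho>'_def using True
        by (simp add: gauss_measure_def integral_return normal_density_def mult_ac)
    qed
    note pe = this
    have "(\<integral>y. p y *\<^sub>R iexp (t * y) \<partial>lborel) = (\<integral>y. (1 / sqrt (2 * pi)) *\<^sub>R (\<rho>' y *\<^sub>R iexp (t * y)) \<partial>lborel)"
      by (simp add: pe)
    also have "\<dots> = (1 / sqrt (2 * pi)) *\<^sub>R (\<integral>y. \<rho>' y *\<^sub>R iexp (t * y) \<partial>lborel)"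
      by (rule integral_scaleR_right)
    finally have "(\<integral>y. p y *\<^sub>R iexp (t * y) \<partial>lborel) = (1 / sqrt (2 * pi)) *\<^sub>R (\<integral>y. \<rho>' y *\<^sub>R iexp (t * y) \<partial>lborel)" .
    moreover have "integrable lborel p"
      unfolding pe[abs_def] using \<rho>'i by (rule integrable_mult_right)
    ultimately show ?thesis
      using True by (simp add: scaleR_conv_of_real)
  next
    case False
    with r have r1: "1 < r" by simp
    let ?s = "sqrt ((r - 1) / r)" and ?C = "1 / sqrt (2 * pi * r)"
    have s: "0 < ?s" using r1 by simp
    define k where "k u y = (?C * \<rho>' u) * normal_density (u / r) ?s y" for u y
    have p: "p y = (\<integral>u. k u y \<partial>lborel)" for y
    proof -
      have "p y = (\<integral>x. normal_density 0 (sqrt (r - 1)) x * (\<rho> (y - x) * exp ((y - x)\<^sup>2 / (4 * r))) \<partial>lborel) * normal_density 0 1 y"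
        unfolding p_def conv_fun_def using r1 by (subst integral_gauss_measure) auto
      also have "\<dots> = (\<integral>u. normal_density 0 (sqrt (r - 1)) (y - u) * (\<rho> u * exp (u\<^sup>2 / (4 * r))) \<partial>lborel) * normal_density 0 1 y"
        by (subst lborel_integral_real_affine[where c = "-1" and t = y]) auto
      also have "\<dots> = (\<integral>u. \<rho> u * (normal_density 0 (sqrt (r - 1)) (y - u) * exp (u\<^sup>2 / (4 * r)) * normal_density 0 1 y) \<partial>lborel)"
        by (subst integral_mult_left_zero[symmetric], intro Bochner_Integration.integral_cong refl) (simp only: mult_ac)
      also have "\<dots> = (\<integral>u. k u y \<partial>lborel)"
        unfolding normal_density_complete_square[OF r1] k_def \<rho>'_def by (simp add: mult_ac)
      finally show ?thesis .
    qed
    have k0: "0 \<le> k u y" for u y unfolding k_def using \<rho>'0 r by simp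
    have km: "(\<lambda>(u, y). k u y) \<in> borel_measurable (lborel \<Otimes>\<^sub>M lborel)"
      unfolding k_def normal_density_def case_prod_beta' by measurable
    have ky: "integrable lborel (k u)" "(\<integral>y. k u y \<partial>lborel) = ?C * \<rho>' u" for u
      unfolding k_def using s by auto
    have ki: "integrable (lborel \<Otimes>\<^sub>M lborel) (\<lambda>(u, y). k u y)"
    proof (rule lborel_pair.Fubini_integrable[OF km])
      have "(\<lambda>u. \<integral>y. norm (k u y) \<partial>lborel) = (\<lambda>u. ?C * \<rho>' u)" using k0 ky(2) by simp
      then show "integrable lborel (\<lambda>u. \<integral>y. norm (case (u, y) of (u, y) \<Rightarrow> k u y) \<partial>lborel)"
        using \<rho>'i by simp
    qed (use ky in simp)
    have pi: "integrable lborel p"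
      unfolding p[abs_def] using lborel_pair.integrable_snd[OF ki] by simp
    have gi: "integrable (lborel \<Otimes>\<^sub>M lborel) (\<lambda>(u, y). k u y *\<^sub>R iexp (t * y))"
      by (rule Bochner_Integration.integrable_bound[OF ki]) (use km in \<open>auto simp: case_prod_beta'\<close>)
    have "(\<integral>y. p y *\<^sub>R iexp (t * y) \<partial>lborel) = (\<integral>y. (\<integral>u. k u y *\<^sub>R iexp (t * y) \<partial>lborel) \<partial>lborel)"
    proof -
      have "AE y in lborel. integrable lborel (\<lambda>u. k u y)"
        using lborel_pair.AE_integrable_snd[OF ki] by simp
      then have "AE y in lborel. p y *\<^sub>R iexp (t * y) = (\<integral>u. k u y *\<^sub>R iexp (t * y) \<partial>lborel)"
        by eventually_elim (simp add: p)
      then show ?thesis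
        using pi lborel_pair.integrable_snd[OF gi] by (intro integral_cong_AE) auto
    qed
    also have "\<dots> = (\<integral>u. (\<integral>y. k u y *\<^sub>R iexp (t * y) \<partial>lborel) \<partial>lborel)"
      using gi by (rule lborel_pair.Fubini_integral)
    also have "(\<lambda>u. \<integral>y. k u y *\<^sub>R iexp (t * y) \<partial>lborel) =
        (\<lambda>u. of_real (?C * exp (- ((r - 1) / r) * t\<^sup>2 / 2)) * (\<rho>' u *\<^sub>R iexp (t * u / r)))"
    proof
      fix u
      have "(\<integral>y. k u y *\<^sub>R iexp (t * y) \<partial>lborel) = (\<integral>y. (?C * \<rho>' u) *\<^sub>R (normal_density (u / r) ?s y *\<^sub>R iexp (t * y)) \<partial>lborel)"
        by (simp add: k_def)
      also have "\<dots> = (?C * \<rho>' u) *\<^sub>R (iexp (t * (u / r)) * of_real (exp (- ?s\<^sup>2 * t\<^sup>2 / 2)))"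
        by (simp only: integral_scaleR_right iexp_normal_density(2)[OF s])
      also have "?s\<^sup>2 = (r - 1) / r" using r1 by simp
      finally show "(\<integral>y. k u y *\<^sub>R iexp (t * y) \<partial>lborel) =
          of_real (?C * exp (- ((r - 1) / r) * t\<^sup>2 / 2)) * (\<rho>' u *\<^sub>R iexp (t * u / r))"
        by (simp add: scaleR_conv_of_real mult_ac)
    qed
    finally show ?thesis
      using pi by (simp only: integral_mult_right_zero simp_thms)
  qed
  then show "integrable lborel p" by blast
  show "(\<integral>y. p y *\<^sub>R iexp (t * y) \<partial>lborel) = of_real (1 / sqrt (2 * pi * r) * exp (- ((r - 1) / r) * t\<^sup>2 / 2)) *
      (\<integral>u. \<rho> u *\<^sub>R (exp (- (1 / (4 * r)) * u\<^sup>2) *\<^sub>R iexp (t * u / r)) \<partial>lborel)"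
    using goal by (simp add: \<rho>'_def)
qed

section \<open>The Gaussian-weighted trace and the measures of the theorem\<close>

definition goe_gauss_char :: "nat \<Rightarrow> real \<Rightarrow> complex" where
  "goe_gauss_char N s = (\<integral>a. (\<Sum>x\<in>#spec N a. exp (- (1 / 4) * x\<^sup>2) *\<^sub>R iexp (s * x)) \<partial>goe_entries N 1)"

lemma continuous_gauss_iexp:
  "continuous_on UNIV (\<lambda>x::real. exp (- b * x\<^sup>2) *\<^sub>R iexp (s * x))"
  by (intro continuous_intros)

lemma cmod_gauss_iexp_le: "0 \<le> b \<Longrightarrow> cmod (exp (- b * x\<^sup>2) *\<^sub>R iexp (s * x)) \<le> 1"
  by simp

lemma goe_gauss_char_0_pos:
  assumes "0 < N"
  shows "0 < Re (goe_gauss_char N 0)" and "Im (goe_gauss_char N 0) = 0"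
proof -
  interpret P: prob_space "goe_entries N 1" by (rule prob_space_goe_entries) simp
  let ?f = "\<lambda>a. \<Sum>x\<in>#spec N a. exp (- (1 / 4) * x\<^sup>2) *\<^sub>R iexp (0 * x)"
  have i: "integrable (goe_entries N 1) ?f"
    by (rule integrable_sum_spec_goe[OF _ continuous_gauss_iexp cmod_gauss_iexp_le]) auto
  have pos: "0 < (\<Sum>x\<in>#A. exp (- (1 / 4) * x\<^sup>2))" if "A \<noteq> {#}" for A :: "real multiset"
    using that
  proof (induct A)
    case (add x A)
    then show ?case by (cases "A = {#}") (auto intro: add_pos_pos)
  qed simp
  have "spec N a \<noteq> {#}" for a using assms size_spec[of N a] by (auto simp del: size_spec)
  then have fpos: "0 < Re (?f a)" for a using pos by (simp add: Re_sum_mset)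
  have eq: "Re (goe_gauss_char N 0) = (\<integral>a. Re (?f a) \<partial>goe_entries N 1)"
    unfolding goe_gauss_char_def using integral_Re[OF i] by simp
  have "(\<integral>a. Re (?f a) \<partial>goe_entries N 1) \<noteq> 0"
  proof
    assume "(\<integral>a. Re (?f a) \<partial>goe_entries N 1) = 0"
    then have "AE a in goe_entries N 1. Re (?f a) = 0"
      using integral_nonneg_eq_0_iff_AE[OF integrable_Re[OF i]] fpos by (simp add: less_imp_le)
    moreover have "Re (?f a) \<noteq> 0" for a using fpos[of a] by linarith
    ultimately have "AE a in goe_entries N 1. False"
      by (elim AE_mp) (intro AE_I2 impI, blast)
    then show False by simp
  qed
  moreover have "0 \<le> (\<integral>a. Re (?f a) \<partial>goe_entries N 1)"
    using fpos by (intro integral_nonneg_AE) (auto simp: less_imp_le)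
  ultimately show "0 < Re (goe_gauss_char N 0)" unfolding eq by linarith
  have "Im (?f a) = 0" for a by (simp add: Im_sum_mset)
  then have "(\<integral>a. Im (?f a) \<partial>goe_entries N 1) = 0" by simp
  then show "Im (goe_gauss_char N 0) = 0"
    unfolding goe_gauss_char_def using integral_Im[OF i] by simp
qed

text \<open>The substitution \<open>u = sqrt r * x\<close> passes to unit variance, makes the weight
  independent of r and changes the frequency from t / r to \<open>t / sqrt r\<close>.\<close>

lemma goe_density_gauss_integral:
  assumes r: "0 < r" and N: "0 < N" and d: "is_goe_density N r \<rho>"
  shows "(\<integral>u. \<rho> u *\<^sub>R (exp (- (1 / (4 * r)) * u\<^sup>2) *\<^sub>R iexp (t * u / r)) \<partial>lborel) = goe_gauss_char N (t / sqrt r) / N"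
proof -
  let ?f = "\<lambda>u. exp (- (1 / (4 * r)) * u\<^sup>2) *\<^sub>R iexp ((t / r) * u)"
  have c: "continuous_on UNIV ?f" by (rule continuous_gauss_iexp)
  have b: "cmod (?f x) \<le> 1" for x by (rule cmod_gauss_iexp_le) (use r in simp)
  have "?f (sqrt r * x) = exp (- (1 / 4) * x\<^sup>2) *\<^sub>R iexp ((t / sqrt r) * x)" for x
  proof -
    have "- (1 / (4 * r)) * (sqrt r * x)\<^sup>2 = - (1 / 4) * x\<^sup>2" using r by (simp add: power_mult_distrib)
    moreover have "(t / r) * (sqrt r * x) = (t / sqrt r) * x"
      using r by (simp add: field_simps)
    ultimately show ?thesis by simp
  qed
  then have "(\<integral>a. (\<Sum>x\<in>#spec N a. ?f x) \<partial>goe_entries N r) = goe_gauss_char N (t / sqrt r)"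
    using integral_sum_spec_goe_scale[OF r c b, of N] by (simp add: goe_gauss_char_def)
  then show ?thesis
    using is_goe_density_complex(2)[OF r d c b] by simp
qed

lemma sigma_check_char:
  assumes r: "1 \<le> r_const w m"
  defines "r \<equiv> r_const w m" and "N \<equiv> m + 1"
  shows "real_distribution (sigma_check w m)"
    and "char (sigma_check w m) t = of_real (exp (- ((r - 1) / r) * t\<^sup>2 / 2)) * goe_gauss_char N (t / sqrt r) / goe_gauss_char N 0"
proof -
  have r1: "1 \<le> r" and r0: "0 < r" using r by (auto simp: r_def)
  have N: "0 < N" by (simp add: N_def)
  let ?\<rho> = "goe_density N r" and ?p = "sigma_check_weight w m"
  have d: "is_goe_density N r ?\<rho>" by (rule is_goe_density_goe_density[OF r0 N])
  then have \<rho>: "integrable lborel ?\<rho>" "\<And>x. 0 \<le> ?\<rho> x" by (auto simp: is_goe_density_def)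
  have p: "?p = (\<lambda>y. conv_fun (gauss_measure (r - 1)) (\<lambda>x. ?\<rho> x * exp (x\<^sup>2 / (4 * r))) y * normal_density 0 1 y)"
    by (simp add: sigma_check_weight_def[abs_def] theta_plus_def[abs_def] r_def N_def)
  let ?C = "1 / sqrt (2 * pi * r)"
  have pi: "integrable lborel ?p" and p0: "0 \<le> ?p y" for y
    unfolding p by (rule theta_weight[OF r1 \<rho>])+
  have pc: "(\<integral>y. ?p y *\<^sub>R iexp (t * y) \<partial>lborel) = of_real (?C * exp (- ((r - 1) / r) * t\<^sup>2 / 2)) * (goe_gauss_char N (t / sqrt r) / N)" for t
    unfolding p theta_weight(3)[OF r1 \<rho>] goe_density_gauss_integral[OF r0 N d] ..
  define Z where "Z = (\<integral>y. ?p y \<partial>lborel)"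
  have "complex_of_real Z = (\<integral>y. ?p y *\<^sub>R iexp (0 * y) \<partial>lborel)"
    unfolding Z_def by (simp add: scaleR_conv_of_real integral_of_real)
  also have "\<dots> = of_real ?C * (goe_gauss_char N 0 / N)"
    unfolding pc by simp
  finally have Zc: "complex_of_real Z = of_real ?C * (goe_gauss_char N 0 / N)" .
  define L where "L = Re (goe_gauss_char N 0)"
  have L0: "goe_gauss_char N 0 = of_real L"
    using goe_gauss_char_0_pos(2)[OF N] by (simp add: complex_eq_iff L_def)
  have "complex_of_real Z = complex_of_real (?C * (L / N))"
    unfolding Zc L0 by simp
  then have "Z = ?C * (L / N)" by (simp only: of_real_eq_iff)
  then have Z: "0 < Z" using goe_gauss_char_0_pos(1)[OF N] r0 N by (simp add: L_def)
  have sc: "sigma_check w m = density lborel (\<lambda>y. ennreal (?p y / Z))"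
    by (simp add: sigma_check_def Z_def)
  show "real_distribution (sigma_check w m)"
    unfolding sc by (rule density_lborel_char[OF pi p0 Z_def Z])
  have "char (sigma_check w m) t = of_real (?C * exp (- ((r - 1) / r) * t\<^sup>2 / 2)) * (goe_gauss_char N (t / sqrt r) / N) /
      (of_real ?C * (goe_gauss_char N 0 / N))"
    unfolding sc density_lborel_char(2)[OF pi p0 Z_def Z] pc Zc ..
  also have "\<dots> = of_real (exp (- ((r - 1) / r) * t\<^sup>2 / 2)) * goe_gauss_char N (t / sqrt r) / goe_gauss_char N 0"
  proof -
    have "complex_of_real ?C \<noteq> 0" "goe_gauss_char N 0 \<noteq> 0" "complex_of_nat N \<noteq> 0"
      using r0 N goe_gauss_char_0_pos(1)[OF N] by auto
    then show ?thesis by (simp add: field_simps)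
  qed
  finally show "char (sigma_check w m) t = of_real (exp (- ((r - 1) / r) * t\<^sup>2 / 2)) * goe_gauss_char N (t / sqrt r) / goe_gauss_char N 0" .
qed

text \<open>The Gaussian factor \<open>e\<^bsup>-x\<^sup>2/4\<^esup>\<close> turns the smoothing by \<open>\<gamma>\<^bsub>2/N\<^esub>\<close> of the traceless spectrum into
  a smoothing by exactly \<open>\<gamma>\<^bsub>2/(N+1)\<^esub>\<close>; this is what can be removed again.\<close>

lemma goe_gauss_char_mixture:
  assumes N: "0 < N"
  defines "Q \<equiv> \<lambda>t. \<integral>a. (\<Sum>x\<in>#spec N a. exp (- (real N / (4 * (real N + 1))) * (x - diag_mean N a)\<^sup>2) *\<^sub>R
    iexp (t * (real N / (real N + 1) * (x - diag_mean N a)))) \<partial>goe_entries N 1"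
  shows "goe_gauss_char N t = of_real (sqrt (real N / (real N + 1)) * exp (- (2 / (real N + 1)) * t\<^sup>2 / 2)) * Q t"
proof -
  let ?\<alpha> = "real N / (real N + 1)" and ?W = "\<lambda>x. exp (- (real N / (4 * (real N + 1))) * x\<^sup>2)" and ?C = "sqrt (real N / (real N + 1))"
  let ?f = "\<lambda>u. exp (- (1 / 4) * u\<^sup>2) *\<^sub>R iexp (t * u)"
  let ?mix = "goe_mixture N 1 (\<lambda>_. 1) 1 (2 * 1 / N)" and ?mix' = "goe_mixture N 1 ?W ?\<alpha> (2 / (real N + 1))"
  have W: "continuous_on UNIV ?W" "\<And>x. 0 \<le> ?W x" "\<And>x. ?W x \<le> 1"
    by (auto intro!: continuous_intros)
  \<comment> \<open>Precisions add: N / 2 from the smoothing and 1 / 2 from the weight give (N + 1)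
    / 2. The remaining factor in x is Gaussian with the sum of the variances, 2 / N + 2.\<close>
  have nd: "normal_density x (sqrt (2 / N)) u * exp (- (1 / 4) * u\<^sup>2) = ?C * (?W x * normal_density (?\<alpha> * x) (sqrt (2 / (real N + 1))) u)" for x u :: real
  proof -
    have s: "(sqrt (2 / N))\<^sup>2 = 2 / N" "(sqrt (2 / (real N + 1)))\<^sup>2 = 2 / (real N + 1)" by auto
    have c: "1 / sqrt (2 * pi * (2 / N)) = ?C * (1 / sqrt (2 * pi * (2 / (real N + 1))))"
      using N by (simp add: real_sqrt_mult real_sqrt_divide)
    have e: "- (u - x)\<^sup>2 / (2 * (2 / N)) + - (1 / 4) * u\<^sup>2 = - (real N / (4 * (real N + 1))) * x\<^sup>2 + - (u - ?\<alpha> * x)\<^sup>2 / (2 * (2 / (real N + 1)))"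
    proof -
      define n where "n = real N + 1"
      have n: "0 < n" "real N = n - 1" by (auto simp: n_def)
      show ?thesis unfolding n(2) using n(1)
        by (simp add: divide_simps) (simp add: power2_eq_square algebra_simps)
    qed
    have "normal_density x (sqrt (2 / N)) u * exp (- (1 / 4) * u\<^sup>2) = 1 / sqrt (2 * pi * (2 / N)) * exp (- (u - x)\<^sup>2 / (2 * (2 / N)) + - (1 / 4) * u\<^sup>2)"
      unfolding normal_density_def s exp_add by simp
    also have "\<dots> = ?C * (?W x * normal_density (?\<alpha> * x) (sqrt (2 / (real N + 1))) u)"
      unfolding c e normal_density_def s exp_add by simp
    finally show ?thesis .
  qed
  have mix: "?mix u * exp (- (1 / 4) * u\<^sup>2) = ?C * ?mix' u" for u
  proof -
    have "?mix u * exp (- (1 / 4) * u\<^sup>2) = (\<integral>a. (\<Sum>x\<in>#spec N a. normal_density (x - diag_mean N a) (sqrt (2 / N)) u) * exp (- (1 / 4) * u\<^sup>2) \<partial>goe_entries N 1)"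
      unfolding goe_mixture_def by simp
    also have "\<dots> = (\<integral>a. ?C * (\<Sum>x\<in>#spec N a. ?W (x - diag_mean N a) * normal_density (?\<alpha> * (x - diag_mean N a)) (sqrt (2 / (real N + 1))) u) \<partial>goe_entries N 1)"
    proof (intro Bochner_Integration.integral_cong refl)
      fix a
      have "(\<Sum>x\<in>#A. g x) * k = ?C * (\<Sum>x\<in>#A. h x)" if "\<And>x. g x * k = ?C * h x" for A g h and k :: real
        by (induct A) (simp_all add: distrib_left distrib_right that)
      from this[OF nd]
      show "(\<Sum>x\<in>#spec N a. normal_density (x - diag_mean N a) (sqrt (2 / N)) u) * exp (- (1 / 4) * u\<^sup>2) =
        ?C * (\<Sum>x\<in>#spec N a. ?W (x - diag_mean N a) * normal_density (?\<alpha> * (x - diag_mean N a)) (sqrt (2 / (real N + 1))) u)" .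
    qed
    also have "\<dots> = ?C * ?mix' u" unfolding goe_mixture_def by (rule integral_mult_right_zero)
    finally show ?thesis .
  qed
  have d: "is_goe_density N 1 (\<lambda>y. ?mix y / N)"
    using is_goe_density_mixture[OF zero_less_one_class.zero_less_one N] .
  have "goe_gauss_char N t / N = (\<integral>u. (?mix u / N) *\<^sub>R ?f u \<partial>lborel)"
    unfolding goe_gauss_char_def
    by (rule is_goe_density_complex(2)[OF zero_less_one_class.zero_less_one d continuous_gauss_iexp cmod_gauss_iexp_le, symmetric]) simp
  also have "\<dots> = (\<integral>u. (1 / N) *\<^sub>R (?C *\<^sub>R (?mix' u *\<^sub>R iexp (t * u))) \<partial>lborel)"
  proof (intro Bochner_Integration.integral_cong refl)
    fix u
    have "(?mix u / N) *\<^sub>R ?f u = (1 / N) *\<^sub>R ((?mix u * exp (- (1 / 4) * u\<^sup>2)) *\<^sub>R iexp (t * u))" by simp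
    then show "(?mix u / N) *\<^sub>R ?f u = (1 / N) *\<^sub>R (?C *\<^sub>R (?mix' u *\<^sub>R iexp (t * u)))"
      unfolding mix by simp
  qed
  also have "\<dots> = (1 / N) *\<^sub>R (?C *\<^sub>R (\<integral>u. ?mix' u *\<^sub>R iexp (t * u) \<partial>lborel))"
    by (simp only: integral_scaleR_right)
  also have "(\<integral>u. ?mix' u *\<^sub>R iexp (t * u) \<partial>lborel) = of_real (exp (- (2 / (real N + 1)) * t\<^sup>2 / 2)) * Q t"
    unfolding Q_def by (rule integral_goe_mixture_iexp[OF zero_less_one_class.zero_less_one _, where W = ?W and K = 1, OF _ W]) simp
  finally have "goe_gauss_char N t / N = (?C *\<^sub>R (of_real (exp (- (2 / (real N + 1)) * t\<^sup>2 / 2)) * Q t)) / N"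
    by (simp add: scaleR_conv_of_real)
  then show ?thesis
    using N by (simp add: scaleR_conv_of_real)
qed

text \<open>Lower the variance of the mixture from \<open>2 / (real N + 1)\<close> by \<kappa>. The
  transform is multiplied by exactly the required factor, and the strict bound on \<kappa> leaves a
  positive variance, hence a true density.\<close>

lemma gauss_deconvolution_exists:
  assumes N: "0 < N" and k: "0 \<le> \<kappa>" "\<kappa> < 2 / (real N + 1)"
  shows "\<exists>\<sigma>. real_distribution \<sigma> \<and>
    (\<forall>t. char \<sigma> t = of_real (exp (\<kappa> * t\<^sup>2 / 2)) * (goe_gauss_char N t / goe_gauss_char N 0))"
proof -
  let ?\<alpha> = "real N / (real N + 1)" and ?W = "\<lambda>x. exp (- (real N / (4 * (real N + 1))) * x\<^sup>2)" and ?c = "2 / (real N + 1) - \<kappa>"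
  let ?p = "goe_mixture N 1 ?W ?\<alpha> ?c"
  define Q where "Q t = (\<integral>a. (\<Sum>x\<in>#spec N a. ?W (x - diag_mean N a) *\<^sub>R iexp (t * (?\<alpha> * (x - diag_mean N a)))) \<partial>goe_entries N 1)" for t
  have c: "0 < ?c" using k by simp
  have W: "continuous_on UNIV ?W" "\<And>x. 0 \<le> ?W x" "\<And>x. ?W x \<le> 1"
    by (auto intro!: continuous_intros)
  have L: "goe_gauss_char N t = of_real (sqrt ?\<alpha> * exp (- (2 / (real N + 1)) * t\<^sup>2 / 2)) * Q t" for t
    unfolding Q_def by (rule goe_gauss_char_mixture[OF N])
  have pi: "integrable lborel ?p" by (rule integrable_goe_mixture[OF zero_less_one_class.zero_less_one c, where W = ?W and K = 1, OF W])
  have p0: "0 \<le> ?p y" for y by (rule goe_mixture_nonneg[OF zero_less_one_class.zero_less_one c, where W = ?W and K = 1, OF W])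
  have pc: "(\<integral>y. ?p y *\<^sub>R iexp (t * y) \<partial>lborel) = of_real (exp (- ?c * t\<^sup>2 / 2)) * Q t" for t
    unfolding Q_def by (rule integral_goe_mixture_iexp[OF zero_less_one_class.zero_less_one c, where W = ?W and K = 1, OF W])
  define Z where "Z = (\<integral>y. ?p y \<partial>lborel)"
  have ZQ: "complex_of_real Z = Q 0"
    using pc[of 0] unfolding Z_def by (simp add: scaleR_conv_of_real integral_of_real)
  have al: "0 < sqrt ?\<alpha>" using N by simp
  have "goe_gauss_char N 0 = of_real (sqrt ?\<alpha> * Z)" unfolding L ZQ[symmetric] by simp
  then have "0 < sqrt ?\<alpha> * Z"
    using goe_gauss_char_0_pos(1)[OF N] by (simp del: real_sqrt_gt_0_iff)
  then have Z: "0 < Z" using al by (simp only: zero_less_mult_pos)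
  let ?\<sigma> = "density lborel (\<lambda>y. ennreal (?p y / Z))"
  have "char ?\<sigma> t = of_real (exp (\<kappa> * t\<^sup>2 / 2)) * (goe_gauss_char N t / goe_gauss_char N 0)" for t
  proof -
    have "char ?\<sigma> t = of_real (exp (- ?c * t\<^sup>2 / 2)) * Q t / Q 0"
      unfolding density_lborel_char(2)[OF pi p0 Z_def Z] pc ZQ ..
    also have "exp (- ?c * t\<^sup>2 / 2) = exp (\<kappa> * t\<^sup>2 / 2) * exp (- (2 / (real N + 1)) * t\<^sup>2 / 2)"
      by (simp add: exp_add[symmetric] algebra_simps diff_divide_distrib add_divide_distrib)
    also have "of_real (exp (\<kappa> * t\<^sup>2 / 2) * exp (- (2 / (real N + 1)) * t\<^sup>2 / 2)) * Q t / Q 0 =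
      of_real (exp (\<kappa> * t\<^sup>2 / 2)) * (goe_gauss_char N t / goe_gauss_char N 0)"
      using N unfolding L by simp
    finally show ?thesis .
  qed
  then show ?thesis
    using density_lborel_char(1)[OF pi p0 Z_def Z] by blast
qed

text \<open>If \<kappa> = 0, \<open>sigma_check\<close> itself is the solution. Otherwise r = 1, so
  the outer Gaussian factor is 1 and the frequency is t, which is the situation of the deconvolution
  lemma.\<close>

lemma (in radial_weight) sigma_meas_char:
  defines "r \<equiv> r_const w m" and "N \<equiv> m + 1" and "\<kappa> \<equiv> omega_const w m / s_check w m"
  shows "real_distribution (sigma_meas w m)"
    and "char (sigma_meas w m) t = of_real (exp (\<kappa> * t\<^sup>2 / 2) * exp (- ((r - 1) / r) * t\<^sup>2 / 2)) *
      (goe_gauss_char N (t / sqrt r) / goe_gauss_char N 0)"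
proof -
  have r: "1 \<le> r_const w m" by (rule omega_ratio(5))
  have k: "0 \<le> \<kappa>" "\<kappa> < 2 / (real N + 1)" using omega_ratio(2,3) by (auto simp: \<kappa>_def N_def)
  note sc = sigma_check_char[OF r, folded r_def N_def]
  have "\<exists>\<sigma>. real_distribution \<sigma> \<and> (\<forall>t. char \<sigma> t = of_real (exp (\<kappa> * t\<^sup>2 / 2)) * char (sigma_check w m) t)"
  proof (cases "\<kappa> = 0")
    case True
    then show ?thesis using sc(1) by auto
  next
    case False
    then have r1: "r = 1" using omega_ratio(4) by (auto simp: r_def \<kappa>_def)
    have "0 < N" by (simp add: N_def)
    from gauss_deconvolution_exists[OF this k] show ?thesis
      by (simp add: sc(2) r1)
  qed
  then obtain \<sigma> where \<sigma>: "real_distribution \<sigma>" "\<And>t. char \<sigma> t = of_real (exp (\<kappa> * t\<^sup>2 / 2)) * char (sigma_check w m) t"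
    by blast
  have "sigma_meas w m = \<sigma>"
    unfolding sigma_meas_def \<kappa>_def[symmetric] by (rule gauss_deconvolution_unique[OF k(1) \<sigma>(1) sc(1) \<sigma>(2)])
  then show "real_distribution (sigma_meas w m)"
    and "char (sigma_meas w m) t = of_real (exp (\<kappa> * t\<^sup>2 / 2) * exp (- ((r - 1) / r) * t\<^sup>2 / 2)) *
      (goe_gauss_char N (t / sqrt r) / goe_gauss_char N 0)"
    using \<sigma> sc(2) by (auto simp: mult.assoc)
qed

section \<open>The entire test function and its boundary values on the strip\<close>

definition strip_test :: "real \<Rightarrow> complex \<Rightarrow> complex" where
  "strip_test s z = exp (- z\<^sup>2 / 4 + \<i> * of_real s * z)"

lemma strip_test_real: "strip_test s (of_real x) = exp (- (1 / 4) * x\<^sup>2) *\<^sub>R iexp (s * x)"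
proof -
  have "strip_test s (of_real x) = exp (of_real (- (1 / 4) * x\<^sup>2) + \<i> * of_real (s * x))"
    unfolding strip_test_def by (simp add: mult.assoc)
  then show ?thesis
    unfolding exp_add exp_of_real by (simp add: scaleR_conv_of_real)
qed

text \<open>At height e = 1 or e = -1 the square contributes the constant 1 / 4 and a frequency
  shift by e / 2, so the modulus remains a multiple of the Gaussian density of variance 2.\<close>

lemma strip_test_boundary:
  assumes e: "e = 1 \<or> e = - 1"
  shows "strip_test s (Complex x e) =
    (sqrt (4 * pi) * exp (1 / 4 - e * s)) *\<^sub>R (normal_density 0 (sqrt 2) x *\<^sub>R iexp ((s - e / 2) * x))"
proof -
  have "- (Complex x e)\<^sup>2 / 4 + \<i> * of_real s * Complex x e =
      of_real (1 / 4 - e * s) + (of_real (- x\<^sup>2 / 4) + \<i> * of_real ((s - e / 2) * x))"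
    using e by (auto simp: complex_eq_iff power2_eq_square field_simps)
  then have "strip_test s (Complex x e) = of_real (exp (1 / 4 - e * s)) * (of_real (exp (- x\<^sup>2 / 4)) * iexp ((s - e / 2) * x))"
    unfolding strip_test_def by (simp only: exp_add exp_of_real)
  moreover have "exp (- x\<^sup>2 / 4) = sqrt (4 * pi) * normal_density 0 (sqrt 2) x"
    by (simp add: normal_density_def)
  ultimately show ?thesis by (simp add: scaleR_conv_of_real mult_ac)
qed

text \<open>The value is the same on both lines, as contour shifting predicts: the frequency shift
  and the factor \<open>exp (1 / 4 - e * s)\<close> compensate.\<close>

lemma strip_test_integral:
  assumes e: "e = 1 \<or> e = - 1"
  shows "integrable lborel (\<lambda>x. strip_test s (Complex x e))"
    and "(\<integral>x. strip_test s (Complex x e) \<partial>lborel) = of_real (sqrt (4 * pi) * exp (- s\<^sup>2))"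
proof -
  have s2: "0 < sqrt (2::real)" by simp
  show "integrable lborel (\<lambda>x. strip_test s (Complex x e))"
    unfolding strip_test_boundary[OF e] by (intro integrable_scaleR_right iexp_normal_density(1) s2)
  have ex: "exp (1 / 4 - e * s) * exp (- (sqrt 2)\<^sup>2 * (s - e / 2)\<^sup>2 / 2) = exp (- s\<^sup>2)"
  proof -
    have "1 / 4 - e * s + (- (sqrt 2)\<^sup>2 * (s - e / 2)\<^sup>2 / 2) = - s\<^sup>2"
      using e by (auto simp: power2_eq_square field_simps)
    then show ?thesis by (simp only: exp_add[symmetric])
  qed
  have "(\<integral>x. strip_test s (Complex x e) \<partial>lborel) =
    (sqrt (4 * pi) * exp (1 / 4 - e * s)) *\<^sub>R of_real (exp (- (sqrt 2)\<^sup>2 * (s - e / 2)\<^sup>2 / 2))"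
    unfolding strip_test_boundary[OF e] integral_scaleR_right iexp_normal_density(2)[OF s2] by simp
  also have "\<dots> = of_real (sqrt (4 * pi) * (exp (1 / 4 - e * s) * exp (- (sqrt 2)\<^sup>2 * (s - e / 2)\<^sup>2 / 2)))"
    by (simp add: scaleR_conv_of_real)
  finally show "(\<integral>x. strip_test s (Complex x e) \<partial>lborel) = of_real (sqrt (4 * pi) * exp (- s\<^sup>2))"
    unfolding ex .
qed

lemma cmod_strip_test_le:
  assumes "\<bar>Im z\<bar> \<le> 1"
  shows "cmod (strip_test s z) \<le> exp (1 / 4 + \<bar>s\<bar>)"
proof -
  have "Re (- z\<^sup>2 / 4 + \<i> * of_real s * z) = - (Re z)\<^sup>2 / 4 + (Im z)\<^sup>2 / 4 - s * Im z"
    by (simp add: power2_eq_square algebra_simps diff_divide_distrib)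
  also have "\<dots> \<le> 1 / 4 + \<bar>s\<bar>"
  proof -
    have "(Im z)\<^sup>2 \<le> 1" using assms by (simp add: abs_square_le_1)
    moreover have "- (s * Im z) \<le> \<bar>s\<bar>"
      using abs_ge_minus_self[of "s * Im z"] mult_left_le[OF assms, of "\<bar>s\<bar>"] by (simp add: abs_mult)
    moreover have "0 \<le> (Re z)\<^sup>2" by simp
    ultimately show ?thesis by linarith
  qed
  finally show ?thesis by (simp add: strip_test_def norm_exp_eq_Re)
qed

lemma resolvent_trace_cnj:
  "Im z \<noteq> 0 \<Longrightarrow> cnj (resolvent_trace N a z) = (\<Sum>x\<in>#spec N a. 1 / (of_real x - cnj z))"
proof -
  have "cnj (\<Sum>x\<in>#A. 1 / (of_real x - z)) = (\<Sum>x\<in>#A. 1 / (of_real x - cnj z))" for A :: "real multiset"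
    by (induct A) auto
  then show "Im z \<noteq> 0 \<Longrightarrow> ?thesis" by (simp add: resolvent_trace_eq)
qed

text \<open>Cauchy's formula at each eigenvalue, summed over the spectrum and averaged by Fubini.
  Since the eigenvalues are real, the lower line carries the conjugate of the trace on the upper
  one, so the local law at height 1 is enough.\<close>

lemma goe_gauss_char_resolvent:
  fixes N :: nat
  defines "g \<equiv> \<lambda>x. \<integral>a. resolvent_trace N a (Complex x 1) \<partial>goe_entries N 1"
  shows "integrable lborel (\<lambda>x. strip_test s (Complex x 1) * g x)"
    and "integrable lborel (\<lambda>x. strip_test s (Complex x (- 1)) * cnj (g x))"
    and "2 * pi * \<i> * goe_gauss_char N s =
      (\<integral>x. strip_test s (Complex x 1) * g x \<partial>lborel) - (\<integral>x. strip_test s (Complex x (- 1)) * cnj (g x) \<partial>lborel)"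
proof -
  let ?P = "goe_entries N 1" and ?F = "strip_test s"
  interpret P: prob_space ?P by (rule prob_space_goe_entries) simp
  interpret PL: pair_sigma_finite ?P lborel ..
  let ?T = "\<lambda>a x. resolvent_trace N a (Complex x 1)"
  have Fi: "integrable lborel (\<lambda>x. ?F (Complex x 1))" "integrable lborel (\<lambda>x. ?F (Complex x (- 1)))"
    by (auto intro: strip_test_integral)
  note Fm[measurable] = borel_measurable_integrable[OF Fi(1)] borel_measurable_integrable[OF Fi(2)]
  have Tm[measurable]: "(\<lambda>(a, x). ?T a x) \<in> borel_measurable (?P \<Otimes>\<^sub>M lborel)"
  proof -
    have c: "(\<lambda>p::(nat \<times> nat \<Rightarrow> real) \<times> real. Complex (snd p) 1) \<in> borel_measurable (?P \<Otimes>\<^sub>M lborel)"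
      unfolding Complex_eq by measurable
    show ?thesis
      unfolding resolvent_trace_def case_prod_beta'
      by (intro borel_measurable_sum borel_measurable_resolvent c measurable_compose[OF measurable_fst] goe_entries_entry_measurable) auto
  qed
  have Tle: "cmod (?T a x) \<le> N" for a x by (rule cmod_resolvent_trace_le) simp
  have int: "integrable (?P \<Otimes>\<^sub>M lborel) (\<lambda>(a, x). f x * h a x)"
    if f: "integrable lborel f" and h: "(\<lambda>(a, x). h a x) \<in> borel_measurable (?P \<Otimes>\<^sub>M lborel)" "\<And>a x. cmod (h a x) \<le> N"
    for f :: "real \<Rightarrow> complex" and h
  proof -
    have [measurable]: "f \<in> borel_measurable borel" using f by simp
    have "integrable (?P \<Otimes>\<^sub>M lborel) (\<lambda>(a, x). cmod (f x) * N)"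
      by (rule PL.Fubini_integrable) (use f in \<open>auto simp: case_prod_beta' P.integrable_const intro!: Bochner_Integration.integrable_mult_left\<close>)
    then show ?thesis
    proof (rule Bochner_Integration.integrable_bound)
      show "(\<lambda>(a, x). f x * h a x) \<in> borel_measurable (?P \<Otimes>\<^sub>M lborel)"
        using h(1) by (simp add: case_prod_beta')
      show "AE p in ?P \<Otimes>\<^sub>M lborel. norm (case p of (a, x) \<Rightarrow> f x * h a x) \<le> norm (case p of (a, x) \<Rightarrow> cmod (f x) * N)"
        using h(2) by (intro AE_I2) (auto simp: norm_mult intro!: mult_left_mono)
    qed
  qed
  have i1: "integrable (?P \<Otimes>\<^sub>M lborel) (\<lambda>(a, x). ?F (Complex x 1) * ?T a x)"
    by (rule int[OF Fi(1) Tm Tle])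
  have i2: "integrable (?P \<Otimes>\<^sub>M lborel) (\<lambda>(a, x). ?F (Complex x (- 1)) * cnj (?T a x))"
  proof (rule int[OF Fi(2)])
    have "cnj \<in> borel_measurable borel"
      by (intro borel_measurable_continuous_onI continuous_intros)
    from measurable_compose[OF Tm this]
    show "(\<lambda>(a, x). cnj (?T a x)) \<in> borel_measurable (?P \<Otimes>\<^sub>M lborel)" by (simp add: case_prod_beta')
  qed (use Tle in simp)
  have Ti: "integrable ?P (\<lambda>a. ?T a x)" for x
    by (rule P.integrable_const_bound[where B = N]) (use Tle borel_measurable_resolvent_trace_goe in auto)
  have g1: "(\<integral>a. ?F (Complex x 1) * ?T a x \<partial>?P) = ?F (Complex x 1) * g x" for x
    unfolding g_def by (rule integral_mult_right_zero)
  have g2: "(\<integral>a. ?F (Complex x (- 1)) * cnj (?T a x) \<partial>?P) = ?F (Complex x (- 1)) * cnj (g x)" for x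
    unfolding g_def using integral_bounded_linear[OF bounded_linear_cnj Ti[of x]]
    by (simp only: integral_mult_right_zero)
  show "integrable lborel (\<lambda>x. ?F (Complex x 1) * g x)"
    using PL.integrable_snd[OF i1] by (simp add: g1 del: integral_mult_right_zero)
  show "integrable lborel (\<lambda>x. ?F (Complex x (- 1)) * cnj (g x))"
    using PL.integrable_snd[OF i2] by (simp add: g2 del: integral_mult_right_zero)
  have hol: "?F holomorphic_on UNIV"
    unfolding strip_test_def by (intro holomorphic_intros) auto
  have pw: "2 * pi * \<i> * (\<Sum>x\<in>#spec N a. exp (- (1 / 4) * x\<^sup>2) *\<^sub>R iexp (s * x)) =
      (\<integral>x. ?F (Complex x 1) * ?T a x \<partial>lborel) - (\<integral>x. ?F (Complex x (- 1)) * cnj (?T a x) \<partial>lborel)" for a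
  proof -
    have ii: "integrable lborel (\<lambda>x. ?F (Complex x e) * (1 / (of_real l - Complex x e)))" if e: "e = 1 \<or> e = - 1" for e l
    proof (rule Bochner_Integration.integrable_bound[OF strip_test_integral(1)[OF e]])
      have "1 \<le> cmod (of_real l - Complex x e)" for x
        using abs_Im_le_cmod[of "of_real l - Complex x e"] e by auto
      then show "AE x in lborel. norm (?F (Complex x e) * (1 / (of_real l - Complex x e))) \<le> norm (?F (Complex x e))"
        by (intro AE_I2) (simp add: norm_mult norm_divide divide_le_eq mult_le_cancel_left1)
      have [measurable]: "(\<lambda>x. Complex x e) \<in> borel_measurable borel" unfolding Complex_eq by measurable
      show "(\<lambda>x. ?F (Complex x e) * (1 / (of_real l - Complex x e))) \<in> borel_measurable lborel"
        using borel_measurable_integrable[OF strip_test_integral(1)[OF e]] by measurable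
    qed
    have one: "2 * pi * \<i> * (exp (- (1 / 4) * l\<^sup>2) *\<^sub>R iexp (s * l)) =
        (\<integral>x. ?F (Complex x 1) * (1 / (of_real l - Complex x 1)) \<partial>lborel) -
        (\<integral>x. ?F (Complex x (- 1)) * (1 / (of_real l - Complex x (- 1))) \<partial>lborel)" for l
    proof -
      \<comment> \<open>The resolvent has l - z where Cauchy's formula has z - l; the sign exchanges
        the roles of the two lines.\<close>
      have flip: "?F z / (z - of_real l) = - (?F z * (1 / (of_real l - z)))" for z
        by (metis (no_types, opaque_lifting) minus_diff_eq minus_divide_right times_divide_eq_right mult.right_neutral)
      show ?thesis
        using cauchy_strip_formula[OF hol Fi cmod_strip_test_le, of l]
        unfolding strip_test_real flip by simp
    qed
    have tr: "(\<Sum>l\<in>#spec N a. ?F (Complex x 1) * (1 / (of_real l - Complex x 1))) = ?F (Complex x 1) * ?T a x"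
      "(\<Sum>l\<in>#spec N a. ?F (Complex x (- 1)) * (1 / (of_real l - Complex x (- 1)))) = ?F (Complex x (- 1)) * cnj (?T a x)" for x
      using resolvent_trace_eq[of "Complex x 1" N a] resolvent_trace_cnj[of "Complex x 1" N a]
      by (simp_all add: sum_mset_distrib_left image_mset.compositionality comp_def complex_cnj)
    have "2 * pi * \<i> * (\<Sum>x\<in>#A. exp (- (1 / 4) * x\<^sup>2) *\<^sub>R iexp (s * x)) =
      (\<Sum>l\<in>#A. \<integral>x. ?F (Complex x 1) * (1 / (of_real l - Complex x 1)) \<partial>lborel) -
      (\<Sum>l\<in>#A. \<integral>x. ?F (Complex x (- 1)) * (1 / (of_real l - Complex x (- 1))) \<partial>lborel)" for A
    proof (induct A)
      case (add l A)
      then show ?case using one[of l] by (simp only: image_mset_add_mset sum_mset.add_mset distrib_left) simp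
    qed simp
    also have "(\<Sum>l\<in>#spec N a. \<integral>x. ?F (Complex x 1) * (1 / (of_real l - Complex x 1)) \<partial>lborel) =
        (\<integral>x. (\<Sum>l\<in>#spec N a. ?F (Complex x 1) * (1 / (of_real l - Complex x 1))) \<partial>lborel)"
      by (rule integrable_sum_mset(2)[symmetric]) (rule ii, simp)
    also have "(\<Sum>l\<in>#spec N a. \<integral>x. ?F (Complex x (- 1)) * (1 / (of_real l - Complex x (- 1))) \<partial>lborel) =
        (\<integral>x. (\<Sum>l\<in>#spec N a. ?F (Complex x (- 1)) * (1 / (of_real l - Complex x (- 1)))) \<partial>lborel)"
      by (rule integrable_sum_mset(2)[symmetric]) (rule ii, simp)
    also have "(\<lambda>x. \<Sum>l\<in>#spec N a. ?F (Complex x 1) * (1 / (of_real l - Complex x 1))) = (\<lambda>x. ?F (Complex x 1) * ?T a x)"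
      by (rule ext) (rule tr(1))
    also have "(\<lambda>x. \<Sum>l\<in>#spec N a. ?F (Complex x (- 1)) * (1 / (of_real l - Complex x (- 1)))) = (\<lambda>x. ?F (Complex x (- 1)) * cnj (?T a x))"
      by (rule ext) (rule tr(2))
    finally show ?thesis .
  qed
  have "2 * pi * \<i> * goe_gauss_char N s = (\<integral>a. 2 * pi * \<i> * (\<Sum>x\<in>#spec N a. exp (- (1 / 4) * x\<^sup>2) *\<^sub>R iexp (s * x)) \<partial>?P)"
    unfolding goe_gauss_char_def by (rule integral_mult_right_zero[symmetric])
  also have "\<dots> = (\<integral>a. (\<integral>x. ?F (Complex x 1) * ?T a x \<partial>lborel) \<partial>?P) - (\<integral>a. (\<integral>x. ?F (Complex x (- 1)) * cnj (?T a x) \<partial>lborel) \<partial>?P)"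
    unfolding pw using PL.integrable_fst[OF i1] PL.integrable_fst[OF i2] by (intro Bochner_Integration.integral_diff) auto
  also have "(\<integral>a. (\<integral>x. ?F (Complex x 1) * ?T a x \<partial>lborel) \<partial>?P) = (\<integral>x. ?F (Complex x 1) * g x \<partial>lborel)"
    unfolding g1[symmetric] by (rule PL.Fubini_integral[OF i1, symmetric])
  also have "(\<integral>a. (\<integral>x. ?F (Complex x (- 1)) * cnj (?T a x) \<partial>lborel) \<partial>?P) = (\<integral>x. ?F (Complex x (- 1)) * cnj (g x) \<partial>lborel)"
    unfolding g2[symmetric] by (rule PL.Fubini_integral[OF i2, symmetric])
  finally show "2 * pi * \<i> * goe_gauss_char N s =
      (\<integral>x. ?F (Complex x 1) * g x \<partial>lborel) - (\<integral>x. ?F (Complex x (- 1)) * cnj (g x) \<partial>lborel)" .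
qed

section \<open>Asymptotics of the characteristic functions\<close>

text \<open>Replace u by its limit \<i> on the upper line and by -\<i> on the lower one. The two
  integrals then add up to \<open>2 * \<i> * sqrt (4 * pi) * exp (- s\<^sup>2)\<close>, and division
  by \<open>2 * pi * \<i>\<close> gives the constant \<open>2 / sqrt pi\<close>. The error of the
  local law grows quadratically in x, which the Gaussian boundary values absorb. The bound is
  explicit in s because the frequency will vary with N.\<close>

lemma goe_gauss_char_asymptotic:
  "\<exists>K. \<forall>N s. 0 < N \<longrightarrow>
    cmod (goe_gauss_char N s / of_real (sqrt N) - of_real (2 / sqrt pi * exp (- s\<^sup>2))) \<le> K * exp \<bar>s\<bar> / sqrt N"
proof -
  let ?n = "normal_density 0 (sqrt 2)"
  \<comment> \<open>The numerator of the local law at z = x + \<i>, where the modulus of z is at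
    most \<open>\<bar>x\<bar> + 1\<close>.\<close>
  let ?b = "\<lambda>x::real. (\<bar>x\<bar> + 4) * (\<bar>x\<bar> + 5)"
  define Kb where "Kb = (\<integral>x. ?n x * ?b x \<partial>lborel)"
  have bi: "integrable lborel (\<lambda>x. ?n x * ?b x)"
  proof -
    have m: "integrable lborel (\<lambda>x. ?n x * \<bar>x\<bar> ^ k)" for k
      using integrable_normal_moment_abs[of "sqrt 2" 0 k] by simp
    have "?n x * ?b x = ?n x * \<bar>x\<bar> ^ 2 + 9 * (?n x * \<bar>x\<bar> ^ 1) + 20 * (?n x * \<bar>x\<bar> ^ 0)" for x
      by (simp add: algebra_simps power2_eq_square)
    then show ?thesis
      using m[of 2] m[of 1] m[of 0] by (simp only:) (intro Bochner_Integration.integrable_add integrable_mult_right)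
  qed
  have double_pi: "x \<le> y / pi" if "2 * pi * x \<le> 2 * y" for x y
    using that by (simp add: pos_le_divide_eq mult.commute)
  have "cmod (goe_gauss_char N s / of_real (sqrt N) - of_real (2 / sqrt pi * exp (- s\<^sup>2))) \<le>
      (sqrt (4 * pi) * exp (1 / 4) * Kb / pi) * exp \<bar>s\<bar> / sqrt N" if N: "0 < N" for N s
  proof -
    define g where "g x = (\<integral>a. resolvent_trace N a (Complex x 1) \<partial>goe_entries N 1)" for x
    define u where "u x = g x / of_real (sqrt N)" for x
    let ?F = "strip_test s" and ?c = "sqrt (4 * pi) * exp (1 / 4 + \<bar>s\<bar>)"
    let ?L = "goe_gauss_char N s"
    have sN: "0 < sqrt N" using N by simp
    have ub: "cmod (u x - \<i>) \<le> ?b x / sqrt N" for x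
    proof -
      have "cmod (u x - \<i>) \<le> (cmod (Complex x 1) + 3) * (cmod (Complex x 1) + 4) / sqrt N"
        unfolding u_def g_def by (rule goe_local_law) (use N in auto)
      also have "\<dots> \<le> ?b x / sqrt N"
        using cmod_le[of "Complex x 1"] sN by (intro divide_right_mono mult_mono) auto
      finally show ?thesis .
    qed
    have Fb: "cmod (?F (Complex x e)) \<le> ?c * ?n x" if e: "e = 1 \<or> e = - 1" for x e
    proof -
      have "1 / 4 - e * s \<le> 1 / 4 + \<bar>s\<bar>" using e by auto
      then have "sqrt (4 * pi) * exp (1 / 4 - e * s) * ?n x \<le> ?c * ?n x"
        by (intro mult_right_mono mult_left_mono) auto
      then show ?thesis unfolding strip_test_boundary[OF e] by (simp add: abs_mult)
    qed
    note gi = goe_gauss_char_resolvent(1,2)[of s N, folded g_def]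
    have i1: "integrable lborel (\<lambda>x. ?F (Complex x 1) * u x)"
      using gi(1) by (simp add: u_def times_divide_eq_right[symmetric] del: times_divide_eq_right) (simp add: integrable_divide)
    have i2: "integrable lborel (\<lambda>x. ?F (Complex x (- 1)) * cnj (u x))"
      using gi(2) by (simp add: u_def integrable_divide)
    have j1: "integrable lborel (\<lambda>x. ?F (Complex x 1) * (u x - \<i>))"
      unfolding right_diff_distrib using i1 strip_test_integral(1)[of 1 s] by (intro Bochner_Integration.integrable_diff integrable_mult_left) auto
    have j2: "integrable lborel (\<lambda>x. ?F (Complex x (- 1)) * (cnj (u x) + \<i>))"
      unfolding distrib_left using i2 strip_test_integral(1)[of "- 1" s] by (intro Bochner_Integration.integrable_add integrable_mult_left) auto
    have "2 * pi * \<i> * ?L / of_real (sqrt N) =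
        (\<integral>x. ?F (Complex x 1) * g x / of_real (sqrt N) \<partial>lborel) - (\<integral>x. ?F (Complex x (- 1)) * cnj (g x) / of_real (sqrt N) \<partial>lborel)"
      unfolding goe_gauss_char_resolvent(3)[of N s, folded g_def] by (simp only: integral_divide_zero diff_divide_distrib)
    then have 1: "2 * pi * \<i> * ?L / of_real (sqrt N) =
        (\<integral>x. ?F (Complex x 1) * u x \<partial>lborel) - (\<integral>x. ?F (Complex x (- 1)) * cnj (u x) \<partial>lborel)"
      by (simp add: u_def)
    \<comment> \<open>The main term in the same shape as \<open>1\<close>, so that the difference
      becomes a pair of integrals of the small quantities \<open>u x - \<i>\<close> and its
      conjugate.\<close>
    have 2: "2 * pi * \<i> * of_real (2 / sqrt pi * exp (- s\<^sup>2)) =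
        (\<integral>x. ?F (Complex x 1) * \<i> \<partial>lborel) + (\<integral>x. ?F (Complex x (- 1)) * \<i> \<partial>lborel)"
    proof -
      have "2 * pi * (2 / sqrt pi) = 2 * sqrt (4 * pi)"
        by (simp add: real_sqrt_mult field_simps)
      then have e: "2 * pi * (2 / sqrt pi) * exp (- s\<^sup>2) = 2 * (sqrt (4 * pi) * exp (- s\<^sup>2))"
        by simp
      have "2 * pi * \<i> * of_real (2 / sqrt pi * exp (- s\<^sup>2)) = of_real (2 * pi * (2 / sqrt pi) * exp (- s\<^sup>2)) * \<i>"
        by simp
      also have "\<dots> = of_real (sqrt (4 * pi) * exp (- s\<^sup>2)) * \<i> + of_real (sqrt (4 * pi) * exp (- s\<^sup>2)) * \<i>"
        unfolding e by (simp only: of_real_mult of_real_numeral) (simp add: algebra_simps)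
      finally show ?thesis
        by (simp only: integral_mult_left_zero strip_test_integral(2) simp_thms)
    qed
    have k1: "(\<integral>x. ?F (Complex x 1) * (u x - \<i>) \<partial>lborel) = (\<integral>x. ?F (Complex x 1) * u x \<partial>lborel) - (\<integral>x. ?F (Complex x 1) * \<i> \<partial>lborel)"
      unfolding right_diff_distrib using i1 strip_test_integral(1)[of 1 s] by (intro Bochner_Integration.integral_diff integrable_mult_left) auto
    have k2: "(\<integral>x. ?F (Complex x (- 1)) * (cnj (u x) + \<i>) \<partial>lborel) = (\<integral>x. ?F (Complex x (- 1)) * cnj (u x) \<partial>lborel) + (\<integral>x. ?F (Complex x (- 1)) * \<i> \<partial>lborel)"
      unfolding distrib_left using i2 strip_test_integral(1)[of "- 1" s] by (intro Bochner_Integration.integral_add integrable_mult_left) auto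
    have 3: "2 * pi * \<i> * (?L / of_real (sqrt N) - of_real (2 / sqrt pi * exp (- s\<^sup>2))) =
        (\<integral>x. ?F (Complex x 1) * (u x - \<i>) \<partial>lborel) - (\<integral>x. ?F (Complex x (- 1)) * (cnj (u x) + \<i>) \<partial>lborel)"
    proof -
      have "2 * pi * \<i> * (?L / of_real (sqrt N) - of_real (2 / sqrt pi * exp (- s\<^sup>2))) =
          2 * pi * \<i> * ?L / of_real (sqrt N) - 2 * pi * \<i> * of_real (2 / sqrt pi * exp (- s\<^sup>2))"
        by (simp only: right_diff_distrib times_divide_eq_right)
      then show ?thesis unfolding 1 2 k1 k2 by simp
    qed
    have bound: "cmod (\<integral>x. f x \<partial>lborel) \<le> ?c * Kb / sqrt N"
      if f: "integrable lborel f" "\<And>x. cmod (f x) \<le> ?c * ?n x * (?b x / sqrt N)" for f :: "real \<Rightarrow> complex"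
    proof -
      have "cmod (\<integral>x. f x \<partial>lborel) \<le> (\<integral>x. cmod (f x) \<partial>lborel)" by (rule integral_norm_bound)
      also have "\<dots> \<le> (\<integral>x. (?c / sqrt N) * (?n x * ?b x) \<partial>lborel)"
      proof (intro integral_mono integrable_norm integrable_mult_right f(1) bi)
        show "cmod (f x) \<le> (?c / sqrt N) * (?n x * ?b x)" for x
          using f(2)[of x] by (simp add: mult_ac)
      qed
      also have "\<dots> = ?c / sqrt N * Kb" unfolding Kb_def by (rule integral_mult_right_zero)
      finally show ?thesis by simp
    qed
    have b1: "cmod (\<integral>x. ?F (Complex x 1) * (u x - \<i>) \<partial>lborel) \<le> ?c * Kb / sqrt N"
      by (rule bound[OF j1]) (unfold norm_mult, intro mult_mono Fb ub, auto)
    have b2: "cmod (\<integral>x. ?F (Complex x (- 1)) * (cnj (u x) + \<i>) \<partial>lborel) \<le> ?c * Kb / sqrt N"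
    proof (rule bound[OF j2])
      fix x
      have "cmod (cnj (u x) + \<i>) = cmod (u x - \<i>)"
        using complex_mod_cnj[of "u x - \<i>"] by simp
      then show "cmod (?F (Complex x (- 1)) * (cnj (u x) + \<i>)) \<le> ?c * ?n x * (?b x / sqrt N)"
        unfolding norm_mult using Fb[of "- 1" x] ub[of x] by (intro mult_mono) auto
    qed
    have "2 * pi * cmod (?L / of_real (sqrt N) - of_real (2 / sqrt pi * exp (- s\<^sup>2))) =
      cmod (2 * pi * \<i> * (?L / of_real (sqrt N) - of_real (2 / sqrt pi * exp (- s\<^sup>2))))"
      by (simp only: norm_mult) simp
    also have "\<dots> \<le> 2 * (?c * Kb / sqrt N)"
      unfolding 3 using norm_triangle_ineq4 b1 b2 by (smt (verit))
    finally have "cmod (?L / of_real (sqrt N) - of_real (2 / sqrt pi * exp (- s\<^sup>2))) \<le> ?c * Kb / sqrt N / pi"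
      by (intro double_pi)
    then show ?thesis by (simp add: exp_add mult_ac)
  qed
  then show ?thesis by blast
qed

text \<open>Numerator and denominator are both of order \<open>sqrt N\<close>, which cancels. The
  frequency is a convergent sequence, since \<open>t / sqrt r\<close> changes with the
  dimension.\<close>

lemma goe_gauss_char_ratio_tendsto:
  assumes s: "s \<longlonglongrightarrow> S" and N: "filterlim N at_top sequentially"
  shows "(\<lambda>n. goe_gauss_char (N n) (s n) / goe_gauss_char (N n) 0) \<longlonglongrightarrow> of_real (exp (- S\<^sup>2))"
proof -
  obtain K where K: "\<And>N s. 0 < N \<Longrightarrow>
    cmod (goe_gauss_char N s / of_real (sqrt N) - of_real (2 / sqrt pi * exp (- s\<^sup>2))) \<le> K * exp \<bar>s\<bar> / sqrt N"
    using goe_gauss_char_asymptotic by blast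
  have ev: "\<forall>\<^sub>F n in sequentially. 0 < N n"
    using N[unfolded filterlim_at_top, rule_format, of 1] by eventually_elim simp
  have lim: "(\<lambda>n. goe_gauss_char (N n) (x n) / of_real (sqrt (N n))) \<longlonglongrightarrow> of_real (2 / sqrt pi * exp (- X\<^sup>2))"
    if x: "x \<longlonglongrightarrow> X" for x X
  proof -
    have "(\<lambda>n. goe_gauss_char (N n) (x n) / of_real (sqrt (N n)) - of_real (2 / sqrt pi * exp (- (x n)\<^sup>2))) \<longlonglongrightarrow> 0"
    proof (rule Lim_null_comparison)
      show "\<forall>\<^sub>F n in sequentially. norm (goe_gauss_char (N n) (x n) / of_real (sqrt (N n)) - of_real (2 / sqrt pi * exp (- (x n)\<^sup>2)))
          \<le> K * exp \<bar>x n\<bar> / sqrt (N n)"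
        using ev by eventually_elim (rule K)
      have "filterlim (\<lambda>n. sqrt (real (N n))) at_top sequentially"
        using N by (intro filterlim_compose[OF sqrt_at_top] filterlim_compose[OF filterlim_real_sequentially])
      moreover have "(\<lambda>n. K * exp \<bar>x n\<bar>) \<longlonglongrightarrow> K * exp \<bar>X\<bar>"
        by (intro tendsto_intros x)
      ultimately show "(\<lambda>n. K * exp \<bar>x n\<bar> / sqrt (N n)) \<longlonglongrightarrow> 0"
        by (intro real_tendsto_divide_at_top)
    qed
    moreover have "(\<lambda>n. complex_of_real (2 / sqrt pi * exp (- (x n)\<^sup>2))) \<longlonglongrightarrow> of_real (2 / sqrt pi * exp (- X\<^sup>2))"
      by (intro tendsto_intros x)
    ultimately show ?thesis
      using tendsto_add by fastforce
  qed
  have "(\<lambda>n. (goe_gauss_char (N n) (s n) / of_real (sqrt (N n))) / (goe_gauss_char (N n) 0 / of_real (sqrt (N n)))) \<longlonglongrightarrow>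
      of_real (2 / sqrt pi * exp (- S\<^sup>2)) / of_real (2 / sqrt pi * exp (- 0\<^sup>2))"
    by (intro tendsto_divide lim s tendsto_const) simp
  also have "complex_of_real (2 / sqrt pi * exp (- S\<^sup>2)) / of_real (2 / sqrt pi * exp (- 0\<^sup>2)) = of_real (exp (- S\<^sup>2))"
    by simp
  finally show ?thesis
    by (rule Lim_transform_eventually) (use ev in \<open>eventually_elim, simp\<close>)
qed

theorem theorem1p5:
  fixes w :: "real \<Rightarrow> real" and r :: ereal
  assumes "schwartz w"
    and "\<And>x. 0 \<le> w x"
    and "\<And>x. w (- x) = w x"
    and "\<exists>x. w x \<noteq> 0"
    and "1 \<le> r"
    and "(\<lambda>m. ereal (r_const w m)) \<longlonglongrightarrow> r"
  shows "weak_conv_m (\<lambda>m. sigma_meas w m)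
           (gauss_measure (if r = \<infinity> then 1 else (real_of_ereal r + 1) / real_of_ereal r))"
proof -
  \<comment> \<open>The reciprocal of r, with value 0 at infinity; all later limits depend on r only
    through l.\<close>
  define l where "l = (if r = \<infinity> then 0 else 1 / real_of_ereal r)"
  have l0: "0 \<le> l"
    using assms(5) by (cases r) (auto simp: l_def)
  have var: "(if r = \<infinity> then 1 else (real_of_ereal r + 1) / real_of_ereal r) = 1 + l"
    using assms(5) by (cases r) (auto simp: l_def add_divide_distrib)
  \<comment> \<open>The index is shifted by 2 so that every dimension satisfies the bound of the
    locale; weak convergence ignores the first two terms.\<close>
  have rw: "radial_weight w (n + 2)" for n
    using assms(1-4) by unfold_locales auto
  define R where "R n = r_const w (n + 2)" for n
  define \<kappa> where "\<kappa> n = omega_const w (n + 2) / s_check w (n + 2)" for n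
  have R1: "1 \<le> R n" for n unfolding R_def by (rule radial_weight.omega_ratio(5)[OF rw])
  have Rlim: "(\<lambda>n. ereal (R n)) \<longlonglongrightarrow> r"
    unfolding R_def using LIMSEQ_ignore_initial_segment[OF assms(6), of 2] .
  have Rinv: "(\<lambda>n. 1 / R n) \<longlonglongrightarrow> l"
  proof (cases "r = \<infinity>")
    case True
    then have "filterlim R at_top sequentially"
      using Rlim by (simp add: tendsto_PInfty_eq_at_top)
    then show ?thesis
      unfolding l_def using True by (simp add: tendsto_divide_0[OF tendsto_const] filterlim_at_top_imp_at_infinity)
  next
    case False
    then obtain r0 where r0: "r = ereal r0" "1 \<le> r0" using assms(5) by (cases r) auto
    have "R \<longlonglongrightarrow> r0" using Rlim r0 by simp
    then have "(\<lambda>n. 1 / R n) \<longlonglongrightarrow> 1 / r0" using r0 by (intro tendsto_intros) auto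
    then show ?thesis using r0 by (simp add: l_def)
  qed
  have \<kappa>lim: "\<kappa> \<longlonglongrightarrow> 0"
  proof (rule real_tendsto_sandwich)
    show "\<forall>\<^sub>F n in sequentially. 0 \<le> \<kappa> n"
      unfolding \<kappa>_def by (intro always_eventually allI radial_weight.omega_ratio(2)[OF rw])
    have "\<kappa> n \<le> 2 / (real n + 4)" for n
      using radial_weight.omega_ratio(3)[OF rw, of n] by (simp add: \<kappa>_def add.commute)
    then show "\<forall>\<^sub>F n in sequentially. \<kappa> n \<le> 2 / (real n + 4)" by simp
    show "(\<lambda>n. 2 / (real n + 4)) \<longlonglongrightarrow> 0" by real_asymp
  qed simp
  have rd: "real_distribution (sigma_meas w (n + 2))" for n
    by (rule radial_weight.sigma_meas_char(1)[OF rw])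
  have "weak_conv_m (\<lambda>n. sigma_meas w (n + 2)) (gauss_measure (1 + l))"
  proof (rule levy_continuity[OF rd real_distribution_gauss_measure])
    show "0 \<le> 1 + l" using l0 by simp
    fix t
    \<comment> \<open>Here N = (n + 2) + 1; the factors are written in terms of
      \<open>1 / R n\<close>, which converges even when \<open>R n\<close> does not.\<close>
    have ch: "char (sigma_meas w (n + 2)) t = of_real (exp (\<kappa> n * t\<^sup>2 / 2) * exp (- (1 - 1 / R n) * t\<^sup>2 / 2)) *
      (goe_gauss_char (n + 3) (t * sqrt (1 / R n)) / goe_gauss_char (n + 3) 0)" for n
    proof -
      have "(R n - 1) / R n = 1 - 1 / R n" using R1[of n] by (simp add: field_simps)
      moreover have "t / sqrt (R n) = t * sqrt (1 / R n)" by (simp add: real_sqrt_divide)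
      ultimately show ?thesis
        using radial_weight.sigma_meas_char(2)[OF rw, of n t] by (simp add: R_def \<kappa>_def numeral_3_eq_3)
    qed
    have "(\<lambda>n. t * sqrt (1 / R n)) \<longlonglongrightarrow> t * sqrt l"
      by (intro tendsto_intros Rinv)
    moreover have "filterlim (\<lambda>n::nat. n + 3) at_top sequentially"
      by (rule filterlim_add_const_nat_at_top)
    ultimately have "(\<lambda>n. goe_gauss_char (n + 3) (t * sqrt (1 / R n)) / goe_gauss_char (n + 3) 0) \<longlonglongrightarrow> of_real (exp (- (t * sqrt l)\<^sup>2))"
      by (rule goe_gauss_char_ratio_tendsto)
    moreover have "(\<lambda>n. complex_of_real (exp (\<kappa> n * t\<^sup>2 / 2) * exp (- (1 - 1 / R n) * t\<^sup>2 / 2))) \<longlonglongrightarrow>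
        of_real (exp (0 * t\<^sup>2 / 2) * exp (- (1 - l) * t\<^sup>2 / 2))"
      by (intro tendsto_intros \<kappa>lim Rinv) simp_all
    ultimately have "(\<lambda>n. char (sigma_meas w (n + 2)) t) \<longlonglongrightarrow>
        of_real (exp (0 * t\<^sup>2 / 2) * exp (- (1 - l) * t\<^sup>2 / 2)) * of_real (exp (- (t * sqrt l)\<^sup>2))"
      unfolding ch by (intro tendsto_mult)
    also have "complex_of_real (exp (0 * t\<^sup>2 / 2) * exp (- (1 - l) * t\<^sup>2 / 2)) * of_real (exp (- (t * sqrt l)\<^sup>2)) =
        char (gauss_measure (1 + l)) t"
    proof -
      \<comment> \<open>Variance 1 - l from the outer smoothing and 2 l from the flat spectrum add
        up to 1 + l.\<close>
      have "exp (- (1 - l) * t\<^sup>2 / 2) * exp (- (t * sqrt l)\<^sup>2) = exp (- (1 + l) * t\<^sup>2 / 2)"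
        using l0 by (simp add: exp_add[symmetric] power_mult_distrib algebra_simps diff_divide_distrib add_divide_distrib)
      note e = this
      have "complex_of_real (exp (0 * t\<^sup>2 / 2) * exp (- (1 - l) * t\<^sup>2 / 2)) * of_real (exp (- (t * sqrt l)\<^sup>2)) =
          of_real (exp (- (1 - l) * t\<^sup>2 / 2) * exp (- (t * sqrt l)\<^sup>2))"
        by simp
      also have "\<dots> = char (gauss_measure (1 + l)) t"
        unfolding e by (rule char_gauss_measure[symmetric]) (use l0 in simp)
      finally show ?thesis .
    qed
    finally show "(\<lambda>n. char (sigma_meas w (n + 2)) t) \<longlonglongrightarrow> char (gauss_measure (1 + l)) t" .
  qed
  then have "weak_conv_m (\<lambda>m. sigma_meas w m) (gauss_measure (1 + l))"
    unfolding weak_conv_m_def weak_conv_def by (auto intro: LIMSEQ_offset[where k = 2])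
  then show ?thesis unfolding var .
qed

end
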